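(* Fix $h>1$. There exists $R_0>0$ such that $\mathcal{S}_{R,e}>\mathcal{S}_R$ for every $R>R_0$ (with $R>h$). Hence, for every such $R$, every minimizer of the Sobolev quotient $\|\nabla v\|_{L^2(\Omega_R)}^2/\|v\|_{L^4(\Omega_R)}^2$ over $v\in H^1_0(\Omega_R)\setminus\{0\}$ is a function that is not even in the $x$-variable.
   Context: For $R>h>1$: $Q_R=(-R,R)\times(-h,h)\subset\mathbb{R}^2$, $B_1$ is the open unit disk centered at the origin, and $\Omega_R=Q_R\setminus\overline{B_1}$. All functions are real-valued scalar functions. $H^1_{0,e}(\Omega_R)$ is the subspace of those $u\in H^1_0(\Omega_R)$ that are even in $x$, i.e. $u(x,y)=u(-x,y)$ for (almost) every $(x,y)\in\Omega_R$. Define $$ \mathcal{S}_R=\min_{v\in H^1_0(\Omega_R)\setminus\{0\}}\frac{\|\nabla v\|_{L^2(\Omega_R)}^2}{\|v\|_{L^4(\Omega_R)}^2},\qquad \mathcal{S}_{R,e}=\min_{v\in H^1_{0,e}(\Omega_R)\setminus\{0\}}\frac{\|\nabla v\|_{L^2(\Omega_R)}^2}{\|v\|_{L^4(\Omega_R)}^2}. $$ *)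

theory Defs
  imports "HOL-Analysis.Analysis"
begin

definition partial_deriv :: "'a::euclidean_space \<Rightarrow> ('a \<Rightarrow> real) \<Rightarrow> 'a \<Rightarrow> real" where
  "partial_deriv i f x = frechet_derivative f (at x) i"

fun C_k :: "nat \<Rightarrow> ('a::euclidean_space \<Rightarrow> real) \<Rightarrow> bool" where
  "C_k 0 f \<longleftrightarrow> continuous_on UNIV f"
| "C_k (Suc k) f \<longleftrightarrow>
     (\<forall>x. f differentiable (at x)) \<and> (\<forall>i\<in>Basis. C_k k (partial_deriv i f))"

definition test_functions :: "'a::euclidean_space set \<Rightarrow> ('a \<Rightarrow> real) set" where
  "test_functions \<Omega> =
     {\<phi>. (\<forall>k. C_k k \<phi>) \<and> compact (closure {x. \<phi> x \<noteq> 0}) \<and> closure {x. \<phi> x \<noteq> 0} \<subseteq> \<Omega>}"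

text \<open>
  Elements of function spaces on \<open>\<Omega>\<close> are represented by functions on the whole space whose
  values outside \<open>\<Omega>\<close> are irrelevant; functions agreeing almost everywhere on \<open>\<Omega>\<close> represent the
  same element, so being zero and being even are understood almost everywhere on \<open>\<Omega>\<close>.
\<close>

definition Lp_norm :: "'a::euclidean_space set \<Rightarrow> real \<Rightarrow> ('a \<Rightarrow> 'b::real_normed_vector) \<Rightarrow> real" where
  "Lp_norm \<Omega> p f = (LINT x|lebesgue_on \<Omega>. norm (f x) powr p) powr (1 / p)"

definition L2 :: "'a::euclidean_space set \<Rightarrow> ('a \<Rightarrow> 'b::euclidean_space) set" where
  "L2 \<Omega> = {f \<in> borel_measurable (lebesgue_on \<Omega>).
              integrable (lebesgue_on \<Omega>) (\<lambda>x. (norm (f x))\<^sup>2)}"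

definition is_weak_gradient ::
  "'a::euclidean_space set \<Rightarrow> ('a \<Rightarrow> real) \<Rightarrow> ('a \<Rightarrow> 'a) \<Rightarrow> bool" where
  "is_weak_gradient \<Omega> u g \<longleftrightarrow>
     (\<forall>\<phi>\<in>test_functions \<Omega>. \<forall>i\<in>Basis.
        (LINT x|lebesgue_on \<Omega>. u x * partial_deriv i \<phi> x) =
        - (LINT x|lebesgue_on \<Omega>. (g x \<bullet> i) * \<phi> x))"

definition H1 :: "'a::euclidean_space set \<Rightarrow> ('a \<Rightarrow> real) set" where
  "H1 \<Omega> = {u \<in> L2 \<Omega>. \<exists>g\<in>L2 \<Omega>. is_weak_gradient \<Omega> u g}"

text \<open>The weak gradient of a member of \<open>H1 \<Omega>\<close>, unique up to equality almost everywhere on \<open>\<Omega>\<close>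
  when \<open>\<Omega>\<close> is open.\<close>

definition weak_gradient :: "'a::euclidean_space set \<Rightarrow> ('a \<Rightarrow> real) \<Rightarrow> 'a \<Rightarrow> 'a" where
  "weak_gradient \<Omega> u = (SOME g. g \<in> L2 \<Omega> \<and> is_weak_gradient \<Omega> u g)"

definition H1_norm :: "'a::euclidean_space set \<Rightarrow> ('a \<Rightarrow> real) \<Rightarrow> real" where
  "H1_norm \<Omega> u = sqrt ((Lp_norm \<Omega> 2 u)\<^sup>2 + (Lp_norm \<Omega> 2 (weak_gradient \<Omega> u))\<^sup>2)"

definition H1_0 :: "'a::euclidean_space set \<Rightarrow> ('a \<Rightarrow> real) set" where
  "H1_0 \<Omega> = {u \<in> H1 \<Omega>. \<forall>\<epsilon>>0. \<exists>\<phi>\<in>test_functions \<Omega>. H1_norm \<Omega> (\<lambda>x. u x - \<phi> x) < \<epsilon>}"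

definition ae_zero :: "'a::euclidean_space set \<Rightarrow> ('a \<Rightarrow> real) \<Rightarrow> bool" where
  "ae_zero \<Omega> u \<longleftrightarrow> (AE x in lebesgue_on \<Omega>. u x = 0)"

definition even_x :: "(real \<times> real) set \<Rightarrow> (real \<times> real \<Rightarrow> real) \<Rightarrow> bool" where
  "even_x \<Omega> u \<longleftrightarrow> (AE p in lebesgue_on \<Omega>. u p = u (- fst p, snd p))"

definition H1_0e :: "(real \<times> real) set \<Rightarrow> (real \<times> real \<Rightarrow> real) set" where
  "H1_0e \<Omega> = {u \<in> H1_0 \<Omega>. even_x \<Omega> u}"

definition sobolev_quotient :: "'a::euclidean_space set \<Rightarrow> ('a \<Rightarrow> real) \<Rightarrow> real" where
  "sobolev_quotient \<Omega> v = (Lp_norm \<Omega> 2 (weak_gradient \<Omega> v))\<^sup>2 / (Lp_norm \<Omega> 4 v)\<^sup>2"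

definition Q_rect :: "real \<Rightarrow> real \<Rightarrow> (real \<times> real) set" where
  "Q_rect h R = {-R<..<R} \<times> {-h<..<h}"

definition Omega :: "real \<Rightarrow> real \<Rightarrow> (real \<times> real) set" where
  "Omega h R = Q_rect h R - closure (ball 0 1)"

text \<open>These are minima, not merely infima: \<open>LEAST\<close> yields a specified value only because the
  minimum is attained.\<close>

definition S_R :: "real \<Rightarrow> real \<Rightarrow> real" where
  "S_R h R = (LEAST q. \<exists>v\<in>H1_0 (Omega h R). \<not> ae_zero (Omega h R) v \<and>
                         q = sobolev_quotient (Omega h R) v)"

definition S_Re :: "real \<Rightarrow> real \<Rightarrow> real" where
  "S_Re h R = (LEAST q. \<exists>v\<in>H1_0e (Omega h R). \<not> ae_zero (Omega h R) v \<and>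
                          q = sobolev_quotient (Omega h R) v)"

end

theory Submission
  imports Defs "HOL-Complex_Analysis.Great_Picard"
begin

text \<open>
  By density both constants are infima over test functions, and they are attained by Rellich's theorem.
  Let \<open>S\<close> be the infimum of the quotient over test functions of the strip \<open>\<bar>y\<bar> < h\<close> without hole. Moving an
  almost optimal test function far away from the hole shows that \<open>S_R\<close> is arbitrarily close to \<open>S\<close> for large
  \<open>R\<close>, so it suffices that even functions vanishing on the hole have quotient at least \<open>S + d\<close> for some \<open>d > 0\<close>
  independent of \<open>R\<close>. Suppose that such a function \<open>u \<ge> 0\<close> with \<open>\<parallel>u\<parallel>\<^sub>4 = 1\<close> has energy below \<open>S + d\<close>. Two far
  apart bumps cost \<open>sqrt 2\<close> times the optimal energy, so \<open>u\<close> cannot split into a left and a right half, and a fixed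
  part of \<open>\<integral> u\<^sup>4\<close> stays in a bounded part of the strip. On the other hand, comparing the energy of
  \<open>u + t \<phi>\<close> with \<open>S\<close> for a function \<open>\<phi> \<ge> 0\<close> that is strictly subharmonic off the hole bounds \<open>\<integral> u \<Delta>\<phi>\<close>
  by \<open>O(sqrt d)\<close>, which forces \<open>u\<close> to be small there: a contradiction for small \<open>d\<close>.
\<close>

section \<open>Smooth functions\<close>

text \<open>Why the hole matters: a nonnegative nonzero minimizer on the full strip would be
  positive everywhere by the strong maximum principle, so it could not vanish on a disk. Making this
  uniform in \<open>R\<close> meets an obstacle: the strip is invariant under horizontal
  translations, so almost minimizers may drift away from the hole; evenness is what excludes
  drifting. The positivity argument is carried out quantitatively on test functions, by perturbing
  almost minimizers instead of using an equation for minimizers. A compactly supported \<phi> \<ge>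
  0 has a maximum point, where it cannot be strictly subharmonic; the hole hides that point. The
  rate O(sqrt d) comes from balancing 2 t \<integral> u \<Delta>\<phi> \<le> d + t^2
  \<open>energy \<phi>\<close> with t = sqrt d. To turn the resulting bound, linear in u, into one
  on \<integral> u^4, large values of u must be controlled by \<integral> u^6, which is why the
  planar Sobolev inequality is proved for all even powers.\<close>

lemma partial_deriv_eq:
  assumes "(f has_derivative f') (at x)"
  shows "partial_deriv i f x = f' i"
  using frechet_derivative_at[OF assms] by (simp add: partial_deriv_def)

lemma C_k_SucI:
  assumes "\<And>x. (f has_derivative f' x) (at x)" "\<And>i. i \<in> Basis \<Longrightarrow> C_k k (\<lambda>x. f' x i)"
  shows "C_k (Suc k) f"
proof -
  have "partial_deriv i f = (\<lambda>x. f' x i)" for i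
    using partial_deriv_eq[OF assms(1)] by auto
  then show ?thesis using assms by (auto simp: differentiable_def)
qed

lemma C_k_Suc_derivative:
  assumes "C_k (Suc k) f"
  shows "(f has_derivative (\<lambda>v. \<Sum>i\<in>Basis. (v \<bullet> i) * partial_deriv i f x)) (at x)"
proof -
  have d: "(f has_derivative frechet_derivative f (at x)) (at x)"
    using assms by (auto simp: frechet_derivative_works)
  then have l: "linear (frechet_derivative f (at x))"
    by (rule has_derivative_linear)
  have "frechet_derivative f (at x) v = (\<Sum>i\<in>Basis. (v \<bullet> i) * partial_deriv i f x)" for v
  proof -
    have "frechet_derivative f (at x) v = frechet_derivative f (at x) (\<Sum>i\<in>Basis. (v \<bullet> i) *\<^sub>R i)"
      by (simp add: euclidean_representation)
    then show ?thesis
      by (simp add: linear_sum[OF l] linear_cmul[OF l] partial_deriv_def)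
  qed
  then have "frechet_derivative f (at x) = (\<lambda>v. \<Sum>i\<in>Basis. (v \<bullet> i) * partial_deriv i f x)" by blast
  with d show ?thesis by simp
qed

lemma C_k_Suc_D: "C_k (Suc k) f \<Longrightarrow> C_k k f"
proof (induction k arbitrary: f)
  case 0
  then show ?case
    by (auto simp: continuous_on_eq_continuous_at differentiable_imp_continuous_within)
next
  case (Suc k)
  then show ?case using C_k.simps(2) by blast
qed

lemma C_k_const [simp]: "C_k k (\<lambda>x::'a::euclidean_space. c)"
proof (induction k arbitrary: c)
  case (Suc k)
  show ?case by (rule C_k_SucI[where f' = "\<lambda>x v. 0"]) (auto intro: Suc)
qed auto

lemma C_k_bounded_linear:
  assumes "bounded_linear f"
  shows "C_k k f"
proof (cases k)
  case 0
  then show ?thesis using assms by (simp add: bounded_linear.linear linear_continuous_on)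
next
  case (Suc n)
  show ?thesis unfolding Suc
    by (rule C_k_SucI[where f' = "\<lambda>x. f"]) (auto intro: bounded_linear_imp_has_derivative assms)
qed

lemma C_k_add: "C_k k f \<Longrightarrow> C_k k g \<Longrightarrow> C_k k (\<lambda>x. f x + g x)"
proof (induction k arbitrary: f g)
  case 0
  then show ?case by (auto intro: continuous_intros)
next
  case (Suc k)
  show ?case
  proof (rule C_k_SucI)
    fix x
    show "((\<lambda>x. f x + g x) has_derivative (\<lambda>v. frechet_derivative f (at x) v + frechet_derivative g (at x) v)) (at x)"
      using Suc.prems by (auto intro!: has_derivative_add simp: frechet_derivative_works[symmetric])
  next
    fix i :: 'a assume "i \<in> Basis"
    then show "C_k k (\<lambda>x. frechet_derivative f (at x) i + frechet_derivative g (at x) i)"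
      using Suc by (auto simp: partial_deriv_def[abs_def])
  qed
qed

lemma C_k_mult: "C_k k f \<Longrightarrow> C_k k g \<Longrightarrow> C_k k (\<lambda>x. f x * g x)"
proof (induction k arbitrary: f g)
  case 0
  then show ?case by (auto intro: continuous_intros)
next
  case (Suc k)
  show ?case
  proof (rule C_k_SucI)
    fix x
    show "((\<lambda>x. f x * g x) has_derivative (\<lambda>v. f x * frechet_derivative g (at x) v + frechet_derivative f (at x) v * g x)) (at x)"
      using Suc.prems by (auto intro!: has_derivative_mult simp: frechet_derivative_works[symmetric])
  next
    fix i :: 'a assume i: "i \<in> Basis"
    have "C_k k (\<lambda>x. frechet_derivative f (at x) i)" "C_k k (\<lambda>x. frechet_derivative g (at x) i)"
      using Suc.prems i by (auto simp: partial_deriv_def[abs_def])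
    then show "C_k k (\<lambda>x. f x * frechet_derivative g (at x) i + frechet_derivative f (at x) i * g x)"
      by (intro C_k_add Suc.IH C_k_Suc_D[OF Suc.prems(1)] C_k_Suc_D[OF Suc.prems(2)])
  qed
qed

lemma C_k_compose_real:
  fixes g :: "real \<Rightarrow> real"
  shows "C_k k g \<Longrightarrow> C_k k f \<Longrightarrow> C_k k (\<lambda>x. g (f x))"
proof (induction k arbitrary: f g)
  case 0
  then show ?case
    by (auto intro: continuous_on_compose2[where t=UNIV])
next
  case (Suc k)
  show ?case
  proof (rule C_k_SucI)
    fix x
    have g: "(g has_derivative (\<lambda>v. v * partial_deriv 1 g (f x))) (at (f x))"
      using C_k_Suc_derivative[OF Suc.prems(1), of "f x"] by simp
    have f: "(f has_derivative frechet_derivative f (at x)) (at x)"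
      using Suc.prems(2) by (auto simp: frechet_derivative_works)
    show "((\<lambda>x. g (f x)) has_derivative (\<lambda>v. frechet_derivative f (at x) v * partial_deriv 1 g (f x))) (at x)"
      by (rule has_derivative_compose[OF f g])
  next
    fix i :: 'a assume i: "i \<in> Basis"
    have "C_k k (\<lambda>x. frechet_derivative f (at x) i)"
      using Suc.prems i by (auto simp: partial_deriv_def[abs_def])
    moreover have "C_k k (\<lambda>x. partial_deriv 1 g (f x))"
      by (rule Suc.IH[OF _ C_k_Suc_D[OF Suc.prems(2)]]) (use Suc.prems(1) in simp)
    ultimately show "C_k k (\<lambda>x. frechet_derivative f (at x) i * partial_deriv 1 g (f x))"
      by (rule C_k_mult)
  qed
qed

lemma C_k_translate: "C_k k f \<Longrightarrow> C_k k (\<lambda>x. f (x + c))"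
proof (induction k arbitrary: f)
  case 0
  have "continuous_on UNIV (\<lambda>x. x + c)" by (intro continuous_intros)
  with 0 show ?case by (auto intro: continuous_on_compose2[where t=UNIV])
next
  case (Suc k)
  show ?case
  proof (rule C_k_SucI)
    fix x
    have f: "(f has_derivative frechet_derivative f (at (x + c))) (at (x + c))"
      using Suc.prems by (auto simp: frechet_derivative_works)
    have "((\<lambda>x. x + c) has_derivative (\<lambda>v. v)) (at x)"
      by (auto intro!: derivative_eq_intros)
    from has_derivative_compose[OF this f]
    show "((\<lambda>x. f (x + c)) has_derivative frechet_derivative f (at (x + c))) (at x)" .
  next
    fix i :: 'a assume "i \<in> Basis"
    then show "C_k k (\<lambda>x. frechet_derivative f (at (x + c)) i)"
      using Suc by (auto simp: partial_deriv_def[abs_def])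
  qed
qed

section \<open>The reflection in the vertical axis\<close>

definition reflect_x :: "real \<times> real \<Rightarrow> real \<times> real" where
  "reflect_x p = (- fst p, snd p)"

lemma reflect_x_reflect_x [simp]: "reflect_x (reflect_x p) = p"
  by (simp add: reflect_x_def)

lemma norm_reflect_x [simp]: "norm (reflect_x p) = norm p"
  by (cases p) (simp add: reflect_x_def norm_Pair)

lemma linear_reflect_x: "linear reflect_x"
  by (auto simp: linear_iff reflect_x_def)

lemma Basis_plane: "(Basis :: (real \<times> real) set) = {(1, 0), (0, 1)}"
  by (auto simp: Basis_prod_def)

lemma C_k_reflect_x: "C_k k f \<Longrightarrow> C_k k (\<lambda>p. f (reflect_x p))"
proof (induction k arbitrary: f)
  case 0
  have "continuous_on UNIV reflect_x"
    by (rule linear_continuous_on) (simp add: linear_linear linear_reflect_x)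
  with 0 show ?case
    by (auto intro: continuous_on_compose2[where t=UNIV])
next
  case (Suc k)
  show ?case
  proof (rule C_k_SucI)
    fix x
    have f: "(f has_derivative frechet_derivative f (at (reflect_x x))) (at (reflect_x x))"
      using Suc.prems by (simp add: frechet_derivative_works del: split_paired_All)
    have "(reflect_x has_derivative reflect_x) (at x)"
      by (intro linear_imp_has_derivative linear_reflect_x)
    from has_derivative_compose[OF this f]
    show "((\<lambda>x. f (reflect_x x)) has_derivative (\<lambda>v. frechet_derivative f (at (reflect_x x)) (reflect_x v))) (at x)" .
  next
    fix i :: "real \<times> real" assume "i \<in> Basis"
    \<comment> \<open>Basis vectors are eigenvectors of the reflection, so a partial derivative of
      the reflected function is a multiple of the reflected partial derivative and the induction
      closes.\<close>
    then obtain c where c: "reflect_x i = c *\<^sub>R i"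
      by (force simp: Basis_plane reflect_x_def intro: that[of 1] that[of "-1"])
    have "linear (frechet_derivative f (at (reflect_x x)))" for x
      using Suc.prems by (intro linear_frechet_derivative) (simp del: split_paired_All)
    then have *: "frechet_derivative f (at (reflect_x x)) (reflect_x i) = c * partial_deriv i f (reflect_x x)" for x
      by (simp add: c linear_cmul partial_deriv_def)
    show "C_k k (\<lambda>x. frechet_derivative f (at (reflect_x x)) (reflect_x i))"
      unfolding * using Suc \<open>i \<in> Basis\<close> by (intro C_k_mult C_k_const) auto
  qed
qed

section \<open>Infinitely differentiable functions and their closure properties\<close>

definition smooth :: "('a::euclidean_space \<Rightarrow> real) \<Rightarrow> bool" where
  "smooth f \<longleftrightarrow> (\<forall>k. C_k k f)"

named_theorems smooth_intros

lemma smooth_const [smooth_intros]: "smooth (\<lambda>x. c)"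
  by (simp add: smooth_def)

lemma smooth_add [smooth_intros]: "smooth f \<Longrightarrow> smooth g \<Longrightarrow> smooth (\<lambda>x. f x + g x)"
  by (simp add: smooth_def C_k_add)

lemma smooth_mult [smooth_intros]: "smooth f \<Longrightarrow> smooth g \<Longrightarrow> smooth (\<lambda>x. f x * g x)"
  by (simp add: smooth_def C_k_mult)

lemma smooth_minus [smooth_intros]: "smooth f \<Longrightarrow> smooth (\<lambda>x. - f x)"
  using smooth_mult[OF smooth_const[of "-1"], of f] by simp

lemma smooth_diff [smooth_intros]: "smooth f \<Longrightarrow> smooth g \<Longrightarrow> smooth (\<lambda>x. f x - g x)"
  using smooth_add[of f "\<lambda>x. - g x"] smooth_minus[of g] by simp

lemma smooth_divide_const [smooth_intros]: "smooth f \<Longrightarrow> smooth (\<lambda>x. f x / c)"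
  using smooth_mult[of f "\<lambda>x. 1/c"] smooth_const[of "1/c"] by simp

lemma smooth_power [smooth_intros]: "smooth f \<Longrightarrow> smooth (\<lambda>x. f x ^ n)"
  by (induction n) (auto intro: smooth_intros)

lemma smooth_compose: "smooth (g :: real \<Rightarrow> real) \<Longrightarrow> smooth f \<Longrightarrow> smooth (\<lambda>x. g (f x))"
  by (simp add: smooth_def C_k_compose_real)

lemma smooth_fst [smooth_intros]: "smooth (fst :: real \<times> real \<Rightarrow> real)"
  and smooth_snd [smooth_intros]: "smooth (snd :: real \<times> real \<Rightarrow> real)"
  by (simp_all add: smooth_def C_k_bounded_linear bounded_linear_fst bounded_linear_snd)

lemma smooth_translate: "smooth f \<Longrightarrow> smooth (\<lambda>x. f (x + c))"
  by (simp add: smooth_def C_k_translate)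

lemma smooth_reflect_x: "smooth f \<Longrightarrow> smooth (\<lambda>x. f (reflect_x x))"
  by (simp add: smooth_def C_k_reflect_x)

lemma smooth_partial_deriv [smooth_intros]: "smooth f \<Longrightarrow> i \<in> Basis \<Longrightarrow> smooth (partial_deriv i f)"
  using C_k.simps(2)[of _ f] unfolding smooth_def by blast

lemma smooth_differentiable: "smooth f \<Longrightarrow> f differentiable (at x)"
  using C_k.simps(2)[of 0 f] unfolding smooth_def by blast

lemma smooth_continuous_on: "smooth f \<Longrightarrow> continuous_on A f"
  using C_k.simps(1)[of f] continuous_on_subset[of UNIV f A] unfolding smooth_def by blast

section \<open>Explicit smooth functions of one real variable\<close>

lemma C_k_Suc_realI:
  fixes g :: "real \<Rightarrow> real"
  assumes "\<And>x. (g has_real_derivative g' x) (at x)" "C_k k g'"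
  shows "C_k (Suc k) g"
proof (rule C_k_SucI)
  show "(g has_derivative (\<lambda>v. g' x * v)) (at x)" for x
    using assms(1) by (simp add: has_field_derivative_def)
  fix i :: real assume "i \<in> Basis"
  then have "i = 1" by simp
  then show "C_k k (\<lambda>x. g' x * i)" using assms(2) by simp
qed

lemma C_k_0_realI:
  fixes g :: "real \<Rightarrow> real"
  assumes "\<And>x. (g has_real_derivative g' x) (at x)"
  shows "C_k 0 g"
proof -
  have "isCont g x" for x using DERIV_isCont[OF assms] .
  then show ?thesis by (simp add: continuous_at_imp_continuous_on)
qed

lemma smooth_realI:
  fixes g :: "real \<Rightarrow> real"
  assumes "\<And>x. (g has_real_derivative g' x) (at x)" "smooth g'"
  shows "smooth g"
  unfolding smooth_def
proof
  fix k show "C_k k g"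
  proof (cases k)
    case 0
    then show ?thesis using C_k_0_realI[OF assms(1)] by simp
  next
    case (Suc n)
    have "C_k n g'" using assms(2) by (simp add: smooth_def)
    then show ?thesis unfolding Suc by (rule C_k_Suc_realI[OF assms(1)])
  qed
qed

lemma smooth_exp: "smooth (exp :: real \<Rightarrow> real)"
  unfolding smooth_def
proof
  fix k show "C_k k (exp :: real \<Rightarrow> real)"
    by (induction k) (auto intro: C_k_0_realI[OF DERIV_exp] C_k_Suc_realI[OF DERIV_exp] simp del: C_k.simps)
qed

lemma C_k_sin_cos: "C_k k (sin :: real \<Rightarrow> real) \<and> C_k k (cos :: real \<Rightarrow> real)"
proof (induction k)
  case 0
  then show ?case by (auto intro: continuous_intros)
next
  case (Suc k)
  have "C_k k (\<lambda>x::real. - 1 * sin x)" using Suc by (intro C_k_mult C_k_const) auto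
  then show ?case using Suc
    using C_k_Suc_realI[OF DERIV_sin, of k] C_k_Suc_realI[OF DERIV_cos, of k] by simp
qed

lemma smooth_sin: "smooth (sin :: real \<Rightarrow> real)" and smooth_cos: "smooth (cos :: real \<Rightarrow> real)"
  using C_k_sin_cos by (auto simp: smooth_def)

text \<open>The exponent is general because each derivative lowers it by one, which closes the
  induction. The case s = -1, e = 1 is the derivative of \<open>arctan\<close>; the case s = 1/2
  serves to smooth the absolute value.\<close>

lemma smooth_square_plus_powr:
  assumes "e > 0"
  shows "smooth (\<lambda>x::real. (x\<^sup>2 + e) powr s)"
  unfolding smooth_def
proof
  fix k
  have d: "((\<lambda>x. (x\<^sup>2 + e) powr s) has_real_derivative 2 * s * x * (x\<^sup>2 + e) powr (s - 1)) (at x)" for x s :: real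
  proof -
    have "x\<^sup>2 + e > 0" using assms by (simp add: add_nonneg_pos)
    then show ?thesis by (auto intro!: derivative_eq_intros)
  qed
  show "C_k k (\<lambda>x. (x\<^sup>2 + e) powr s)"
  proof (induction k arbitrary: s)
    case 0
    show ?case by (rule C_k_0_realI[OF d])
  next
    case (Suc k)
    have "C_k k (\<lambda>x. 2 * s * x * (x\<^sup>2 + e) powr (s - 1))"
      by (intro C_k_mult Suc C_k_const) (simp add: C_k_bounded_linear bounded_linear_ident)
    then show ?case by (rule C_k_Suc_realI[OF d])
  qed
qed

lemma smooth_arctan: "smooth (arctan :: real \<Rightarrow> real)"
proof (rule smooth_realI)
  show "(arctan has_real_derivative ((x\<^sup>2 + 1) powr (-1))) (at x)" for x :: real
    using DERIV_arctan[of x] by (simp add: powr_minus add.commute powr_one_gt_zero_iff add_nonneg_pos)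
  show "smooth (\<lambda>x::real. (x\<^sup>2 + 1) powr (-1))" by (rule smooth_square_plus_powr) simp
qed

text \<open>The classical function exp(-1/x) extended by zero, divided by powers of x: every
  derivative of \<open>flat n\<close> is a combination of members of the family.\<close>

definition flat :: "nat \<Rightarrow> real \<Rightarrow> real" where
  "flat n x = (if x > 0 then exp (- (1 / x)) / x ^ n else 0)"

lemma flat_quotient_tendsto: "((\<lambda>x. exp (- (1 / x)) / x ^ n) \<longlongrightarrow> 0) (at_right (0::real))"
proof -
  have "((\<lambda>y::real. y ^ n / exp y) \<longlongrightarrow> 0) at_top"
    by (rule tendsto_power_div_exp_0)
  then have "((\<lambda>x. (inverse x) ^ n / exp (inverse x)) \<longlongrightarrow> 0) (at_right (0::real))"
    using filterlim_inverse_at_top_right by (rule filterlim_compose)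
  moreover have "(inverse x) ^ n / exp (inverse x) = exp (- (1 / x)) / x ^ n" for x :: real
    by (simp add: exp_minus field_simps inverse_eq_divide power_divide)
  ultimately show ?thesis by simp
qed

lemma flat_has_derivative:
  "(flat n has_real_derivative flat (n + 2) x - n * flat (n + 1) x) (at x)"
proof -
  consider "x > 0" | "x < 0" | "x = 0" by linarith
  then show ?thesis
  proof cases
    case 1
    have "((\<lambda>x. exp (- (1 / x)) / x ^ n) has_real_derivative flat (n + 2) x - n * flat (n + 1) x) (at x)"
      using 1 by (auto intro!: derivative_eq_intros simp: flat_def)
        (cases n; simp add: field_simps power2_eq_square)
    then show ?thesis
      by (rule has_field_derivative_transform_within_open[where S = "{0<..}"]) (use 1 in \<open>auto simp: flat_def\<close>)
  next
    case 2
    have "((\<lambda>x. 0) has_real_derivative flat (n + 2) x - n * flat (n + 1) x) (at x)"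
      using 2 by (simp add: flat_def)
    then show ?thesis
      by (rule has_field_derivative_transform_within_open[where S = "{..<0}"]) (use 2 in \<open>auto simp: flat_def\<close>)
  next
    case 3
    \<comment> \<open>The right difference quotient at 0 is \<open>flat (Suc n)\<close>: the
      exponential decay absorbs one more power of x.\<close>
    have r: "((\<lambda>x. flat n x / x) \<longlongrightarrow> 0) (at_right 0)"
      by (rule tendsto_cong[THEN iffD1, OF _ flat_quotient_tendsto[of "Suc n"]])
        (auto simp: flat_def eventually_at_filter)
    have l: "((\<lambda>x. flat n x / x) \<longlongrightarrow> 0) (at_left 0)"
      by (rule tendsto_cong[THEN iffD1, OF _ tendsto_const])
        (auto simp: flat_def eventually_at_filter)
    have "((\<lambda>x. flat n x / x) \<longlongrightarrow> 0) (at 0)"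
      using l r by (simp add: filterlim_split_at)
    then show ?thesis using 3 by (simp add: has_field_derivative_iff flat_def)
  qed
qed

lemma smooth_flat: "smooth (flat n)"
  unfolding smooth_def
proof
  fix k show "C_k k (flat n)"
  proof (induction k arbitrary: n)
    case 0
    show ?case by (rule C_k_0_realI[OF flat_has_derivative])
  next
    case (Suc k)
    have "C_k k (\<lambda>x. flat (n + 2) x + (- real n) * flat (n + 1) x)"
      by (intro C_k_add C_k_mult C_k_const Suc)
    then show ?case
      by (intro C_k_Suc_realI[OF flat_has_derivative]) simp
  qed
qed

lemma flat_nonneg [simp]: "0 \<le> flat n x" and flat_pos: "0 < x \<Longrightarrow> 0 < flat n x"
  and flat_eq_0: "x \<le> 0 \<Longrightarrow> flat n x = 0"
  by (auto simp: flat_def)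

section \<open>Functions of compact support\<close>

definition csupp :: "('a::real_normed_vector \<Rightarrow> real) \<Rightarrow> bool" where
  "csupp f \<longleftrightarrow> (\<exists>r. \<forall>x. r < norm x \<longrightarrow> f x = 0)"

named_theorems csupp_intros

lemma csupp_subset: "csupp f \<Longrightarrow> (\<And>x. f x = 0 \<Longrightarrow> g x = 0) \<Longrightarrow> csupp g"
  unfolding csupp_def by blast

lemma csupp_mult_left [csupp_intros]: "csupp f \<Longrightarrow> csupp (\<lambda>x. f x * g x)"
  and csupp_mult_right [csupp_intros]: "csupp g \<Longrightarrow> csupp (\<lambda>x. f x * g x)"
  and csupp_minus [csupp_intros]: "csupp f \<Longrightarrow> csupp (\<lambda>x. - f x)"
  and csupp_abs [csupp_intros]: "csupp f \<Longrightarrow> csupp (\<lambda>x. \<bar>f x\<bar>)"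
  and csupp_power [csupp_intros]: "0 < n \<Longrightarrow> csupp f \<Longrightarrow> csupp (\<lambda>x. f x ^ n)"
  and csupp_divide [csupp_intros]: "csupp f \<Longrightarrow> csupp (\<lambda>x. f x / c)"
  by (erule csupp_subset; simp)+

lemma csupp_add [csupp_intros]:
  assumes "csupp f" "csupp g" shows "csupp (\<lambda>x. f x + g x)"
proof -
  obtain r s where "\<forall>x. r < norm x \<longrightarrow> f x = 0" "\<forall>x. s < norm x \<longrightarrow> g x = 0"
    using assms unfolding csupp_def by blast
  then show ?thesis unfolding csupp_def by (intro exI[of _ "max r s"]) auto
qed

lemma csupp_diff [csupp_intros]: "csupp f \<Longrightarrow> csupp g \<Longrightarrow> csupp (\<lambda>x. f x - g x)"
  using csupp_add[of f "\<lambda>x. - g x"] csupp_minus[of g] by simp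

lemma csupp_translate:
  assumes "csupp f" shows "csupp (\<lambda>x. f (x + c))"
proof -
  obtain r where r: "\<forall>x. r < norm x \<longrightarrow> f x = 0" using assms unfolding csupp_def by blast
  have "f (x + c) = 0" if "r + norm c < norm x" for x
    using that norm_triangle_ineq4[of "x + c" c] r by auto
  then show ?thesis unfolding csupp_def by blast
qed

lemma csupp_reflect_x: "csupp f \<Longrightarrow> csupp (\<lambda>x. f (reflect_x x))"
  unfolding csupp_def by (metis norm_reflect_x)

lemma csupp_bounded:
  fixes f :: "'a::euclidean_space \<Rightarrow> real"
  assumes "continuous_on UNIV f" "csupp f"
  obtains B where "0 \<le> B" "\<And>x. \<bar>f x\<bar> \<le> B"
proof -
  obtain r where r: "\<forall>x. r < norm x \<longrightarrow> f x = 0" using assms(2) unfolding csupp_def by blast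
  have "bounded (f ` cball 0 r)"
    by (intro compact_imp_bounded compact_continuous_image continuous_on_subset[OF assms(1)]) auto
  then obtain B where "\<forall>y\<in>f ` cball 0 r. norm y \<le> B" unfolding bounded_iff by blast
  then have B: "norm x \<le> r \<Longrightarrow> \<bar>f x\<bar> \<le> B" for x by auto
  have "\<bar>f x\<bar> \<le> max B 0" for x using B[of x] r by (cases "norm x \<le> r") auto
  then show ?thesis using that[of "max B 0"] by simp
qed

lemma integrable_csupp:
  fixes f :: "'a::euclidean_space \<Rightarrow> real"
  assumes "continuous_on UNIV f" "csupp f"
  shows "integrable lborel f"
proof -
  obtain r where r: "\<forall>x. r < norm x \<longrightarrow> f x = 0" using assms(2) unfolding csupp_def by blast
  have "integrable lborel (\<lambda>x. indicator (cball 0 r) x *\<^sub>R f x)"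
    by (intro borel_integrable_compact continuous_on_subset[OF assms(1)]) auto
  moreover have "(\<lambda>x. indicator (cball 0 r) x *\<^sub>R f x) = f"
    using r by (auto simp: fun_eq_iff indicator_def)
  ultimately show ?thesis by simp
qed

lemma partial_deriv_outside:
  assumes "open U" "\<And>x. x \<in> U \<Longrightarrow> f x = 0" "x \<in> U"
  shows "partial_deriv i f x = 0"
proof -
  have "((\<lambda>x. 0) has_derivative (\<lambda>v. 0)) (at x)" by simp
  then have "(f has_derivative (\<lambda>v. 0)) (at x)"
    by (rule has_derivative_transform_within_open[OF _ assms(1,3)]) (use assms(2) in auto)
  then show ?thesis using partial_deriv_eq by blast
qed

lemma partial_deriv_outside_ball:
  assumes "\<forall>x. r < norm x \<longrightarrow> f x = 0" "r < norm x"
  shows "partial_deriv i f x = 0"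
proof (rule partial_deriv_outside)
  show "open {x::'a. r < norm x}" by (intro open_Collect_less continuous_intros)
qed (use assms in auto)

lemma csupp_partial_deriv [csupp_intros]: "csupp f \<Longrightarrow> csupp (partial_deriv i f)"
  unfolding csupp_def using partial_deriv_outside_ball by blast

lemma smooth_has_derivative: "smooth f \<Longrightarrow> (f has_derivative frechet_derivative f (at x)) (at x)"
  using smooth_differentiable frechet_derivative_works by blast

lemma smooth_line_derivative:
  assumes "smooth f"
  shows "((\<lambda>t. f (x + t *\<^sub>R v)) has_real_derivative frechet_derivative f (at (x + t *\<^sub>R v)) v) (at t)"
proof -
  have 1: "((\<lambda>t. x + t *\<^sub>R v) has_derivative (\<lambda>s. s *\<^sub>R v)) (at t)"
    by (auto intro!: derivative_eq_intros)
  note d = smooth_has_derivative[OF assms, of "x + t *\<^sub>R v"]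
  have "linear (frechet_derivative f (at (x + t *\<^sub>R v)))" using d by (rule has_derivative_linear)
  then have "(\<lambda>s. frechet_derivative f (at (x + t *\<^sub>R v)) (s *\<^sub>R v)) = (*) (frechet_derivative f (at (x + t *\<^sub>R v)) v)"
    by (auto simp: linear_cmul)
  then show ?thesis using has_derivative_compose[OF 1 d] by (simp add: has_field_derivative_def)
qed

section \<open>Integration by parts and Sobolev inequalities\<close>

lemma integral_translate:
  fixes f :: "'a::euclidean_space \<Rightarrow> real"
  assumes "f \<in> borel_measurable borel"
  shows "(\<integral>x. f (x + c) \<partial>lborel) = (\<integral>x. f x \<partial>lborel)"
proof -
  have "(\<integral>x. f x \<partial>lborel) = (\<integral>x. f x \<partial>distr lborel borel ((+) c))" by (simp add: lborel_distr_plus)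
  also have "\<dots> = (\<integral>x. f (c + x) \<partial>lborel)" by (rule integral_distr) (use assms in auto)
  finally show ?thesis by (simp add: add.commute)
qed

text \<open>A diagonal change of variables with factors -1 and 1, whose product has modulus
  1.\<close>

lemma distr_reflect_x: "distr lborel borel reflect_x = lborel"
proof -
  define c :: "real \<times> real \<Rightarrow> real" where "c j = (if j = (1, 0) then -1 else 1)" for j
  have T: "(\<lambda>x. 0 + (\<Sum>j\<in>Basis. (c j * (x \<bullet> j)) *\<^sub>R j)) = reflect_x"
    by (auto simp: fun_eq_iff reflect_x_def c_def Basis_plane)
  have "lborel = density (distr lborel borel (\<lambda>x. 0 + (\<Sum>j\<in>Basis. (c j * (x \<bullet> j)) *\<^sub>R j))) (\<lambda>_. (\<Prod>j\<in>Basis. \<bar>c j\<bar>))"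
    by (rule lborel_affine_euclidean) (auto simp: c_def)
  also have "(\<lambda>_::real\<times>real. (\<Prod>j\<in>Basis. \<bar>c j\<bar>)) = (\<lambda>_. 1)" by (auto simp: c_def Basis_plane)
  finally show ?thesis unfolding T by (simp add: density_1)
qed

lemma measurable_reflect_x [measurable]: "reflect_x \<in> borel_measurable borel"
proof (rule borel_measurable_continuous_onI)
  show "continuous_on UNIV reflect_x"
    unfolding reflect_x_def[abs_def] by (intro continuous_intros)
qed

lemma integral_reflect_x:
  fixes f :: "real \<times> real \<Rightarrow> real"
  assumes "f \<in> borel_measurable borel"
  shows "(\<integral>x. f (reflect_x x) \<partial>lborel) = (\<integral>x. f x \<partial>lborel)"
  by (subst distr_reflect_x[symmetric], subst integral_distr) (use assms in auto)

text \<open>Each difference quotient of \<open>f\<close> has integral 0 by translation invariance,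
  and the quotients converge to the derivative with a common integrable bound.\<close>

lemma integral_partial_deriv_eq_0:
  fixes f :: "'a::euclidean_space \<Rightarrow> real"
  assumes f: "smooth f" "csupp f" and i: "i \<in> Basis"
  shows "(\<integral>x. partial_deriv i f x \<partial>lborel) = 0"
proof -
  obtain r where r: "\<forall>x. r < norm x \<longrightarrow> f x = 0" using f(2) unfolding csupp_def by blast
  have sm: "smooth (partial_deriv i f)" using f i by (intro smooth_intros)
  obtain B where B: "0 \<le> B" "\<And>x. \<bar>partial_deriv i f x\<bar> \<le> B"
    using csupp_bounded[OF smooth_continuous_on[OF sm] csupp_partial_deriv[OF f(2)]] by blast
  have [measurable]: "f \<in> borel_measurable borel" "partial_deriv i f \<in> borel_measurable borel"
    using f sm by (auto intro!: borel_measurable_continuous_onI smooth_continuous_on)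
  define e where "e n = inverse (real (Suc n))" for n
  define s where "s n x = (f (x + e n *\<^sub>R i) - f x) / e n" for n x
  have e: "0 < e n" "e n \<le> 1" for n by (auto simp: e_def field_simps)
  have fi: "integrable lborel f" "integrable lborel (\<lambda>x. f (x + c))" for c
    using f by (auto intro!: integrable_csupp csupp_translate smooth_continuous_on smooth_translate)
  have "(\<lambda>n. \<integral>x. s n x \<partial>lborel) \<longlonglongrightarrow> (\<integral>x. partial_deriv i f x \<partial>lborel)"
  \<comment> \<open>The mean value theorem bounds the quotients by \<open>B\<close>; the steps are
    at most 1, so all quotients vanish outside the ball of radius r + 1.\<close>
  proof (rule integral_dominated_convergence[where w = "\<lambda>x. B * indicator (cball 0 (r + 1)) x"])
    show "integrable lborel (\<lambda>x::'a. B * indicator (cball 0 (r + 1)) x)"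
      by (auto intro!: integrable_mult_right emeasure_compact_finite)
    show "s n \<in> borel_measurable lborel" for n unfolding s_def[abs_def] by measurable
    show "AE x in lborel. (\<lambda>n. s n x) \<longlonglongrightarrow> partial_deriv i f x"
    proof (rule AE_I2)
      fix x
      have "((\<lambda>h. (f (x + h *\<^sub>R i) - f (x + 0 *\<^sub>R i)) / (h - 0)) \<longlongrightarrow> frechet_derivative f (at (x + 0 *\<^sub>R i)) i) (at 0)"
        using smooth_line_derivative[OF f(1), of x i 0] unfolding has_field_derivative_iff .
      moreover have "filterlim e (at 0) sequentially"
        using LIMSEQ_inverse_real_of_nat e by (intro filterlim_atI) (auto simp: e_def[abs_def])
      ultimately show "(\<lambda>n. s n x) \<longlonglongrightarrow> partial_deriv i f x"
        unfolding s_def partial_deriv_def by (auto dest: filterlim_compose)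
    qed
    show "AE x in lborel. norm (s n x) \<le> B * indicator (cball 0 (r + 1)) x" for n
    proof (rule AE_I2)
      fix x
      show "norm (s n x) \<le> B * indicator (cball 0 (r + 1)) x"
      proof (cases "norm x \<le> r + 1")
        case True
        obtain z where "f (x + e n *\<^sub>R i) - f (x + 0 *\<^sub>R i) = (e n - 0) * frechet_derivative f (at (x + z *\<^sub>R i)) i"
          using MVT2[OF e(1)[of n] smooth_line_derivative[OF f(1), of x i]] by blast
        then have "s n x = partial_deriv i f (x + z *\<^sub>R i)"
          using e(1)[of n] by (simp add: s_def partial_deriv_def)
        then show ?thesis using True B by simp
      next
        case False
        have "norm (e n *\<^sub>R i) \<le> 1" using e(2)[of n] e(1)[of n] i by simp
        moreover have "norm x \<le> norm (x + e n *\<^sub>R i) + norm (e n *\<^sub>R i)"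
          by (metis add_diff_cancel norm_triangle_ineq4)
        ultimately have "f (x + e n *\<^sub>R i) = 0" "f x = 0" using False r by auto
        then show ?thesis using B by (simp add: s_def)
      qed
    qed
  qed auto
  moreover have "(\<integral>x. s n x \<partial>lborel) = 0" for n
    unfolding s_def using fi by (simp add: integral_translate)
  ultimately show ?thesis by (simp add: LIMSEQ_const_iff)
qed

section \<open>Rules for partial derivatives and integration by parts\<close>

lemma partial_deriv_mult:
  assumes "smooth f" "smooth g"
  shows "partial_deriv i (\<lambda>x. f x * g x) x = f x * partial_deriv i g x + partial_deriv i f x * g x"
  using partial_deriv_eq[OF has_derivative_mult[OF smooth_has_derivative[OF assms(1)] smooth_has_derivative[OF assms(2)]], of i x]
  by (simp add: partial_deriv_def)

lemma partial_deriv_add: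
  assumes "smooth f" "smooth g"
  shows "partial_deriv i (\<lambda>x. f x + g x) x = partial_deriv i f x + partial_deriv i g x"
  using partial_deriv_eq[OF has_derivative_add[OF smooth_has_derivative[OF assms(1)] smooth_has_derivative[OF assms(2)]], of i x]
  by (simp add: partial_deriv_def)

lemma partial_deriv_const [simp]: "partial_deriv i (\<lambda>x. c) x = 0"
  using partial_deriv_eq[OF has_derivative_const] by blast

lemma partial_deriv_cmult:
  assumes "smooth f"
  shows "partial_deriv i (\<lambda>x. c * f x) x = c * partial_deriv i f x"
  using partial_deriv_mult[OF smooth_const assms, of i c x] by simp

lemma partial_deriv_diff:
  assumes "smooth f" "smooth g"
  shows "partial_deriv i (\<lambda>x. f x - g x) x = partial_deriv i f x - partial_deriv i g x"
  using partial_deriv_eq[OF has_derivative_diff[OF smooth_has_derivative[OF assms(1)] smooth_has_derivative[OF assms(2)]], of i x]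
  by (simp add: partial_deriv_def)

lemma partial_deriv_compose:
  assumes "(g has_real_derivative g') (at (f x))" "smooth f"
  shows "partial_deriv i (\<lambda>x. g (f x)) x = g' * partial_deriv i f x"
  using partial_deriv_eq[OF has_derivative_compose[OF smooth_has_derivative[OF assms(2)] assms(1)[unfolded has_field_derivative_def]], of i]
  by (simp add: partial_deriv_def)

lemma partial_deriv_power:
  assumes "smooth f"
  shows "partial_deriv i (\<lambda>x. f x ^ n) x = n * f x ^ (n - 1) * partial_deriv i f x"
  by (rule partial_deriv_compose[where g = "\<lambda>t. t ^ n"]) (auto intro!: derivative_eq_intros assms)

lemma partial_deriv_fst [simp]: "partial_deriv i fst x = fst i"
  and partial_deriv_snd [simp]: "partial_deriv i snd x = snd i"
  by (rule partial_deriv_eq bounded_linear_imp_has_derivative bounded_linear_fst bounded_linear_snd)+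

lemma partial_deriv_reflect_x:
  assumes "smooth f"
  shows "partial_deriv i (\<lambda>p. f (reflect_x p)) p = frechet_derivative f (at (reflect_x p)) (reflect_x i)"
  by (rule partial_deriv_eq[OF has_derivative_compose[OF linear_imp_has_derivative[OF linear_reflect_x] smooth_has_derivative[OF assms]]])

lemma partial_deriv_translate:
  assumes "smooth f"
  shows "partial_deriv i (\<lambda>p. f (p + c)) p = partial_deriv i f (p + c)"
proof -
  have "((\<lambda>x. x + c) has_derivative (\<lambda>v. v)) (at p)" by (auto intro!: derivative_eq_intros)
  from has_derivative_compose[OF this smooth_has_derivative[OF assms]]
  show ?thesis using partial_deriv_eq by (fastforce simp: partial_deriv_def[of i f])
qed

lemma integration_by_parts:
  fixes f g :: "'a::euclidean_space \<Rightarrow> real"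
  assumes "smooth f" "smooth g" "csupp f \<or> csupp g" "i \<in> Basis"
  shows "(\<integral>x. f x * partial_deriv i g x \<partial>lborel) = - (\<integral>x. partial_deriv i f x * g x \<partial>lborel)"
proof -
  have "0 = (\<integral>x. partial_deriv i (\<lambda>x. f x * g x) x \<partial>lborel)"
    using assms by (intro integral_partial_deriv_eq_0[symmetric] smooth_intros) (auto intro: csupp_intros)
  also have "\<dots> = (\<integral>x. f x * partial_deriv i g x + partial_deriv i f x * g x \<partial>lborel)"
    using assms by (simp add: partial_deriv_mult)
  also have "\<dots> = (\<integral>x. f x * partial_deriv i g x \<partial>lborel) + (\<integral>x. partial_deriv i f x * g x \<partial>lborel)"
    using assms by (intro Bochner_Integration.integral_add integrable_csupp smooth_continuous_on smooth_intros)
      (auto intro: csupp_intros)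
  finally show ?thesis by simp
qed

text \<open>Nonnegativity of the quadratic form \<integral> (a f + b g)^2 in a and b. If \<integral>
  g^2 = 0 it is affine in b, and the b inserted below would give it the value -1 unless the mixed
  term vanishes.\<close>

lemma integral_Cauchy_Schwarz:
  fixes f g :: "'a \<Rightarrow> real"
  assumes [simp]: "integrable M (\<lambda>x. (f x)\<^sup>2)" "integrable M (\<lambda>x. (g x)\<^sup>2)" "integrable M (\<lambda>x. f x * g x)"
  shows "(\<integral>x. f x * g x \<partial>M)\<^sup>2 \<le> (\<integral>x. (f x)\<^sup>2 \<partial>M) * (\<integral>x. (g x)\<^sup>2 \<partial>M)"
proof -
  define A B C where "A = (\<integral>x. (f x)\<^sup>2 \<partial>M)" and "B = (\<integral>x. (g x)\<^sup>2 \<partial>M)" and "C = (\<integral>x. f x * g x \<partial>M)"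
  have *: "0 \<le> a\<^sup>2 * A + 2 * a * b * C + b\<^sup>2 * B" for a b
  proof -
    have "0 \<le> (\<integral>x. (a * f x + b * g x)\<^sup>2 \<partial>M)" by simp
    also have "(\<lambda>x. (a * f x + b * g x)\<^sup>2) = (\<lambda>x. a\<^sup>2 * (f x)\<^sup>2 + 2 * a * b * (f x * g x) + b\<^sup>2 * (g x)\<^sup>2)"
      by (auto simp: power2_eq_square algebra_simps)
    finally show ?thesis by (simp add: A_def B_def C_def)
  qed
  have "0 \<le> B" by (simp add: B_def)
  show ?thesis
  proof (cases "B = 0")
    case True
    have "C = 0"
    proof (rule ccontr)
      assume "C \<noteq> 0"
      then show False using *[of 1 "- (A + 1) / (2 * C)"] True by (simp add: field_simps)
    qed
    then show ?thesis using True by (simp add: A_def B_def C_def)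
  next
    case False
    then have "0 < B" using \<open>0 \<le> B\<close> by simp
    have "0 \<le> B * (A * B - C\<^sup>2)" using *[of B "- C"] by (simp add: power2_eq_square algebra_simps)
    then show ?thesis using \<open>0 < B\<close> by (simp add: zero_le_mult_iff A_def B_def C_def)
  qed
qed

section \<open>Planar Sobolev and Poincare inequalities and the energy\<close>

abbreviation "dx \<equiv> partial_deriv (1::real, 0::real)"
abbreviation "dy \<equiv> partial_deriv (0::real, 1::real)"

lemma smooth_dx [smooth_intros]: "smooth f \<Longrightarrow> smooth (dx f)"
  and smooth_dy [smooth_intros]: "smooth f \<Longrightarrow> smooth (dy f)"
  by (auto intro!: smooth_partial_deriv simp: Basis_plane)

text \<open>One factor \<bar>f(x, y)\<bar> is bounded by the integral of the x-derivative along the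
  horizontal line, a function of y alone, the other by that of the y-derivative along the vertical
  line, a function of x alone. The integral of the product then factorizes.\<close>

lemma Gagliardo_Nirenberg:
  fixes f :: "real \<times> real \<Rightarrow> real"
  assumes f: "smooth f" "csupp f"
  shows "(\<integral>p. (f p)\<^sup>2 \<partial>lborel) \<le> (\<integral>p. \<bar>dx f p\<bar> \<partial>lborel) * (\<integral>p. \<bar>dy f p\<bar> \<partial>lborel)"
proof -
  obtain r where r: "\<forall>x. r < norm x \<longrightarrow> f x = 0" using f(2) unfolding csupp_def by blast
  define A where "A y = (\<integral>\<^sup>+s. ennreal \<bar>dx f (s, y)\<bar> \<partial>lborel)" for y
  define B where "B x = (\<integral>\<^sup>+t. ennreal \<bar>dy f (x, t)\<bar> \<partial>lborel)" for x
  have [measurable]: "f \<in> borel_measurable borel" "dx f \<in> borel_measurable borel" "dy f \<in> borel_measurable borel"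
    using f by (auto intro!: borel_measurable_continuous_onI smooth_continuous_on smooth_intros)
  have int: "integrable lborel (\<lambda>p. \<bar>dx f p\<bar>)" "integrable lborel (\<lambda>p. \<bar>dy f p\<bar>)" "integrable lborel (\<lambda>p. (f p)\<^sup>2)"
  proof -
    have "continuous_on UNIV f" "continuous_on UNIV (dx f)" "continuous_on UNIV (dy f)"
      using f by (intro smooth_continuous_on smooth_intros; simp)+
    then show "integrable lborel (\<lambda>p. \<bar>dx f p\<bar>)" "integrable lborel (\<lambda>p. \<bar>dy f p\<bar>)" "integrable lborel (\<lambda>p. (f p)\<^sup>2)"
      using f by (auto intro!: integrable_csupp csupp_abs csupp_power csupp_partial_deriv continuous_on_rabs continuous_on_power)
  qed
  \<comment> \<open>Fundamental theorem of calculus started at a zero \<open>a\<close> of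
    \<open>G\<close>; below, \<open>a\<close> is taken to the left of or below the support.\<close>
  have key: "ennreal \<bar>G b\<bar> \<le> (\<integral>\<^sup>+s. ennreal \<bar>g s\<bar> \<partial>lborel)"
    if G: "\<And>t. (G has_real_derivative g t) (at t)" "continuous_on UNIV g" "G a = 0" "a \<le> b"
    for G g :: "real \<Rightarrow> real" and a b
  proof -
    have [measurable]: "g \<in> borel_measurable borel" using that(2) by (rule borel_measurable_continuous_onI)
    have "has_bochner_integral lborel (\<lambda>x. indicator {a .. b} x *\<^sub>R g x) (G b - G a)"
      using that by (intro has_bochner_integral_FTC_Icc)
        (auto intro: continuous_on_subset has_vector_derivative_at_within simp: has_real_derivative_iff_has_vector_derivative)
    then have "ennreal (norm (G b - G a)) \<le> (\<integral>\<^sup>+s. ennreal (norm (indicator {a .. b} s *\<^sub>R g s)) \<partial>lborel)"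
      using integral_norm_bound_ennreal[of lborel "\<lambda>x. indicator {a .. b} x *\<^sub>R g x"]
      by (simp add: has_bochner_integral_iff)
    also have "\<dots> \<le> (\<integral>\<^sup>+s. ennreal \<bar>g s\<bar> \<partial>lborel)"
      by (intro nn_integral_mono) (auto split: split_indicator)
    finally show ?thesis using that by simp
  qed
  have fA: "ennreal \<bar>f (x, y)\<bar> \<le> A y" for x y
    unfolding A_def
  proof (rule key[where G = "\<lambda>s. f (s, y)" and a = "- \<bar>r\<bar> - \<bar>x\<bar> - 1"])
    show "((\<lambda>s. f (s, y)) has_real_derivative dx f (s, y)) (at s)" for s
      using smooth_line_derivative[OF f(1), of "(0, y)" "(1, 0)" s] by (simp add: partial_deriv_def)
    show "continuous_on UNIV (\<lambda>s. dx f (s, y))"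
      by (rule continuous_on_compose2[OF smooth_continuous_on[OF smooth_dx[OF f(1)], of UNIV]])
        (auto intro: continuous_intros)
    have "\<bar>- \<bar>r\<bar> - \<bar>x\<bar> - 1\<bar> \<le> norm (- \<bar>r\<bar> - \<bar>x\<bar> - 1, y)" 
      using norm_fst_le[of "- \<bar>r\<bar> - \<bar>x\<bar> - 1" y] by simp
    then show "f (- \<bar>r\<bar> - \<bar>x\<bar> - 1, y) = 0" using r by auto
  qed auto
  have fB: "ennreal \<bar>f (x, y)\<bar> \<le> B x" for x y
    unfolding B_def
  proof (rule key[where G = "\<lambda>s. f (x, s)" and a = "- \<bar>r\<bar> - \<bar>y\<bar> - 1"])
    show "((\<lambda>s. f (x, s)) has_real_derivative dy f (x, s)) (at s)" for s
      using smooth_line_derivative[OF f(1), of "(x, 0)" "(0, 1)" s] by (simp add: partial_deriv_def)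
    show "continuous_on UNIV (\<lambda>s. dy f (x, s))"
      by (rule continuous_on_compose2[OF smooth_continuous_on[OF smooth_dy[OF f(1)], of UNIV]])
        (auto intro: continuous_intros)
    have "\<bar>- \<bar>r\<bar> - \<bar>y\<bar> - 1\<bar> \<le> norm (x, - \<bar>r\<bar> - \<bar>y\<bar> - 1)" 
      using norm_snd_le[of "(- \<bar>r\<bar> - \<bar>y\<bar> - 1)" x] by simp
    then show "f (x, - \<bar>r\<bar> - \<bar>y\<bar> - 1) = 0" using r by auto
  qed auto
  have [measurable]: "f \<in> borel_measurable (lborel \<Otimes>\<^sub>M lborel)"
    "dx f \<in> borel_measurable (lborel \<Otimes>\<^sub>M lborel)" "dy f \<in> borel_measurable (lborel \<Otimes>\<^sub>M lborel)"
    by (simp_all add: lborel_prod)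
  have mA[measurable]: "A \<in> borel_measurable lborel" and mB[measurable]: "B \<in> borel_measurable lborel"
    unfolding A_def B_def by measurable
  have "ennreal (\<integral>p. (f p)\<^sup>2 \<partial>lborel) = (\<integral>\<^sup>+p. ennreal ((f p)\<^sup>2) \<partial>lborel)"
    using int by (intro nn_integral_eq_integral[symmetric]) auto
  also have "\<dots> \<le> (\<integral>\<^sup>+p. B (fst p) * A (snd p) \<partial>lborel)"
  proof (intro nn_integral_mono)
    fix p :: "real \<times> real"
    have "ennreal ((f p)\<^sup>2) = ennreal \<bar>f p\<bar> * ennreal \<bar>f p\<bar>"
      by (simp add: power2_eq_square ennreal_mult[symmetric])
    also have "\<dots> \<le> B (fst p) * A (snd p)"
      using fA[of "fst p" "snd p"] fB[of "fst p" "snd p"] by (intro mult_mono) auto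
    finally show "ennreal ((f p)\<^sup>2) \<le> B (fst p) * A (snd p)" .
  qed
  also have "\<dots> = (\<integral>\<^sup>+x. \<integral>\<^sup>+y. B x * A y \<partial>lborel \<partial>lborel)"
    by (subst lborel_prod[symmetric], subst lborel.nn_integral_fst[symmetric]) auto
  also have "\<dots> = (\<integral>\<^sup>+x. B x \<partial>lborel) * (\<integral>\<^sup>+y. A y \<partial>lborel)"
    by (simp add: nn_integral_cmult nn_integral_multc)
  also have "(\<integral>\<^sup>+x. B x \<partial>lborel) = (\<integral>\<^sup>+p. ennreal \<bar>dy f p\<bar> \<partial>lborel)"
    unfolding B_def using lborel.nn_integral_fst[of "\<lambda>p. ennreal \<bar>dy f p\<bar>" lborel] by (simp add: lborel_prod)
  also have "(\<integral>\<^sup>+y. A y \<partial>lborel) = (\<integral>\<^sup>+p. ennreal \<bar>dx f p\<bar> \<partial>lborel)"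
    unfolding A_def using lborel_pair.nn_integral_snd[of "\<lambda>p. ennreal \<bar>dx f p\<bar>"] by (simp add: lborel_prod)
  also have "(\<integral>\<^sup>+p. ennreal \<bar>dy f p\<bar> \<partial>lborel) * (\<integral>\<^sup>+p. ennreal \<bar>dx f p\<bar> \<partial>lborel)
      = ennreal ((\<integral>p. \<bar>dx f p\<bar> \<partial>lborel) * (\<integral>p. \<bar>dy f p\<bar> \<partial>lborel))"
    using int by (simp add: nn_integral_eq_integral ennreal_mult mult.commute)
  finally show ?thesis by (simp add: ennreal_le_iff)
qed

definition energy :: "(real \<times> real \<Rightarrow> real) \<Rightarrow> real" where
  "energy u = (\<integral>p. (dx u p)\<^sup>2 + (dy u p)\<^sup>2 \<partial>lborel)"

lemma energy_nonneg [simp]: "0 \<le> energy u"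
  by (simp add: energy_def)

lemma integrable_csupp_smooth:
  "smooth f \<Longrightarrow> csupp f \<Longrightarrow> integrable lborel f"
  by (simp add: integrable_csupp smooth_continuous_on)

lemma integrable_grad_sq:
  assumes "smooth u" "csupp u"
  shows "integrable lborel (\<lambda>p. (dx u p)\<^sup>2)" "integrable lborel (\<lambda>p. (dy u p)\<^sup>2)"
    "integrable lborel (\<lambda>p. (dx u p)\<^sup>2 + (dy u p)\<^sup>2)"
  using assms by (auto intro!: integrable_csupp_smooth smooth_intros csupp_intros)

lemma energy_dx_dy:
  assumes "smooth u" "csupp u"
  shows "energy u = (\<integral>p. (dx u p)\<^sup>2 \<partial>lborel) + (\<integral>p. (dy u p)\<^sup>2 \<partial>lborel)"
  unfolding energy_def using integrable_grad_sq[OF assms] by simp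

text \<open>\<open>Gagliardo_Nirenberg\<close> applied to u^k, whose derivative k u^(k-1)
  \<partial>u is split by Cauchy-Schwarz. The case k = 2 controls \<integral> u^4, the case k = 3
  controls \<integral> u^6.\<close>

lemma integral_even_power_le:
  fixes u :: "real \<times> real \<Rightarrow> real"
  assumes u: "smooth u" "csupp u" and k: "k \<ge> 2"
  shows "(\<integral>p. u p ^ (2 * k) \<partial>lborel) \<le> (real k)\<^sup>2 * energy u * (\<integral>p. u p ^ (2 * k - 2) \<partial>lborel)"
proof -
  define J where "J = (\<integral>p. u p ^ (2 * k - 2) \<partial>lborel)"
  have evn: "even (2 * k - 2)" by simp
  have J: "0 \<le> J" unfolding J_def by (simp add: zero_le_even_power)
  have pw: "(u p ^ (k - 1))\<^sup>2 = u p ^ (2 * k - 2)" for p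
    using k by (simp add: power_mult[symmetric] right_diff_distrib' mult.commute)
  have b: "(\<integral>p. \<bar>partial_deriv i (\<lambda>x. u x ^ k) p\<bar> \<partial>lborel)\<^sup>2 \<le> (real k)\<^sup>2 * (J * (\<integral>p. (partial_deriv i u p)\<^sup>2 \<partial>lborel))"
    if i: "i \<in> Basis" for i
  proof -
    have "(\<integral>p. \<bar>partial_deriv i (\<lambda>x. u x ^ k) p\<bar> \<partial>lborel) = (\<integral>p. real k * (\<bar>u p ^ (k - 1)\<bar> * \<bar>partial_deriv i u p\<bar>) \<partial>lborel)"
      using u by (simp add: partial_deriv_power abs_mult mult.assoc)
    also have "\<dots> = real k * (\<integral>p. (\<bar>u p ^ (k - 1)\<bar> * \<bar>partial_deriv i u p\<bar>) \<partial>lborel)" by simp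
    also have "\<dots>\<^sup>2 = (real k)\<^sup>2 * (\<integral>p. \<bar>u p ^ (k - 1)\<bar> * \<bar>partial_deriv i u p\<bar> \<partial>lborel)\<^sup>2"
      by (simp add: power_mult_distrib)
    also have "\<dots> \<le> (real k)\<^sup>2 * ((\<integral>p. \<bar>u p ^ (k - 1)\<bar>\<^sup>2 \<partial>lborel) * (\<integral>p. \<bar>partial_deriv i u p\<bar>\<^sup>2 \<partial>lborel))"
      using u i k by (intro mult_left_mono integral_Cauchy_Schwarz integrable_csupp csupp_intros continuous_intros smooth_continuous_on smooth_intros) auto
    finally show ?thesis by (simp only: power2_abs pw J_def)
  qed
  define X Y where "X = (\<integral>p. \<bar>dx (\<lambda>x. u x ^ k) p\<bar> \<partial>lborel)" and "Y = (\<integral>p. \<bar>dy (\<lambda>x. u x ^ k) p\<bar> \<partial>lborel)"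
  have "(\<integral>p. u p ^ (2 * k) \<partial>lborel) = (\<integral>p. (u p ^ k)\<^sup>2 \<partial>lborel)" by (simp add: power_mult[symmetric] mult.commute)
  also have "\<dots> \<le> X * Y"
    unfolding X_def Y_def using u k by (intro Gagliardo_Nirenberg smooth_intros csupp_intros) auto
  also have "X * Y \<le> X\<^sup>2 + Y\<^sup>2"
    using sum_squares_bound[of X Y] zero_le_power2[of X] zero_le_power2[of Y] by linarith
  also have "\<dots> \<le> (real k)\<^sup>2 * (J * (\<integral>p. (dx u p)\<^sup>2 \<partial>lborel)) + (real k)\<^sup>2 * (J * (\<integral>p. (dy u p)\<^sup>2 \<partial>lborel))"
    unfolding X_def Y_def by (intro add_mono b) (auto simp: Basis_plane)
  also have "\<dots> = (real k)\<^sup>2 * energy u * J" using u by (simp add: energy_dx_dy algebra_simps)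
  finally show ?thesis unfolding J_def .
qed

text \<open>Obtained from \<open>\<integral> \<partial>\<^sub>y (y u\<^sup>2) = 0\<close> and Young's inequality.\<close>

lemma Poincare_strip:
  fixes u :: "real \<times> real \<Rightarrow> real"
  assumes u: "smooth u" "csupp u" and h: "\<And>p. h < \<bar>snd p\<bar> \<Longrightarrow> u p = 0"
  shows "(\<integral>p. (u p)\<^sup>2 \<partial>lborel) \<le> 4 * h\<^sup>2 * energy u"
proof -
  note i = integrable_csupp_smooth smooth_intros csupp_intros
  have "(0, 1) \<in> (Basis :: (real \<times> real) set)" by (simp add: Basis_plane)
  then have "(\<integral>p. snd p * dy (\<lambda>x. (u x)\<^sup>2) p \<partial>lborel) = - (\<integral>p. dy snd p * (u p)\<^sup>2 \<partial>lborel)"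
    using u by (intro integration_by_parts smooth_intros disjI2 csupp_intros) auto
  then have eq: "(\<integral>p. (u p)\<^sup>2 \<partial>lborel) = (\<integral>p. - (2 * snd p * u p * dy u p) \<partial>lborel)"
    using u by (simp add: partial_deriv_power algebra_simps)
  also have "\<dots> \<le> (\<integral>p. (u p)\<^sup>2 / 2 + 2 * h\<^sup>2 * (dy u p)\<^sup>2 \<partial>lborel)"
  proof (rule integral_mono)
    show "integrable lborel (\<lambda>p. - (2 * snd p * u p * dy u p))" using u by (intro i) 
    show "integrable lborel (\<lambda>p. (u p)\<^sup>2 / 2 + 2 * h\<^sup>2 * (dy u p)\<^sup>2)" using u by (intro i) auto
    fix p
    have "- (2 * snd p * u p * dy u p) \<le> (u p)\<^sup>2 / 2 + 2 * (snd p)\<^sup>2 * (dy u p)\<^sup>2"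
      using zero_le_power2[of "u p + 2 * snd p * dy u p"] by (simp add: power2_eq_square algebra_simps)
    moreover have "(snd p)\<^sup>2 \<le> h\<^sup>2" if "u p \<noteq> 0"
      using h[of p] that abs_le_square_iff[of "snd p" h] by fastforce
    then have "2 * (snd p)\<^sup>2 * (dy u p)\<^sup>2 \<le> 2 * h\<^sup>2 * (dy u p)\<^sup>2" if "u p \<noteq> 0"
      using that by (intro mult_right_mono) auto
    ultimately show "- (2 * snd p * u p * dy u p) \<le> (u p)\<^sup>2 / 2 + 2 * h\<^sup>2 * (dy u p)\<^sup>2"
      by (cases "u p = 0") auto
  qed
  also have "\<dots> = (\<integral>p. (u p)\<^sup>2 \<partial>lborel) / 2 + 2 * h\<^sup>2 * (\<integral>p. (dy u p)\<^sup>2 \<partial>lborel)"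
    using u by (subst Bochner_Integration.integral_add) (auto intro!: i)
  finally have "(\<integral>p. (u p)\<^sup>2 \<partial>lborel) \<le> 4 * h\<^sup>2 * (\<integral>p. (dy u p)\<^sup>2 \<partial>lborel)" by simp
  also have "\<dots> \<le> 4 * h\<^sup>2 * energy u"
    using u by (intro mult_left_mono) (auto simp: energy_dx_dy)
  finally show ?thesis .
qed

lemma indicator_sq: "(indicator A x)\<^sup>2 = (indicator A x :: real)"
  and indicator_idem: "indicator A x * (indicator A x * y) = indicator A x * (y :: real)"
  and indicator_mult_sq: "(indicator A x * y)\<^sup>2 = indicator A x * y\<^sup>2"
  by (auto split: split_indicator)

text \<open>The energy is a quadratic form. This identity makes minimizing sequences Cauchy and
  shows that symmetrization does not raise the energy.\<close>

lemma energy_parallelogram: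
  assumes u: "smooth u" "csupp u" and v: "smooth v" "csupp v"
  shows "energy (\<lambda>x. u x + v x) + energy (\<lambda>x. u x - v x) = 2 * energy u + 2 * energy v"
proof -
  note i = integrable_grad_sq(3)
  have "energy (\<lambda>x. u x + v x) + energy (\<lambda>x. u x - v x)
      = (\<integral>p. ((dx (\<lambda>x. u x + v x) p)\<^sup>2 + (dy (\<lambda>x. u x + v x) p)\<^sup>2) +
          ((dx (\<lambda>x. u x - v x) p)\<^sup>2 + (dy (\<lambda>x. u x - v x) p)\<^sup>2) \<partial>lborel)"
    unfolding energy_def using u v
    by (intro Bochner_Integration.integral_add[symmetric] i smooth_intros csupp_intros)
  also have "\<dots> = (\<integral>p. 2 * ((dx u p)\<^sup>2 + (dy u p)\<^sup>2) + 2 * ((dx v p)\<^sup>2 + (dy v p)\<^sup>2) \<partial>lborel)"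
    using u v by (intro Bochner_Integration.integral_cong refl)
      (simp add: partial_deriv_add partial_deriv_diff power2_eq_square algebra_simps)
  also have "\<dots> = 2 * energy u + 2 * energy v"
    unfolding energy_def using i[OF u] i[OF v]
    by (subst Bochner_Integration.integral_add) (auto simp del: distrib_left_numeral)
  finally show ?thesis .
qed

lemma energy_diff_le:
  assumes "smooth u" "csupp u" "smooth v" "csupp v"
  shows "energy (\<lambda>x. u x - v x) \<le> 2 * energy u + 2 * energy v"
  using energy_parallelogram[OF assms] energy_nonneg[of "\<lambda>x. u x + v x"] by linarith

lemma frechet_derivative_plane:
  assumes "smooth (u :: real \<times> real \<Rightarrow> real)"
  shows "frechet_derivative u (at p) v = fst v * dx u p + snd v * dy u p"
proof -
  have l: "linear (frechet_derivative u (at p))"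
    using smooth_has_derivative[OF assms] by (rule has_derivative_linear)
  have "frechet_derivative u (at p) v = frechet_derivative u (at p) (fst v *\<^sub>R (1, 0) + snd v *\<^sub>R (0, 1))"
    by simp
  then show ?thesis unfolding linear_add[OF l] linear_cmul[OF l] by (simp add: partial_deriv_def)
qed

text \<open>The increment is the integral of the directional derivative along the segment from p to
  p + z. After Cauchy-Schwarz on the unit interval, integrating in p first gives the same energy for
  every point of the segment.\<close>

lemma integral_translate_diff_sq_le:
  assumes u: "smooth (u :: real \<times> real \<Rightarrow> real)" "csupp u"
  shows "(\<integral>p. (u (p + z) - u p)\<^sup>2 \<partial>lborel) \<le> (norm z)\<^sup>2 * energy u"
proof -
  define g where "g p = (dx u p)\<^sup>2 + (dy u p)\<^sup>2" for p
  have g0: "0 \<le> g p" for p by (simp add: g_def)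
  have sg: "smooth g" unfolding g_def[abs_def] using u by (intro smooth_intros)
  have gi: "integrable lborel g" unfolding g_def[abs_def] by (rule integrable_grad_sq(3)[OF u])
  have cg: "continuous_on UNIV g" using sg by (rule smooth_continuous_on)
  have [measurable]: "g \<in> borel_measurable borel" using cg by (rule borel_measurable_continuous_onI)
  have pt: "ennreal ((u (p + z) - u p)\<^sup>2) \<le> (\<integral>\<^sup>+t. ennreal (indicator {0..1} t * ((norm z)\<^sup>2 * g (p + t *\<^sub>R z))) \<partial>lborel)" for p
  proof -
    define w where "w t = frechet_derivative u (at (p + t *\<^sub>R z)) z" for t
    have cl: "continuous_on UNIV (\<lambda>t. p + t *\<^sub>R z)" by (intro continuous_intros)
    have cgz: "continuous_on UNIV (\<lambda>t. g (p + t *\<^sub>R z))"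
      by (rule continuous_on_compose2[OF cg cl]) auto
    have cw: "continuous_on UNIV w"
      unfolding w_def frechet_derivative_plane[OF u(1)]
      by (intro continuous_intros continuous_on_compose2[OF smooth_continuous_on[OF smooth_dx[OF u(1)], of UNIV] cl]
          continuous_on_compose2[OF smooth_continuous_on[OF smooth_dy[OF u(1)], of UNIV] cl]) auto
    have int: "integrable lborel (\<lambda>t. indicator {0..1} t *\<^sub>R f t)" if "continuous_on UNIV f" for f :: "real \<Rightarrow> real"
      by (intro borel_integrable_compact continuous_on_subset[OF that]) auto
    have "u (p + 1 *\<^sub>R z) - u (p + 0 *\<^sub>R z) = (\<integral>t. indicator {0..1} t *\<^sub>R w t \<partial>lborel)"
      using smooth_line_derivative[OF u(1), of p z]
      by (intro integral_FTC_Icc[symmetric] continuous_on_subset[OF cw])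
        (auto simp: w_def has_real_derivative_iff_has_vector_derivative intro: has_vector_derivative_at_within)
    \<comment> \<open>The indicator is duplicated so that Cauchy-Schwarz on the whole line yields
      the length 1 of the interval as first factor.\<close>
    then have "(u (p + z) - u p)\<^sup>2 = (\<integral>t. indicator {0..1::real} t * (indicator {0..1} t * w t) \<partial>lborel)\<^sup>2"
      by (simp add: indicator_idem del: indicator_simps)
    also have "\<dots> \<le> (\<integral>t. (indicator {0..1::real} t)\<^sup>2 \<partial>lborel) * (\<integral>t. (indicator {0..1} t * w t)\<^sup>2 \<partial>lborel)"
    proof (rule integral_Cauchy_Schwarz)
      show "integrable lborel (\<lambda>t. (indicator {0..1::real} t)\<^sup>2 :: real)"
        using int[of "\<lambda>_. 1"] by (simp add: indicator_sq)
      show "integrable lborel (\<lambda>t. (indicator {0..1::real} t * w t)\<^sup>2 :: real)"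
        using int[of "\<lambda>t. (w t)\<^sup>2"] cw by (simp add: power_mult_distrib indicator_sq continuous_intros)
      show "integrable lborel (\<lambda>t. indicator {0..1::real} t * (indicator {0..1} t * w t))"
        using int[OF cw] by (simp add: indicator_idem)
    qed
    also have "(\<integral>t. (indicator {0..1::real} t)\<^sup>2 \<partial>lborel) = (1::real)" by (simp add: indicator_sq)
    also have "1 * (\<integral>t. (indicator {0..1} t * w t)\<^sup>2 \<partial>lborel)
        \<le> (\<integral>t. indicator {0..1} t * ((norm z)\<^sup>2 * g (p + t *\<^sub>R z)) \<partial>lborel)"
      unfolding mult_1
    proof (rule integral_mono)
      show "integrable lborel (\<lambda>t. (indicator {0..1::real} t * w t)\<^sup>2 :: real)"
        using int[of "\<lambda>t. (w t)\<^sup>2"] cw by (simp add: power_mult_distrib indicator_sq continuous_intros)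
      show "integrable lborel (\<lambda>t. indicator {0..1} t * ((norm z)\<^sup>2 * g (p + t *\<^sub>R z)))"
        using int[of "\<lambda>t. (norm z)\<^sup>2 * g (p + t *\<^sub>R z)"] cgz by (simp add: continuous_intros)
      fix t
      have "(w t)\<^sup>2 \<le> (norm z)\<^sup>2 * g (p + t *\<^sub>R z)"
        unfolding w_def frechet_derivative_plane[OF u(1)] g_def
        using zero_le_power2[of "fst z * dy u (p + t *\<^sub>R z) - snd z * dx u (p + t *\<^sub>R z)"]
        by (cases z) (simp add: norm_Pair power2_eq_square algebra_simps)
      then show "(indicator {0..1} t * w t)\<^sup>2 \<le> indicator {0..1} t * ((norm z)\<^sup>2 * g (p + t *\<^sub>R z))"
        by (auto split: split_indicator)
    qed
    finally have "ennreal ((u (p + z) - u p)\<^sup>2) \<le> ennreal (\<integral>t. indicator {0..1} t * ((norm z)\<^sup>2 * g (p + t *\<^sub>R z)) \<partial>lborel)"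
      by (rule ennreal_leI)
    also have "\<dots> = (\<integral>\<^sup>+t. ennreal (indicator {0..1} t * ((norm z)\<^sup>2 * g (p + t *\<^sub>R z))) \<partial>lborel)"
      using int[of "\<lambda>t. (norm z)\<^sup>2 * g (p + t *\<^sub>R z)"] cgz g0
      by (intro nn_integral_eq_integral[symmetric]) (auto simp: continuous_intros)
    finally show ?thesis .
  qed
  have gt: "(\<integral>\<^sup>+p. ennreal (g (p + c)) \<partial>lborel) = ennreal (energy u)" for c
  proof -
    have "integrable lborel (\<lambda>p. g (p + c))"
    proof -
      have "integrable (distr lborel borel ((+) c)) g" using gi by (simp add: lborel_distr_plus)
      then show ?thesis by (subst (asm) integrable_distr_eq) (auto simp: add.commute)
    qed
    then have "(\<integral>\<^sup>+p. ennreal (g (p + c)) \<partial>lborel) = ennreal (\<integral>p. g (p + c) \<partial>lborel)"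
      using g0 by (intro nn_integral_eq_integral) auto
    also have "(\<integral>p. g (p + c) \<partial>lborel) = energy u"
      unfolding energy_def g_def[symmetric] by (rule integral_translate) measurable
    finally show ?thesis .
  qed
  have meas: "(\<lambda>(p, t). ennreal (indicator {0..1} t * ((norm z)\<^sup>2 * g (p + t *\<^sub>R z)))) \<in> borel_measurable (lborel \<Otimes>\<^sub>M lborel)"
  proof -
    have "continuous_on UNIV (\<lambda>x::(real\<times>real)\<times>real. g (fst x + snd x *\<^sub>R z))"
      by (rule continuous_on_compose2[OF cg]) (auto intro!: continuous_intros)
    then have [measurable]: "(\<lambda>x. g (fst x + snd x *\<^sub>R z)) \<in> borel_measurable (lborel \<Otimes>\<^sub>M lborel)"
      unfolding lborel_prod by (simp add: borel_measurable_continuous_onI)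
    show ?thesis unfolding case_prod_beta by measurable
  qed
  have "(\<integral>\<^sup>+p. ennreal ((u (p + z) - u p)\<^sup>2) \<partial>lborel)
      \<le> (\<integral>\<^sup>+p. \<integral>\<^sup>+t. ennreal (indicator {0..1} t * ((norm z)\<^sup>2 * g (p + t *\<^sub>R z))) \<partial>lborel \<partial>lborel)"
    by (intro nn_integral_mono pt)
  also have "\<dots> = (\<integral>\<^sup>+t. \<integral>\<^sup>+p. ennreal (indicator {0..1} t * ((norm z)\<^sup>2 * g (p + t *\<^sub>R z))) \<partial>lborel \<partial>lborel)"
    by (rule lborel_pair.Fubini'[OF meas, symmetric])
  also have "\<dots> = (\<integral>\<^sup>+t. indicator {0..1} t * ennreal ((norm z)\<^sup>2 * energy u) \<partial>(lborel :: real measure))"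
  proof (intro nn_integral_cong)
    fix t :: real
    show "(\<integral>\<^sup>+p. ennreal (indicator {0..1} t * ((norm z)\<^sup>2 * g (p + t *\<^sub>R z))) \<partial>lborel) = indicator {0..1} t * ennreal ((norm z)\<^sup>2 * energy u)"
      using gt[of "t *\<^sub>R z"] by (auto split: split_indicator simp: ennreal_mult g0 nn_integral_cmult)
  qed
  also have "\<dots> = ennreal ((norm z)\<^sup>2 * energy u)" by (simp add: nn_integral_multc)
  finally have "(\<integral>\<^sup>+p. ennreal ((u (p + z) - u p)\<^sup>2) \<partial>lborel) \<le> ennreal ((norm z)\<^sup>2 * energy u)" .
  moreover have "(\<integral>\<^sup>+p. ennreal ((u (p + z) - u p)\<^sup>2) \<partial>lborel) = ennreal (\<integral>p. (u (p + z) - u p)\<^sup>2 \<partial>lborel)"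
    using u by (intro nn_integral_eq_integral integrable_csupp_smooth smooth_intros csupp_power csupp_diff csupp_translate smooth_translate) auto
  ultimately show ?thesis by (simp add: ennreal_le_iff)
qed

section \<open>Rellich compactness\<close>

text \<open>The average over the ball of radius \<open>e\<close> around \<open>p\<close>, not
  divided by the area, so powers of \<open>barea e\<close> appear in the estimates.\<close>

definition bint :: "real \<Rightarrow> (real \<times> real \<Rightarrow> real) \<Rightarrow> real \<times> real \<Rightarrow> real" where
  "bint e u p = (\<integral>z. indicator (ball 0 e) z * u (p + z) \<partial>lborel)"

abbreviation barea :: "real \<Rightarrow> real" where
  "barea e \<equiv> measure lborel (ball (0 :: real \<times> real) e)"

lemma barea_pos: "0 < e \<Longrightarrow> 0 < barea e"
  by (simp add: content_ball_pos)

lemma emeasure_ball_plane: "emeasure lborel (ball (0::real\<times>real) e) = ennreal (barea e)"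
  using emeasure_bounded_finite[OF bounded_ball, of "0::real\<times>real" e] by (intro emeasure_eq_ennreal_measure) simp

lemma integrable_indicator_ball:
  fixes f :: "real \<times> real \<Rightarrow> real"
  assumes "integrable lborel f"
  shows "integrable lborel (\<lambda>z. indicator (ball 0 e) z * f z)"
  using integrable_mult_indicator[OF _ assms, of "ball 0 e"] by simp

lemma integrable_indicator_ball_1: "integrable lborel (indicator (ball (0::real\<times>real) e) :: _ \<Rightarrow> real)"
  by (simp add: integrable_indicator_iff emeasure_ball_plane)

lemma csupp_translate': "csupp f \<Longrightarrow> csupp (\<lambda>x. f (c + x))"
  and smooth_translate': "smooth f \<Longrightarrow> smooth (\<lambda>x. f (c + x))"
  using csupp_translate[of f c] smooth_translate[of f c] by (simp_all add: add.commute)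

lemma ball_integral_sq_le:
  assumes v: "smooth v" "csupp (v :: real \<times> real \<Rightarrow> real)"
  shows "(\<integral>z. indicator (ball 0 e) z * v z \<partial>lborel)\<^sup>2 \<le> barea e * (\<integral>z. indicator (ball 0 e) z * (v z)\<^sup>2 \<partial>lborel)"
proof -
  note i = integrable_indicator_ball
  have "(\<integral>z. indicator (ball 0 e) z * (indicator (ball 0 e) z * v z) \<partial>lborel)\<^sup>2
      \<le> (\<integral>z. (indicator (ball (0::real\<times>real) e) z)\<^sup>2 \<partial>lborel) * (\<integral>z. (indicator (ball 0 e) z * v z)\<^sup>2 \<partial>lborel)"
    using v
    by (intro integral_Cauchy_Schwarz) (auto simp: indicator_mult_sq indicator_sq integrable_indicator_ball_1
        intro!: i integrable_csupp_smooth smooth_power csupp_power)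
  then show ?thesis by (simp add: indicator_sq indicator_mult_sq indicator_idem)
qed

lemma bint_diff:
  assumes "smooth u" "csupp u" "smooth v" "csupp v"
  shows "bint e (\<lambda>x. u x - v x) p = bint e u p - bint e v p"
  unfolding bint_def right_diff_distrib using assms
  by (intro Bochner_Integration.integral_diff integrable_indicator_ball integrable_csupp_smooth smooth_translate' csupp_translate')

text \<open>The bound is uniform in \<open>p\<close>: averages of a sequence bounded in L2 are
  bounded at every point, as diagonal extraction requires.\<close>

lemma bint_sq_le:
  assumes u: "smooth u" "csupp u"
  shows "(bint e u p)\<^sup>2 \<le> barea e * (\<integral>x. (u x)\<^sup>2 \<partial>lborel)"
proof -
  have i: "integrable lborel (\<lambda>z. (u (p + z))\<^sup>2)"
    using u by (intro integrable_csupp_smooth smooth_power csupp_power smooth_translate' csupp_translate') auto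
  have "(bint e u p)\<^sup>2 \<le> barea e * (\<integral>z. indicator (ball 0 e) z * (u (p + z))\<^sup>2 \<partial>lborel)"
    unfolding bint_def using u by (intro ball_integral_sq_le smooth_translate' csupp_translate')
  also have "\<dots> \<le> barea e * (\<integral>z. (u (p + z))\<^sup>2 \<partial>lborel)"
    by (intro mult_left_mono integral_mono integrable_indicator_ball i) (auto split: split_indicator)
  also have "(\<integral>z. (u (p + z))\<^sup>2 \<partial>lborel) = (\<integral>z. (u (z + p))\<^sup>2 \<partial>lborel)" by (simp add: add.commute)
  also have "\<dots> = (\<integral>z. (u z)\<^sup>2 \<partial>lborel)"
    using u by (intro integral_translate[where f = "\<lambda>z. (u z)\<^sup>2"] borel_measurable_continuous_onI smooth_continuous_on smooth_power)
  finally show ?thesis .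
qed

text \<open>The difference of two averages is an average of a translation difference, which the
  energy controls in L2. The Lipschitz constant depends only on radius and energy, hence
  equicontinuity.\<close>

lemma bint_diff_sq_le:
  assumes u: "smooth u" "csupp u"
  shows "(bint e u p - bint e u q)\<^sup>2 \<le> barea e * ((norm (p - q))\<^sup>2 * energy u)"
proof -
  define v where "v x = u (x + (p - q)) - u x" for x
  have v: "smooth v" "csupp v" unfolding v_def[abs_def] using u
    by (intro smooth_diff csupp_diff smooth_translate csupp_translate; simp)+
  have "bint e u p = bint e (\<lambda>x. u (x + (p - q))) q"
    unfolding bint_def by (simp add: algebra_simps)
  then have "bint e u p - bint e u q = bint e v q"
    unfolding v_def[abs_def] using u by (subst bint_diff) (auto intro: smooth_translate csupp_translate)
  then have "(bint e u p - bint e u q)\<^sup>2 \<le> barea e * (\<integral>x. (v x)\<^sup>2 \<partial>lborel)"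
    using bint_sq_le[OF v] by simp
  also have "\<dots> \<le> barea e * ((norm (p - q))\<^sup>2 * energy u)"
    unfolding v_def by (intro mult_left_mono integral_translate_diff_sq_le u) auto
  finally show ?thesis .
qed

lemma continuous_on_bint:
  assumes u: "smooth u" "csupp u"
  shows "continuous_on UNIV (bint e u)"
proof -
  have "\<bar>bint e u p - bint e u q\<bar> \<le> sqrt (barea e * energy u) * dist p q" for p q
  proof -
    have "(bint e u p - bint e u q)\<^sup>2 \<le> (sqrt (barea e * energy u) * dist p q)\<^sup>2"
      using bint_diff_sq_le[OF u, of e p q] by (simp add: power_mult_distrib dist_norm mult_ac)
    then show ?thesis by (simp add: abs_le_square_iff[symmetric])
  qed
  then have "(sqrt (barea e * energy u))-lipschitz_on UNIV (bint e u)"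
    by (intro lipschitz_onI) (auto simp: dist_real_def)
  then show ?thesis by (rule lipschitz_on_continuous_on)
qed

lemma bint_outside:
  assumes "\<forall>x. r < norm x \<longrightarrow> u x = 0" "r + e < norm p"
  shows "bint e u p = 0"
proof -
  have "indicator (ball 0 e) z * u (p + z) = 0" for z
  proof (cases "norm z < e")
    case True
    have "norm p \<le> norm (p + z) + norm z" by (metis add_diff_cancel norm_triangle_ineq4)
    then show ?thesis using True assms by (simp del: split_paired_All)
  qed simp
  then show ?thesis unfolding bint_def by (simp only: Bochner_Integration.integral_zero)
qed

lemma csupp_bint: "csupp u \<Longrightarrow> csupp (bint e u)"
  unfolding csupp_def[of u] by (elim exE) (auto simp: csupp_def intro!: exI bint_outside)

text \<open>For shifts shorter than \<open>e\<close>, translation differences are at most e^2 times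
  the energy in squared L2 norm, hence so is the deviation of u from its true averages. The factors
  2 come from squaring a sum of two terms.\<close>

lemma integral_sq_le_bint:
  assumes u: "smooth u" "csupp u" and e: "0 < e"
  shows "(\<integral>p. (u p)\<^sup>2 \<partial>lborel) \<le> 2 * e\<^sup>2 * energy u + 2 / (barea e)\<^sup>2 * (\<integral>p. (bint e u p)\<^sup>2 \<partial>lborel)"
proof -
  define b where "b = barea e"
  have b: "0 < b" using barea_pos[OF e] by (simp add: b_def)
  define F where "F p z = indicator (ball 0 e) z * (u (p + z) - u p)\<^sup>2" for p z
  have iu2: "integrable lborel (\<lambda>p. (u p)\<^sup>2)" using u by (intro integrable_csupp_smooth smooth_power csupp_power) auto
  have ib2: "integrable lborel (\<lambda>p. (bint e u p)\<^sup>2)"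
    using u by (intro integrable_csupp csupp_power csupp_bint continuous_on_power continuous_on_bint) auto
  have si: "integrable lborel (\<lambda>z. (u (p + z) - u p)\<^sup>2 * indicator (ball 0 e) z)" for p
  proof -
    have "integrable lborel (\<lambda>z. indicator (cball 0 e) z *\<^sub>R (u (p + z) - u p)\<^sup>2)"
      using u by (intro borel_integrable_compact continuous_intros smooth_continuous_on smooth_translate') auto
    from integrable_mult_indicator[OF _ this, of "ball 0 e"]
    show ?thesis by (auto simp: indicator_def if_distrib cong: if_cong elim!: back_subst[of "integrable lborel"])
  qed
  \<comment> \<open>Here b u(p) is \<open>bint e u p\<close> minus the integral of the differences
    u(p + z) - u(p) over the ball, and the latter is estimated by Cauchy-Schwarz.\<close>
  have pt: "b * (u p)\<^sup>2 \<le> 2 * (\<integral>z. F p z \<partial>lborel) + 2 / b * (bint e u p)\<^sup>2" for p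
  proof -
    obtain r where r: "\<forall>x. r < norm x \<longrightarrow> u x = 0" using u(2) unfolding csupp_def by blast
    have iI: "integrable lborel (\<lambda>z::real\<times>real. indicator (ball 0 e) z * c)" for c :: real
      using integrable_indicator_ball_1 by (intro integrable_mult_left)
    have iT: "integrable lborel (\<lambda>z. indicator (ball 0 e) z * u (p + z))"
      using u by (intro integrable_indicator_ball integrable_csupp_smooth smooth_translate' csupp_translate')
    define w where "w z = indicator (ball 0 e) z * (u (p + z) - u p)" for z
    have iw: "integrable lborel w" unfolding w_def[abs_def] right_diff_distrib by (intro Bochner_Integration.integrable_diff iI iT)
    have iw2: "integrable lborel (\<lambda>z. (w z)\<^sup>2)" unfolding w_def indicator_mult_sq using si by (simp add: mult.commute)
    have "(\<integral>z. w z \<partial>lborel) = bint e u p - b * u p"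
      unfolding w_def right_diff_distrib bint_def b_def using iI iT by simp
    moreover have "(\<integral>z. indicator (ball 0 e) z * w z \<partial>lborel)\<^sup>2
       \<le> (\<integral>z. (indicator (ball (0::real\<times>real) e) z)\<^sup>2 \<partial>lborel) * (\<integral>z. (w z)\<^sup>2 \<partial>lborel)"
      by (intro integral_Cauchy_Schwarz iw2 integrable_indicator_ball iw) (simp add: indicator_sq integrable_indicator_ball_1)
    ultimately have "(bint e u p - b * u p)\<^sup>2 \<le> b * (\<integral>z. F p z \<partial>lborel)"
      by (simp add: indicator_sq b_def w_def indicator_mult_sq F_def indicator_idem)
    moreover have "(b * u p)\<^sup>2 \<le> 2 * (bint e u p - b * u p)\<^sup>2 + 2 * (bint e u p)\<^sup>2"
      using zero_le_power2[of "2 * bint e u p - b * u p"] by (simp add: power2_eq_square algebra_simps)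
    ultimately have "b * (b * (u p)\<^sup>2) \<le> b * (2 * (\<integral>z. F p z \<partial>lborel) + 2 / b * (bint e u p)\<^sup>2)"
      using b by (simp add: power2_eq_square algebra_simps)
    then show ?thesis using b by simp
  qed
  have F0: "0 \<le> F p z" for p z by (simp add: F_def)
  have Fm: "(\<lambda>(p, z). ennreal (F p z)) \<in> borel_measurable (lborel \<Otimes>\<^sub>M lborel)"
  proof -
    have "continuous_on UNIV (\<lambda>x::(real\<times>real)\<times>(real\<times>real). (u (fst x + snd x) - u (fst x))\<^sup>2)"
      by (intro continuous_intros continuous_on_compose2[OF smooth_continuous_on[OF u(1), of UNIV]]) auto
    then have [measurable]: "(\<lambda>x. (u (fst x + snd x) - u (fst x))\<^sup>2) \<in> borel_measurable borel"
      by (simp add: borel_measurable_continuous_onI)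
    have "open (snd -` ball (0::real\<times>real) e :: ((real\<times>real)\<times>(real\<times>real)) set)"
      by (intro open_vimage_snd) auto
    then have "(indicator (snd -` ball (0::real\<times>real) e) :: (real\<times>real)\<times>(real\<times>real) \<Rightarrow> real) \<in> borel_measurable borel"
      by (intro borel_measurable_indicator borel_open)
    then have [measurable]: "(\<lambda>x::(real\<times>real)\<times>(real\<times>real). indicator (ball 0 e) (snd x) :: real) \<in> borel_measurable borel"
      by (simp add: indicator_vimage[symmetric] comp_def)
    have "(\<lambda>x. ennreal (F (fst x) (snd x))) \<in> borel_measurable borel" unfolding F_def by measurable
    then show ?thesis unfolding case_prod_beta lborel_prod by simp
  qed
  have nnF: "ennreal (\<integral>z. F p z \<partial>lborel) = (\<integral>\<^sup>+z. ennreal (F p z) \<partial>lborel)" for p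
    using si F0 by (intro nn_integral_eq_integral[symmetric]) (auto simp: F_def mult.commute)
  have "ennreal (b * (\<integral>p. (u p)\<^sup>2 \<partial>lborel)) = (\<integral>\<^sup>+p. ennreal (b * (u p)\<^sup>2) \<partial>lborel)"
    using iu2 b by (subst nn_integral_eq_integral) auto
  also have "\<dots> \<le> (\<integral>\<^sup>+p. 2 * (\<integral>\<^sup>+z. ennreal (F p z) \<partial>lborel) + ennreal (2 / b * (bint e u p)\<^sup>2) \<partial>lborel)"
  proof (intro nn_integral_mono)
    fix p
    have "ennreal (b * (u p)\<^sup>2) \<le> ennreal (2 * (\<integral>z. F p z \<partial>lborel) + 2 / b * (bint e u p)\<^sup>2)"
      using pt by (rule ennreal_leI)
    also have "\<dots> = 2 * (\<integral>\<^sup>+z. ennreal (F p z) \<partial>lborel) + ennreal (2 / b * (bint e u p)\<^sup>2)"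
      using b F0 by (simp add: ennreal_plus ennreal_mult nnF[symmetric] integral_nonneg)
    finally show "ennreal (b * (u p)\<^sup>2) \<le> 2 * (\<integral>\<^sup>+z. ennreal (F p z) \<partial>lborel) + ennreal (2 / b * (bint e u p)\<^sup>2)" .
  qed
  also have "\<dots> = 2 * (\<integral>\<^sup>+p. \<integral>\<^sup>+z. ennreal (F p z) \<partial>lborel \<partial>lborel) + (\<integral>\<^sup>+p. ennreal (2 / b * (bint e u p)\<^sup>2) \<partial>lborel)"
  proof -
    have [measurable]: "(\<lambda>p. \<integral>\<^sup>+z. ennreal (F p z) \<partial>lborel) \<in> borel_measurable lborel"
      using lborel.borel_measurable_nn_integral_fst[OF Fm] by simp
    have [measurable]: "bint e u \<in> borel_measurable lborel"
      using continuous_on_bint[OF u] by (simp add: borel_measurable_continuous_onI)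
    show ?thesis by (simp add: nn_integral_add nn_integral_cmult)
  qed
  \<comment> \<open>With z outermost, the inner integral is a translation difference by a fixed
    vector shorter than \<open>e\<close>.\<close>
  also have "(\<integral>\<^sup>+p. \<integral>\<^sup>+z. ennreal (F p z) \<partial>lborel \<partial>lborel) = (\<integral>\<^sup>+z. \<integral>\<^sup>+p. ennreal (F p z) \<partial>lborel \<partial>lborel)"
    by (rule lborel_pair.Fubini'[OF Fm, symmetric])
  also have "\<dots> \<le> (\<integral>\<^sup>+z. ennreal (e\<^sup>2 * energy u) * indicator (ball 0 e) z \<partial>(lborel::(real\<times>real) measure))"
  proof (intro nn_integral_mono)
    fix z :: "real \<times> real"
    show "(\<integral>\<^sup>+p. ennreal (F p z) \<partial>lborel) \<le> ennreal (e\<^sup>2 * energy u) * indicator (ball 0 e) z"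
    proof (cases "z \<in> ball 0 e")
      case True
      have "(\<integral>\<^sup>+p. ennreal (F p z) \<partial>lborel) = ennreal (\<integral>p. (u (p + z) - u p)\<^sup>2 \<partial>lborel)"
        unfolding F_def using True u by (subst nn_integral_eq_integral[symmetric])
          (auto intro!: integrable_csupp_smooth csupp_power csupp_diff csupp_translate smooth_translate smooth_power smooth_diff)
      also have "\<dots> \<le> ennreal ((norm z)\<^sup>2 * energy u)" by (intro ennreal_leI integral_translate_diff_sq_le u)
      also have "\<dots> \<le> ennreal (e\<^sup>2 * energy u)"
        using True by (intro ennreal_leI mult_right_mono power_mono) auto
      finally show ?thesis using True by simp
    qed (simp add: F_def)
  qed
  also have "\<dots> = ennreal (e\<^sup>2 * energy u) * ennreal b"
    by (simp add: nn_integral_cmult_indicator emeasure_ball_plane b_def)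
  also have "(\<integral>\<^sup>+p. ennreal (2 / b * (bint e u p)\<^sup>2) \<partial>lborel) = ennreal (2 / b * (\<integral>p. (bint e u p)\<^sup>2 \<partial>lborel))"
    using ib2 b by (subst nn_integral_eq_integral) auto
  also have "2 * (ennreal (e\<^sup>2 * energy u) * ennreal b) + ennreal (2 / b * (\<integral>p. (bint e u p)\<^sup>2 \<partial>lborel))
     = ennreal (2 * (e\<^sup>2 * energy u * b) + 2 / b * (\<integral>p. (bint e u p)\<^sup>2 \<partial>lborel))"
    using b by (simp add: ennreal_mult ennreal_plus)
  finally have "ennreal (b * (\<integral>p. (u p)\<^sup>2 \<partial>lborel)) \<le> ennreal (2 * (e\<^sup>2 * energy u * b) + 2 / b * (\<integral>p. (bint e u p)\<^sup>2 \<partial>lborel))"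
    by (simp add: add_right_mono mult_left_mono)
  then have "b * (\<integral>p. (u p)\<^sup>2 \<partial>lborel) \<le> 2 * (e\<^sup>2 * energy u * b) + 2 / b * (\<integral>p. (bint e u p)\<^sup>2 \<partial>lborel)"
    using b by (subst (asm) ennreal_le_iff) auto
  then have "(\<integral>p. (u p)\<^sup>2 \<partial>lborel) \<le> (2 * (e\<^sup>2 * energy u * b) + 2 / b * (\<integral>p. (bint e u p)\<^sup>2 \<partial>lborel)) / b"
    using b by (simp add: pos_le_divide_eq mult.commute)
  also have "\<dots> = 2 * e\<^sup>2 * energy u + 2 / b\<^sup>2 * (\<integral>p. (bint e u p)\<^sup>2 \<partial>lborel)"
    using b by (simp add: field_simps power2_eq_square)
  finally show ?thesis unfolding b_def .
qed

text \<open>The averages over balls of functions of bounded energy are equicontinuous and close to the functions in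
  \<open>L\<^sup>2\<close>, so it suffices to make the averages converge pointwise on a countable dense set.\<close>

lemma Rellich:
  fixes \<phi> :: "nat \<Rightarrow> real \<times> real \<Rightarrow> real"
  assumes \<phi>: "\<And>n. smooth (\<phi> n)" and supp: "\<And>n x. r < norm x \<Longrightarrow> \<phi> n x = 0"
    and E: "\<And>n. energy (\<phi> n) \<le> E" and E': "\<And>n. (\<integral>p. (\<phi> n p)\<^sup>2 \<partial>lborel) \<le> E'"
  obtains k :: "nat \<Rightarrow> nat" where "strict_mono k"
    "\<And>\<epsilon>. 0 < \<epsilon> \<Longrightarrow> \<exists>N. \<forall>m\<ge>N. \<forall>n\<ge>N. (\<integral>p. (\<phi> (k m) p - \<phi> (k n) p)\<^sup>2 \<partial>lborel) < \<epsilon>"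
proof -
  have cs: "csupp (\<phi> n)" for n using supp unfolding csupp_def by blast
  obtain D :: "(real \<times> real) set" where D: "countable D" "\<And>X. open X \<Longrightarrow> X \<noteq> {} \<Longrightarrow> \<exists>d\<in>D. d \<in> X"
    by (rule countable_dense_setE[where 'a = "real \<times> real"]) blast
  define e where "e j = 1 / real (Suc j)" for j
  have e: "0 < e j" "e j \<le> 1" for j by (auto simp: e_def field_simps)
  have "0 \<le> (\<integral>p. (\<phi> 0 p)\<^sup>2 \<partial>lborel)" by simp
  then have E0: "0 \<le> E" "0 \<le> E'" using E[of 0] E'[of 0] energy_nonneg[of "\<phi> 0"] by linarith+
  have b1: "barea (e j) \<le> barea 1" for j
    using e(2)[of j] by (intro measure_mono_fmeasurable) (auto simp: fmeasurable_def emeasure_ball_plane)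
  have M: "norm (bint (e j) (\<phi> n) q) \<le> sqrt (barea 1 * E')" for n j q
  proof -
    have "(bint (e j) (\<phi> n) q)\<^sup>2 \<le> barea (e j) * (\<integral>x. (\<phi> n x)\<^sup>2 \<partial>lborel)" by (rule bint_sq_le[OF \<phi> cs])
    also have "\<dots> \<le> barea 1 * E'" using b1 E' by (intro mult_mono) auto
    finally show ?thesis by (simp add: real_le_rsqrt)
  qed
  \<comment> \<open>Diagonal extraction over the countable set of pairs of a dense point and a
    radius index, so that one subsequence serves all radii 1/(j+1).\<close>
  obtain k :: "nat \<Rightarrow> nat" where k: "strict_mono k"
    and conv: "\<And>x. x \<in> D \<times> UNIV \<Longrightarrow> \<exists>l. (\<lambda>n. bint (e (snd x)) (\<phi> (k n)) (fst x)) \<longlonglongrightarrow> l"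
  proof (rule function_convergent_subsequence[of "D \<times> (UNIV :: nat set)" "\<lambda>n x. bint (e (snd x)) (\<phi> n) (fst x)" "sqrt (barea 1 * E')"])
    show "countable (D \<times> (UNIV :: nat set))" using D by auto
  qed (use M in auto)
  have convp: "\<exists>l. (\<lambda>n. bint (e j) (\<phi> (k n)) p) \<longlonglongrightarrow> l" for j p
  proof -
    \<comment> \<open>Common Lipschitz constant of the averages, carrying convergence from the dense
      set to every point; the summand 1 makes it positive, as it is divided by.\<close>
    define L where "L = sqrt (barea 1 * E) + 1"
    have L: "0 < L" using E0 by (simp add: L_def add_nonneg_pos)
    have lip: "\<bar>bint (e j) (\<phi> n) p - bint (e j) (\<phi> n) q\<bar> \<le> L * dist p q" for n q
    proof -
      have "(bint (e j) (\<phi> n) p - bint (e j) (\<phi> n) q)\<^sup>2 \<le> barea (e j) * ((norm (p - q))\<^sup>2 * energy (\<phi> n))"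
        by (rule bint_diff_sq_le[OF \<phi> cs])
      also have "\<dots> \<le> barea 1 * ((norm (p - q))\<^sup>2 * E)" using b1 E by (intro mult_mono mult_left_mono) auto
      also have "\<dots> = (sqrt (barea 1 * E) * dist p q)\<^sup>2"
        using E0 by (simp add: power_mult_distrib dist_norm mult_ac)
      finally have "\<bar>bint (e j) (\<phi> n) p - bint (e j) (\<phi> n) q\<bar> \<le> sqrt (barea 1 * E) * dist p q"
        using E0 by (simp add: abs_le_square_iff[symmetric])
      also have "\<dots> \<le> L * dist p q" unfolding L_def by (intro mult_right_mono) auto
      finally show ?thesis .
    qed
    have "Cauchy (\<lambda>n. bint (e j) (\<phi> (k n)) p)"
    proof (rule metric_CauchyI)
      fix \<epsilon> :: real assume "0 < \<epsilon>"
      then have "0 < \<epsilon> / (3 * L)" using L by simp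
      then have "ball p (\<epsilon> / (3 * L)) \<noteq> {}" by simp
      then obtain q where q: "q \<in> D" "q \<in> ball p (\<epsilon> / (3 * L))"
        using D(2)[of "ball p (\<epsilon> / (3 * L))"] by blast
      obtain l where "(\<lambda>n. bint (e j) (\<phi> (k n)) q) \<longlonglongrightarrow> l" using conv[of "(q, j)"] q(1) by auto
      then have "Cauchy (\<lambda>n. bint (e j) (\<phi> (k n)) q)" by (rule LIMSEQ_imp_Cauchy)
      then obtain N where N: "\<And>m n. m \<ge> N \<Longrightarrow> n \<ge> N \<Longrightarrow> dist (bint (e j) (\<phi> (k m)) q) (bint (e j) (\<phi> (k n)) q) < \<epsilon> / 3"
        using metric_CauchyD[of _ "\<epsilon> / 3"] \<open>0 < \<epsilon>\<close> by (metis divide_pos_pos zero_less_numeral)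
      have "L * dist p q < \<epsilon> / 3" using q(2) L by (simp add: field_simps)
      then have "dist (bint (e j) (\<phi> (k m)) p) (bint (e j) (\<phi> (k n)) p) < \<epsilon>" if "m \<ge> N" "n \<ge> N" for m n
        using N[OF that] lip[of "k m" q] lip[of "k n" q] unfolding dist_real_def by linarith
      then show "\<exists>N. \<forall>m\<ge>N. \<forall>n\<ge>N. dist (bint (e j) (\<phi> (k m)) p) (bint (e j) (\<phi> (k n)) p) < \<epsilon>" by blast
    qed
    then show ?thesis by (simp add: Cauchy_convergent_iff convergent_def)
  qed
  define g where "g j p = lim (\<lambda>n. bint (e j) (\<phi> (k n)) p)" for j p
  have g: "(\<lambda>n. bint (e j) (\<phi> (k n)) p) \<longlonglongrightarrow> g j p" for j p
    using convp[of j p] unfolding g_def by (auto simp: convergent_def dest: limI)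
  have [measurable]: "bint (e j) (\<phi> n) \<in> borel_measurable borel" for j n
    using continuous_on_bint[OF \<phi> cs] by (rule borel_measurable_continuous_onI)
  have [measurable]: "g j \<in> borel_measurable borel" for j
    by (rule borel_measurable_LIMSEQ_real[OF g]) measurable
  define K where "K = sqrt (barea 1 * E')"
  have K0: "0 \<le> K" using E0 by (simp add: K_def)
  have gK: "\<bar>g j p\<bar> \<le> K" for j p
    using M[of j _ p] by (intro LIMSEQ_le_const2[OF tendsto_rabs[OF g]]) (auto simp: K_def)
  define S where "S = cball (0::real\<times>real) (r + 1)"
  have out: "bint (e j) (\<phi> n) p = 0" if "p \<notin> S" for j n p
    using that e(2)[of j] supp by (intro bint_outside[of r]) (auto simp: S_def)
  then have gout: "g j p = 0" if "p \<notin> S" for j p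
    using that g[of j p] by (simp add: LIMSEQ_const_iff)
  have wi: "integrable lborel (\<lambda>p. (2 * K)\<^sup>2 * indicator S p)"
    using emeasure_compact_finite[of "cball (0::real\<times>real) (r + 1)"] unfolding S_def
    by (intro integrable_mult_right) (simp add: integrable_indicator_iff)
  have wb: "(bint (e j) (\<phi> n) p - g j p)\<^sup>2 \<le> (2 * K)\<^sup>2 * indicator S p" for j n p
  proof (cases "p \<in> S")
    case True
    have "\<bar>bint (e j) (\<phi> n) p - g j p\<bar> \<le> 2 * K" using M[of j n p] gK[of j p] by (simp add: K_def)
    then have "(bint (e j) (\<phi> n) p - g j p)\<^sup>2 \<le> (2 * K)\<^sup>2" using power_mono[of _ _ 2] by fastforce
    then show ?thesis using True by simp
  qed (simp add: out gout)
  have igb: "integrable lborel (\<lambda>p. (bint (e j) (\<phi> n) p - g j p)\<^sup>2)" for j n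
    by (rule Bochner_Integration.integrable_bound[OF wi]) (use wb in \<open>auto simp: abs_of_nonneg\<close>)
  \<comment> \<open>Pointwise convergence becomes L2 convergence because all averages are bounded by
    \<open>K\<close> and vanish outside the ball \<open>S\<close>.\<close>
  have lim: "(\<lambda>n. \<integral>p. (bint (e j) (\<phi> (k n)) p - g j p)\<^sup>2 \<partial>lborel) \<longlonglongrightarrow> 0" for j
  proof -
    have "(\<lambda>n. \<integral>p. (bint (e j) (\<phi> (k n)) p - g j p)\<^sup>2 \<partial>lborel) \<longlonglongrightarrow> (\<integral>p. 0 \<partial>(lborel :: (real\<times>real) measure))"
    proof (rule integral_dominated_convergence[OF _ _ wi])
      show "AE p in lborel. (\<lambda>n. (bint (e j) (\<phi> (k n)) p - g j p)\<^sup>2) \<longlonglongrightarrow> 0"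
      proof (rule AE_I2)
        fix p
        have "(\<lambda>n. (bint (e j) (\<phi> (k n)) p - g j p)\<^sup>2) \<longlonglongrightarrow> (g j p - g j p)\<^sup>2"
          by (intro tendsto_intros g)
        then show "(\<lambda>n. (bint (e j) (\<phi> (k n)) p - g j p)\<^sup>2) \<longlonglongrightarrow> 0" by simp
      qed
    qed (use wb in auto)
    then show ?thesis by simp
  qed
  have "\<exists>N. \<forall>m\<ge>N. \<forall>n\<ge>N. (\<integral>p. (\<phi> (k m) p - \<phi> (k n) p)\<^sup>2 \<partial>lborel) < \<epsilon>" if \<epsilon>: "0 < \<epsilon>" for \<epsilon>
  proof -
    \<comment> \<open>The radius is fixed before the index \<open>N\<close>: it makes the smoothing
      error of a difference, whose energy is at most 4 E, smaller than half of \<epsilon>. Then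
      \<open>N\<close> takes care of the averages at this one radius.\<close>
    obtain j where j: "inverse (real (Suc j)) < \<epsilon> / (16 * (E + 1))"
      using reals_Archimedean[of "\<epsilon> / (16 * (E + 1))"] \<epsilon> E0 by auto
    have ej: "2 * (e j)\<^sup>2 * (4 * E) < \<epsilon> / 2"
    proof -
      have "(e j)\<^sup>2 \<le> e j" using e[of j] by (simp add: power2_eq_square mult_left_le)
      moreover have "e j * (16 * (E + 1)) < \<epsilon>" using j E0 by (simp add: e_def inverse_eq_divide field_simps)
      moreover have "(e j)\<^sup>2 * E \<le> e j * E" using \<open>(e j)\<^sup>2 \<le> e j\<close> E0 by (intro mult_right_mono) auto
      ultimately show ?thesis using e(1)[of j] by (simp add: algebra_simps)
    qed
    define b where "b = barea (e j)"
    have b: "0 < b" using barea_pos[OF e(1)] by (simp add: b_def)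
    define I where "I n = (\<integral>p. (bint (e j) (\<phi> (k n)) p - g j p)\<^sup>2 \<partial>lborel)" for n
    obtain N where N: "\<And>n. n \<ge> N \<Longrightarrow> I n < \<epsilon> * b\<^sup>2 / 16"
      using order_tendstoD(2)[OF lim[of j], of "\<epsilon> * b\<^sup>2 / 16"] \<epsilon> b
      unfolding I_def eventually_sequentially by auto
    have "(\<integral>p. (\<phi> (k m) p - \<phi> (k n) p)\<^sup>2 \<partial>lborel) < \<epsilon>" if "m \<ge> N" "n \<ge> N" for m n
    proof -
      define v where "v p = \<phi> (k m) p - \<phi> (k n) p" for p
      have v: "smooth v" "csupp v" unfolding v_def[abs_def] by (intro smooth_diff csupp_diff \<phi> cs)+
      have bv: "bint (e j) v p = bint (e j) (\<phi> (k m)) p - bint (e j) (\<phi> (k n)) p" for p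
        unfolding v_def[abs_def] by (intro bint_diff \<phi> cs)
      have "(\<integral>p. (bint (e j) v p)\<^sup>2 \<partial>lborel) \<le> (\<integral>p. 2 * (bint (e j) (\<phi> (k m)) p - g j p)\<^sup>2 + 2 * (bint (e j) (\<phi> (k n)) p - g j p)\<^sup>2 \<partial>lborel)"
      proof (rule integral_mono)
        show "integrable lborel (\<lambda>p. (bint (e j) v p)\<^sup>2)"
          using v by (intro integrable_csupp csupp_power csupp_bint continuous_on_power continuous_on_bint) auto
        show "integrable lborel (\<lambda>p. 2 * (bint (e j) (\<phi> (k m)) p - g j p)\<^sup>2 + 2 * (bint (e j) (\<phi> (k n)) p - g j p)\<^sup>2)"
          using igb by simp
        fix p
        have "(a - c)\<^sup>2 \<le> 2 * (a - d)\<^sup>2 + 2 * (c - d)\<^sup>2" for a c d :: real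
          using zero_le_power2[of "a + c - 2 * d"] by (simp add: power2_eq_square algebra_simps)
        then show "(bint (e j) v p)\<^sup>2 \<le> 2 * (bint (e j) (\<phi> (k m)) p - g j p)\<^sup>2 + 2 * (bint (e j) (\<phi> (k n)) p - g j p)\<^sup>2"
          unfolding bv .
      qed
      also have "\<dots> = 2 * I m + 2 * I n" unfolding I_def using igb by simp
      also have "\<dots> < \<epsilon> * b\<^sup>2 / 4" using N[OF that(1)] N[OF that(2)] by simp
      finally have "2 / b\<^sup>2 * (\<integral>p. (bint (e j) v p)\<^sup>2 \<partial>lborel) < 2 / b\<^sup>2 * (\<epsilon> * b\<^sup>2 / 4)"
        using b by (intro mult_strict_left_mono) auto
      also have "\<dots> = \<epsilon> / 2" using b by (simp add: field_simps)
      finally have A: "2 / b\<^sup>2 * (\<integral>p. (bint (e j) v p)\<^sup>2 \<partial>lborel) < \<epsilon> / 2" .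
      have "energy v \<le> 2 * energy (\<phi> (k m)) + 2 * energy (\<phi> (k n))"
        unfolding v_def[abs_def] by (intro energy_diff_le \<phi> cs)
      then have "energy v \<le> 4 * E" using E[of "k m"] E[of "k n"] by linarith
      then have "2 * (e j)\<^sup>2 * energy v \<le> 2 * (e j)\<^sup>2 * (4 * E)" by (intro mult_left_mono) auto
      then have "(\<integral>p. (v p)\<^sup>2 \<partial>lborel) < \<epsilon>"
        using integral_sq_le_bint[OF v e(1)[of j]] A ej unfolding b_def by linarith
      then show ?thesis by (simp add: v_def)
    qed
    then show ?thesis by blast
  qed
  then show ?thesis by (rule that[OF k])
qed

section \<open>Test functions and weak gradients\<close>

lemma test_functionsI:
  assumes "smooth \<phi>" "compact K" "K \<subseteq> \<Omega>" "\<And>x. x \<notin> K \<Longrightarrow> \<phi> x = 0"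
  shows "\<phi> \<in> test_functions \<Omega>"
proof -
  have "closure {x. \<phi> x \<noteq> 0} \<subseteq> K"
    using assms by (intro closure_minimal) (auto intro: compact_imp_closed)
  then show ?thesis
    using assms compact_closure[of "{x. \<phi> x \<noteq> 0}"] bounded_subset[OF compact_imp_bounded[OF assms(2)]]
    by (auto simp: test_functions_def smooth_def dest: subset_trans[OF closure_subset])
qed

lemma test_functionsE:
  assumes "\<phi> \<in> test_functions \<Omega>"
  obtains K where "smooth \<phi>" "compact K" "K \<subseteq> \<Omega>" "\<And>x. x \<notin> K \<Longrightarrow> \<phi> x = 0"
proof (rule that[of "closure {x. \<phi> x \<noteq> 0}"])
  show "\<phi> x = 0" if "x \<notin> closure {x. \<phi> x \<noteq> 0}" for x
    using that closure_subset[of "{x. \<phi> x \<noteq> 0}"] by auto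
qed (use assms in \<open>auto simp: test_functions_def smooth_def\<close>)

lemma test_functions_smooth: "\<phi> \<in> test_functions \<Omega> \<Longrightarrow> smooth \<phi>"
  by (erule test_functionsE)

lemma test_functions_csupp:
  assumes "\<phi> \<in> test_functions \<Omega>"
  shows "csupp \<phi>"
proof -
  obtain K where K: "compact K" "\<And>x. x \<notin> K \<Longrightarrow> \<phi> x = 0" using assms by (rule test_functionsE) blast
  obtain r where "\<forall>x\<in>K. norm x \<le> r" using compact_imp_bounded[OF K(1)] unfolding bounded_iff by blast
  then show ?thesis using K(2) unfolding csupp_def by (intro exI[of _ r]) (auto simp: not_le[symmetric])
qed

lemma test_functions_outside:
  assumes "\<phi> \<in> test_functions \<Omega>" "x \<notin> \<Omega>"
  shows "\<phi> x = 0" "partial_deriv i \<phi> x = 0"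
proof -
  obtain K where K: "compact K" "K \<subseteq> \<Omega>" "\<And>x. x \<notin> K \<Longrightarrow> \<phi> x = 0" using assms(1) by (rule test_functionsE) blast
  show "\<phi> x = 0" using K assms(2) by auto
  show "partial_deriv i \<phi> x = 0"
    by (rule partial_deriv_outside[of "- K"]) (use K assms(2) in \<open>auto simp: compact_imp_closed open_Compl\<close>)
qed

lemma test_functions_mono: "\<Omega> \<subseteq> \<Omega>' \<Longrightarrow> \<phi> \<in> test_functions \<Omega> \<Longrightarrow> \<phi> \<in> test_functions \<Omega>'"
  by (auto simp: test_functions_def)

lemma test_functions_subset_support:
  assumes "\<phi> \<in> test_functions \<Omega>" "smooth \<psi>" "\<And>x. \<phi> x = 0 \<Longrightarrow> \<psi> x = 0"
  shows "\<psi> \<in> test_functions \<Omega>"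
proof -
  obtain K where K: "compact K" "K \<subseteq> \<Omega>" "\<And>x. x \<notin> K \<Longrightarrow> \<phi> x = 0" using assms(1) by (rule test_functionsE) blast
  then show ?thesis using assms by (intro test_functionsI[of _ K]) auto
qed

lemma test_functions_add:
  assumes "\<phi> \<in> test_functions \<Omega>" "\<psi> \<in> test_functions \<Omega>"
  shows "(\<lambda>x. \<phi> x + \<psi> x) \<in> test_functions \<Omega>"
proof -
  obtain K where K: "smooth \<phi>" "compact K" "K \<subseteq> \<Omega>" "\<And>x. x \<notin> K \<Longrightarrow> \<phi> x = 0" using assms(1) by (rule test_functionsE) blast
  obtain L where L: "smooth \<psi>" "compact L" "L \<subseteq> \<Omega>" "\<And>x. x \<notin> L \<Longrightarrow> \<psi> x = 0" using assms(2) by (rule test_functionsE) blast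
  show ?thesis using K L by (intro test_functionsI[of _ "K \<union> L"]) (auto intro: smooth_add)
qed

lemma test_functions_mult:
  assumes "\<phi> \<in> test_functions \<Omega>" "smooth g"
  shows "(\<lambda>x. g x * \<phi> x) \<in> test_functions \<Omega>"
  using assms test_functions_smooth by (intro test_functions_subset_support[OF assms(1)]) (auto intro: smooth_mult)

lemma test_functions_cmult: "\<phi> \<in> test_functions \<Omega> \<Longrightarrow> (\<lambda>x. c * \<phi> x) \<in> test_functions \<Omega>"
  by (erule test_functions_mult) (rule smooth_const)

lemma test_functions_diff:
  assumes "\<phi> \<in> test_functions \<Omega>" "\<psi> \<in> test_functions \<Omega>"
  shows "(\<lambda>x. \<phi> x - \<psi> x) \<in> test_functions \<Omega>"
  using test_functions_add[OF assms(1) test_functions_cmult[OF assms(2), of "-1"]] by simp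

lemma test_functions_zero: "(\<lambda>x. 0) \<in> test_functions \<Omega>"
  by (rule test_functionsI[of _ "{}"]) (auto intro: smooth_const)

lemma test_functions_sum:
  "(\<And>i. i \<in> I \<Longrightarrow> f i \<in> test_functions \<Omega>) \<Longrightarrow> (\<lambda>x. \<Sum>i\<in>I. f i x) \<in> test_functions \<Omega>"
  by (induction I rule: infinite_finite_induct) (auto intro: test_functions_add test_functions_zero)

section \<open>Bumps and smooth approximation of indicators of open sets\<close>

definition bump :: "real \<times> real \<Rightarrow> real \<Rightarrow> real \<times> real \<Rightarrow> real" where
  "bump p r q = flat 0 (r\<^sup>2 - ((fst q - fst p)\<^sup>2 + (snd q - snd p)\<^sup>2))"

lemma bump_arg: "(fst q - fst p)\<^sup>2 + (snd q - snd p)\<^sup>2 = (dist p q)\<^sup>2" for p q :: "real \<times> real"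
  by (cases p; cases q) (simp add: dist_Pair_Pair dist_real_def power2_commute)

lemma bump_pos_iff: "0 < r \<Longrightarrow> 0 < bump p r q \<longleftrightarrow> q \<in> ball p r"
proof -
  assume r: "0 < r"
  have "(dist p q)\<^sup>2 < r\<^sup>2 \<longleftrightarrow> dist p q < r" using r by (metis power2_less_imp_less power_strict_mono zero_le_dist less_imp_le zero_less_numeral)
  then show ?thesis
    unfolding bump_def bump_arg using flat_pos[of "r\<^sup>2 - (dist p q)\<^sup>2" 0] flat_eq_0[of "r\<^sup>2 - (dist p q)\<^sup>2" 0]
    by (auto simp: not_less[symmetric])
qed

lemma bump_nonneg: "0 \<le> bump p r q"
  by (simp add: bump_def)

lemma bump_test_function:
  assumes "0 < r" "cball p r \<subseteq> \<Omega>"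
  shows "bump p r \<in> test_functions \<Omega>"
proof (rule test_functionsI[of _ "cball p r"])
  show "smooth (bump p r)"
    unfolding bump_def[abs_def] by (intro smooth_compose[OF smooth_flat] smooth_intros)
  show "bump p r x = 0" if "x \<notin> cball p r" for x
    using bump_pos_iff[OF assms(1), of p x] bump_nonneg[of p r x] that by auto
qed (use assms in auto)

text \<open>A Lindelof cover. The closed balls stay inside \<open>U\<close> so that the bumps on
  them are test functions on \<open>U\<close>.\<close>

lemma open_countable_balls:
  assumes "open U" "U \<noteq> {}"
  obtains p :: "nat \<Rightarrow> 'a::euclidean_space" and r where "\<And>i. 0 < r i" "\<And>i. cball (p i) (r i) \<subseteq> U" "(\<Union>i. ball (p i) (r i)) = U"
proof -
  define F where "F = {B. \<exists>p r. B = ball p r \<and> 0 < r \<and> cball p r \<subseteq> U}"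
  have "\<Union>F = U"
  proof
    show "U \<subseteq> \<Union>F"
    proof
      fix x assume "x \<in> U"
      then obtain e where "0 < e" "cball x e \<subseteq> U" using assms(1) open_contains_cball by blast
      then have "ball x e \<in> F" "x \<in> ball x e" by (auto simp: F_def)
      then show "x \<in> \<Union>F" by blast
    qed
  qed (use ball_subset_cball in \<open>fastforce simp: F_def\<close>)
  moreover obtain F' where F': "F' \<subseteq> F" "countable F'" "\<Union>F' = \<Union>F"
    by (rule Lindelof[of F]) (auto simp: F_def)
  ultimately have ne: "F' \<noteq> {}" using assms(2) by auto
  have "from_nat_into F' i \<in> F" for i using from_nat_into[OF ne] F'(1) by blast
  then have "\<forall>i. \<exists>pr. from_nat_into F' i = ball (fst pr) (snd pr) \<and> 0 < snd pr \<and> cball (fst pr) (snd pr) \<subseteq> U"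
    by (simp add: F_def)
  then obtain pr where pr: "\<And>i. from_nat_into F' i = ball (fst (pr i)) (snd (pr i)) \<and> 0 < snd (pr i) \<and> cball (fst (pr i)) (snd (pr i)) \<subseteq> U"
    by metis
  have "(\<Union>i. ball (fst (pr i)) (snd (pr i))) = \<Union>(range (from_nat_into F'))" using pr by simp
  also have "\<dots> = U" using range_from_nat_into[OF ne F'(2)] F'(3) \<open>\<Union>F = U\<close> by simp
  finally show ?thesis using that[of "\<lambda>i. snd (pr i)" "\<lambda>i. fst (pr i)"] pr by blast
qed

text \<open>With s_n the sum of the first n bumps of a countable cover, n s_n tends to infinity on
  \<open>U\<close> and is 0 off \<open>U\<close>; so 1 - exp(-n s_n) has the required limit and
  range, and it is supported where s_n is.\<close>

lemma open_indicator_approx: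
  fixes U :: "(real \<times> real) set"
  assumes "open U"
  obtains \<psi> where "\<And>n. \<psi> n \<in> test_functions U" "\<And>n x. 0 \<le> \<psi> n x \<and> \<psi> n x \<le> 1"
    "\<And>x. (\<lambda>n. \<psi> n x) \<longlonglongrightarrow> indicator U x"
proof (cases "U = {}")
  case True
  show ?thesis
    by (rule that[of "\<lambda>_ _. 0"]) (auto simp: True test_functions_zero)
next
  case False
  obtain p :: "nat \<Rightarrow> real \<times> real" and r where pr: "\<And>i. 0 < r i" "\<And>i. cball (p i) (r i) \<subseteq> U" "(\<Union>i. ball (p i) (r i)) = U"
    by (rule open_countable_balls[OF assms False]) (rule that)
  define s where "s n x = (\<Sum>i<n. bump (p i) (r i) x)" for n :: nat and x
  define \<psi> where "\<psi> n x = 1 - exp (- (real n * s n x))" for n x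
  have s0: "0 \<le> s n x" for n x unfolding s_def by (intro sum_nonneg bump_nonneg)
  have st: "s n \<in> test_functions U" for n
    unfolding s_def[abs_def] by (intro test_functions_sum bump_test_function pr)
  show ?thesis
  proof (rule that[of \<psi>])
    show "\<psi> n \<in> test_functions U" for n
      unfolding \<psi>_def[abs_def]
      by (rule test_functions_subset_support[OF st[of n]])
        (auto intro!: smooth_diff smooth_compose[OF smooth_exp] smooth_minus smooth_mult smooth_const test_functions_smooth[OF st])
    show "0 \<le> \<psi> n x \<and> \<psi> n x \<le> 1" for n x using s0[of n x] by (simp add: \<psi>_def)
    fix x
    show "(\<lambda>n. \<psi> n x) \<longlonglongrightarrow> indicator U x"
    proof (cases "x \<in> U")
      case True
      then obtain i where "x \<in> ball (p i) (r i)" using pr(3) by blast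
      then have b: "0 < bump (p i) (r i) x" using bump_pos_iff[OF pr(1)] by blast
      have "filterlim (\<lambda>n. bump (p i) (r i) x * real n) at_top sequentially"
        by (rule filterlim_tendsto_pos_mult_at_top[OF tendsto_const b filterlim_real_sequentially])
      moreover have "eventually (\<lambda>n. bump (p i) (r i) x * real n \<le> real n * s n x) sequentially"
        unfolding eventually_sequentially
      proof (intro exI allI impI)
        fix n assume "Suc i \<le> n"
        then have "bump (p i) (r i) x \<le> s n x"
          unfolding s_def by (intro member_le_sum) (auto intro: bump_nonneg)
        then show "bump (p i) (r i) x * real n \<le> real n * s n x" by (simp add: mult.commute mult_left_mono)
      qed
      ultimately have "filterlim (\<lambda>n. real n * s n x) at_top sequentially"
        by (rule filterlim_at_top_mono)
      then have "((\<lambda>n. exp (- (real n * s n x))) \<longlongrightarrow> 0) sequentially"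
        by (intro filterlim_compose[OF exp_at_bot]) (simp add: filterlim_uminus_at_top[symmetric])
      then have "(\<lambda>n. \<psi> n x) \<longlonglongrightarrow> 1 - 0" unfolding \<psi>_def by (intro tendsto_diff tendsto_const)
      then show ?thesis using True by simp
    next
      case False
      then have "\<psi> n x = 0" for n using test_functions_outside[OF st[of n]] by (simp add: \<psi>_def)
      then show ?thesis using False by simp
    qed
  qed
qed

section \<open>The fundamental lemma of the calculus of variations\<close>

lemma borel_measurable_lebesgue_on:
  assumes "f \<in> borel_measurable borel"
  shows "f \<in> borel_measurable (lebesgue_on S)"
  using assms by (intro measurable_restrict_space1 measurable_completion) simp

text \<open>Bridge between the completed measure restricted to the domain, in which the function
  spaces are defined, and \<open>lborel\<close>, in which the calculus is done.\<close>

lemma integral_lebesgue_on_eq: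
  fixes f :: "'a::euclidean_space \<Rightarrow> real"
  assumes "open \<Omega>" "f \<in> borel_measurable borel" "\<And>x. x \<notin> \<Omega> \<Longrightarrow> f x = 0"
  shows "(\<integral>x. f x \<partial>lebesgue_on \<Omega>) = (\<integral>x. f x \<partial>lborel)"
    and "integrable lborel f \<Longrightarrow> integrable (lebesgue_on \<Omega>) f"
proof -
  have *: "indicator \<Omega> x *\<^sub>R f x = f x" for x using assms(3) by (auto split: split_indicator)
  have m: "\<Omega> \<inter> space lebesgue \<in> sets lebesgue" using assms(1) by (simp add: lebesgue_openin)
  show "(\<integral>x. f x \<partial>lebesgue_on \<Omega>) = (\<integral>x. f x \<partial>lborel)"
    using assms by (simp only: integral_restrict_space[OF m] * integral_completion measurable_lborel2)
  show "integrable (lebesgue_on \<Omega>) f" if "integrable lborel f"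
    using that assms by (simp only: integrable_restrict_space[OF m] * integrable_completion measurable_lborel2)
qed

text \<open>Approximating indicators by test functions shows that the integral of \<open>g\<close>
  over every open subset is 0. Positive and negative part thus have the same finite integrals over
  open sets, an intersection-stable generator, hence over all Borel sets, and so they agree.\<close>

lemma fundamental_lemma:
  fixes g :: "real \<times> real \<Rightarrow> real"
  assumes \<Omega>: "open \<Omega>" and g: "integrable (lebesgue_on \<Omega>) g"
    and z: "\<And>\<phi>. \<phi> \<in> test_functions \<Omega> \<Longrightarrow> (\<integral>x. g x * \<phi> x \<partial>lebesgue_on \<Omega>) = 0"
  shows "AE x in lebesgue_on \<Omega>. g x = 0"
proof -
  have \<Omega>s: "\<Omega> \<in> sets lebesgue" "\<Omega> \<inter> space lebesgue \<in> sets lebesgue" using \<Omega> by (auto simp: lebesgue_openin)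
  \<comment> \<open>Extension by zero, to be replaced by a Borel representative, since the
    comparison of measures takes place on Borel sets.\<close>
  define G where "G x = indicator \<Omega> x * g x" for x
  have GL: "integrable lebesgue G" using g unfolding G_def by (subst (asm) integrable_restrict_space[OF \<Omega>s(2)]) simp
  then obtain G' where G': "G' \<in> borel_measurable lborel" "AE x in lborel. G x = G' x"
    using completion_ex_borel_measurable_real[of G lborel] by auto
  have G'm[measurable]: "G' \<in> borel_measurable borel" using G' by simp
  have AEL: "AE x in lebesgue. G x = G' x" using G'(2) by (rule AE_completion)
  have G'i: "integrable lborel G'"
  proof -
    have "integrable lebesgue G'"
      by (rule integrable_cong_AE_imp[OF GL]) (use AEL G'(1) in \<open>auto intro: measurable_completion\<close>)
    then show ?thesis using G'(1) by (simp add: integrable_completion)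
  qed
  have U0: "(\<integral>x. G' x * indicator U x \<partial>lborel) = 0" if U: "open U" for U
  proof -
    obtain \<psi> where \<psi>: "\<And>n. \<psi> n \<in> test_functions (U \<inter> \<Omega>)" "\<And>n x. 0 \<le> \<psi> n x \<and> \<psi> n x \<le> 1"
      "\<And>x. (\<lambda>n. \<psi> n x) \<longlonglongrightarrow> indicator (U \<inter> \<Omega>) x"
      using open_indicator_approx[of "U \<inter> \<Omega>"] U \<Omega> by auto
    have [measurable]: "\<psi> n \<in> borel_measurable borel" for n
      by (intro borel_measurable_continuous_onI smooth_continuous_on test_functions_smooth[OF \<psi>(1)])
    have [measurable]: "U \<in> sets borel" "\<Omega> \<in> sets borel" using U \<Omega> by auto
    have "(\<lambda>n. \<integral>x. G' x * \<psi> n x \<partial>lborel) \<longlonglongrightarrow> (\<integral>x. G' x * indicator (U \<inter> \<Omega>) x \<partial>lborel)"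
    proof (rule integral_dominated_convergence[where w = "\<lambda>x. \<bar>G' x\<bar>"])
      show "AE x in lborel. (\<lambda>n. G' x * \<psi> n x) \<longlonglongrightarrow> G' x * indicator (U \<inter> \<Omega>) x"
        by (intro AE_I2 tendsto_mult tendsto_const \<psi>(3))
      show "AE x in lborel. norm (G' x * \<psi> n x) \<le> \<bar>G' x\<bar>" for n
        using \<psi>(2) by (intro AE_I2) (simp add: abs_mult mult_left_le)
    qed (use G'i in auto)
    moreover have "(\<integral>x. G' x * \<psi> n x \<partial>lborel) = 0" for n
    proof -
      have t: "\<psi> n \<in> test_functions \<Omega>" using \<psi>(1) by (rule test_functions_mono[rotated]) auto
      have "(\<integral>x. G' x * \<psi> n x \<partial>lborel) = (\<integral>x. G' x * \<psi> n x \<partial>lebesgue)"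
        by (rule integral_completion[symmetric]) simp
      also have "\<dots> = (\<integral>x. G x * \<psi> n x \<partial>lebesgue)"
      proof (rule integral_cong_AE)
        show "(\<lambda>x. G x * \<psi> n x) \<in> borel_measurable lebesgue"
          using GL by (intro borel_measurable_times) (auto intro: measurable_completion)
        show "(\<lambda>x. G' x * \<psi> n x) \<in> borel_measurable lebesgue"
          by (rule measurable_completion) simp
        show "AE x in lebesgue. G' x * \<psi> n x = G x * \<psi> n x" using AEL by eventually_elim simp
      qed
      also have "\<dots> = (\<integral>x. g x * \<psi> n x \<partial>lebesgue_on \<Omega>)"
        unfolding integral_restrict_space[OF \<Omega>s(2)] G_def by (simp add: mult.assoc)
      also have "\<dots> = 0" by (rule z[OF t])
      finally show ?thesis .
    qed
    ultimately have "(\<integral>x. G' x * indicator (U \<inter> \<Omega>) x \<partial>lborel) = 0" by (simp add: LIMSEQ_const_iff)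
    moreover have "(\<integral>x. G' x * indicator (U \<inter> \<Omega>) x \<partial>lborel) = (\<integral>x. G' x * indicator U x \<partial>lborel)"
    proof (rule integral_cong_AE)
      show "AE x in lborel. G' x * indicator (U \<inter> \<Omega>) x = G' x * indicator U x"
        using G'(2) by eventually_elim (auto simp: G_def split: split_indicator split_indicator_asm)
    qed auto
    ultimately show ?thesis by simp
  qed
  \<comment> \<open>As \<open>ennreal\<close> sends negative numbers to 0, the two densities are the
    positive and the negative part of \<open>G'\<close>.\<close>
  define M1 where "M1 = density lborel (\<lambda>x. ennreal (G' x))"
  define M2 where "M2 = density lborel (\<lambda>x. ennreal (- G' x))"
  have em: "emeasure M1 U = emeasure M2 U \<and> emeasure M1 U \<noteq> \<infinity>" if U: "open U" for U
  proof -
    have [measurable]: "U \<in> sets borel" using U by simp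
    define A B where "A = (\<integral>x. max (G' x) 0 * indicator U x \<partial>lborel)" and "B = (\<integral>x. max (- G' x) 0 * indicator U x \<partial>lborel)"
    have i1: "integrable lborel (\<lambda>x. max (G' x) 0 * indicator U x)"
      and i2: "integrable lborel (\<lambda>x. max (- G' x) 0 * indicator U x)"
      by (rule Bochner_Integration.integrable_bound[OF G'i]; auto split: split_indicator)+
    have "A - B = (\<integral>x. G' x * indicator U x \<partial>lborel)"
      unfolding A_def B_def Bochner_Integration.integral_diff[OF i1 i2, symmetric]
      by (intro Bochner_Integration.integral_cong) (auto split: split_indicator)
    then have AB: "A = B" using U0[OF U] by simp
    have "emeasure M1 U = (\<integral>\<^sup>+x. ennreal (max (G' x) 0 * indicator U x) \<partial>lborel)"
      unfolding M1_def by (subst emeasure_density) (auto intro!: nn_integral_cong simp: max_def ennreal_neg split: split_indicator)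
    also have "\<dots> = ennreal A" unfolding A_def using i1 by (intro nn_integral_eq_integral) auto
    finally have 1: "emeasure M1 U = ennreal A" .
    have "emeasure M2 U = (\<integral>\<^sup>+x. ennreal (max (- G' x) 0 * indicator U x) \<partial>lborel)"
      unfolding M2_def by (subst emeasure_density) (auto intro!: nn_integral_cong simp: max_def ennreal_neg split: split_indicator)
    also have "\<dots> = ennreal B" unfolding B_def using i2 by (intro nn_integral_eq_integral) auto
    finally show ?thesis using 1 AB by simp
  qed
  have "M1 = M2"
  proof (rule measure_eqI_generator_eq[of "Collect open" UNIV _ _ "\<lambda>_. UNIV"])
    show "Int_stable (Collect open :: (real \<times> real) set set)" by (auto simp: Int_stable_def)
    show "sets M1 = sigma_sets UNIV (Collect open)" "sets M2 = sigma_sets UNIV (Collect open)"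
      by (simp_all add: M1_def M2_def borel_def)
    show "\<And>i. emeasure M1 UNIV \<noteq> \<infinity>" using em[OF open_UNIV] by blast
  qed (use em in auto)
  then have "AE x in lborel. ennreal (G' x) = ennreal (- G' x)"
    unfolding M1_def M2_def by (subst (asm) sigma_finite_measure.density_unique_iff[OF sigma_finite_lborel]) auto
  then have "AE x in lborel. G' x = 0"
  proof eventually_elim
    fix x assume "ennreal (G' x) = ennreal (- G' x)"
    then show "G' x = 0" by (cases "G' x \<ge> 0") (auto simp: ennreal_neg ennreal_eq_0_iff)
  qed
  then have "AE x in lebesgue. G' x = 0" by (rule AE_completion)
  with AEL have "AE x in lebesgue. G x = 0" by eventually_elim simp
  then have "AE x in lebesgue. x \<in> \<Omega> \<longrightarrow> g x = 0" by eventually_elim (auto simp: G_def)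
  then show ?thesis using AE_restrict_space_iff[OF \<Omega>s(2)] by simp
qed

section \<open>Completeness of L2 and passage to the limit\<close>

lemma norm_diff_sq_le:
  fixes a b :: "'b::real_normed_vector"
  shows "(norm (a - b))\<^sup>2 \<le> 2 * (norm a)\<^sup>2 + 2 * (norm b)\<^sup>2"
proof -
  have "(norm (a - b))\<^sup>2 \<le> (norm a + norm b)\<^sup>2" by (intro power_mono norm_triangle_ineq4) auto
  also have "\<dots> \<le> 2 * (norm a)\<^sup>2 + 2 * (norm b)\<^sup>2"
    using zero_le_power2[of "norm a - norm b"] by (simp add: power2_eq_square algebra_simps)
  finally show ?thesis .
qed

lemma integrable_norm_diff_sq:
  fixes f g :: "'a \<Rightarrow> 'b::euclidean_space"
  assumes [measurable]: "f \<in> borel_measurable M" "g \<in> borel_measurable M"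
    and "integrable M (\<lambda>x. (norm (f x))\<^sup>2)" "integrable M (\<lambda>x. (norm (g x))\<^sup>2)"
  shows "integrable M (\<lambda>x. (norm (f x - g x))\<^sup>2)"
proof (rule Bochner_Integration.integrable_bound)
  show "integrable M (\<lambda>x. 2 * (norm (f x))\<^sup>2 + 2 * (norm (g x))\<^sup>2)" using assms by simp
qed (auto simp: norm_diff_sq_le)

lemma integral_norm_diff_sq_le:
  fixes f g :: "'a \<Rightarrow> 'b::euclidean_space"
  assumes "f \<in> borel_measurable M" "g \<in> borel_measurable M"
    and "integrable M (\<lambda>x. (norm (f x))\<^sup>2)" "integrable M (\<lambda>x. (norm (g x))\<^sup>2)"
  shows "(\<integral>x. (norm (f x - g x))\<^sup>2 \<partial>M) \<le> 2 * (\<integral>x. (norm (f x))\<^sup>2 \<partial>M) + 2 * (\<integral>x. (norm (g x))\<^sup>2 \<partial>M)"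
proof -
  have "(\<integral>x. (norm (f x - g x))\<^sup>2 \<partial>M) \<le> (\<integral>x. 2 * (norm (f x))\<^sup>2 + 2 * (norm (g x))\<^sup>2 \<partial>M)"
    using assms by (intro integral_mono integrable_norm_diff_sq norm_diff_sq_le) auto
  then show ?thesis using assms by simp
qed

lemma integrable_mult_sq:
  fixes f g :: "'a \<Rightarrow> real"
  assumes [measurable]: "f \<in> borel_measurable M" "g \<in> borel_measurable M"
    and "integrable M (\<lambda>x. (f x)\<^sup>2)" "integrable M (\<lambda>x. (g x)\<^sup>2)"
  shows "integrable M (\<lambda>x. f x * g x)"
proof (rule Bochner_Integration.integrable_bound)
  show "integrable M (\<lambda>x. (f x)\<^sup>2 + (g x)\<^sup>2)" using assms by simp
  have "\<bar>a * b\<bar> \<le> a\<^sup>2 + b\<^sup>2" for a b :: real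
    using sum_squares_bound[of "\<bar>a\<bar>" "\<bar>b\<bar>"] zero_le_power2[of a] zero_le_power2[of b]
    unfolding abs_mult power2_abs by linarith
  then show "AE x in M. norm (f x * g x) \<le> norm ((f x)\<^sup>2 + (g x)\<^sup>2)" by simp
qed auto

text \<open>Fatou's lemma for real integrals. Integrability is part of the conclusion because the
  Bochner integral of a nonintegrable function is 0, so that the bound alone would say
  nothing.\<close>

lemma integrable_Fatou:
  fixes F :: "nat \<Rightarrow> 'a \<Rightarrow> real"
  assumes [measurable]: "G \<in> borel_measurable M" and F: "\<And>n. integrable M (F n)" "\<And>n x. 0 \<le> F n x"
    and c: "\<And>n. N \<le> n \<Longrightarrow> (\<integral>x. F n x \<partial>M) \<le> c" and lim: "AE x in M. (\<lambda>n. F n x) \<longlonglongrightarrow> G x"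
  shows "integrable M G" "(\<integral>x. G x \<partial>M) \<le> c"
proof -
  have [measurable]: "F n \<in> borel_measurable M" for n using F(1) by blast
  have "0 \<le> (\<integral>x. F N x \<partial>M)" by (intro Bochner_Integration.integral_nonneg F(2))
  then have c0: "0 \<le> c" using c[of N] by simp
  have G0: "AE x in M. 0 \<le> G x"
    using lim by eventually_elim (auto intro: LIMSEQ_le_const F(2))
  have "(\<integral>\<^sup>+x. ennreal (G x) \<partial>M) = (\<integral>\<^sup>+x. liminf (\<lambda>n. ennreal (F n x)) \<partial>M)"
  proof (rule nn_integral_cong_AE)
    show "AE x in M. ennreal (G x) = liminf (\<lambda>n. ennreal (F n x))"
      using lim by eventually_elim (auto intro!: lim_imp_Liminf[symmetric] tendsto_ennrealI)
  qed
  also have "\<dots> \<le> liminf (\<lambda>n. \<integral>\<^sup>+x. ennreal (F n x) \<partial>M)" by (rule nn_integral_liminf) simp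
  also have "\<dots> \<le> liminf (\<lambda>n. ennreal c)"
  proof (rule Liminf_mono)
    show "\<forall>\<^sub>F n in sequentially. (\<integral>\<^sup>+x. ennreal (F n x) \<partial>M) \<le> ennreal c"
      using eventually_ge_at_top[of N]
      by eventually_elim (auto simp: nn_integral_eq_integral F intro!: ennreal_leI c)
  qed
  finally have le: "(\<integral>\<^sup>+x. ennreal (G x) \<partial>M) \<le> ennreal c" by (simp add: Liminf_const)
  show i: "integrable M G"
    unfolding integrable_iff_bounded
  proof
    have "(\<integral>\<^sup>+x. ennreal (norm (G x)) \<partial>M) = (\<integral>\<^sup>+x. ennreal (G x) \<partial>M)"
      by (rule nn_integral_cong_AE) (use G0 in eventually_elim, simp)
    then show "(\<integral>\<^sup>+x. ennreal (norm (G x)) \<partial>M) < \<infinity>" using le by (simp add: le_less_trans ennreal_less_top)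
  qed simp
  show "(\<integral>x. G x \<partial>M) \<le> c"
    using le c0 nn_integral_eq_integral[OF i G0] by (simp add: ennreal_le_iff)
qed

text \<open>Vector valued, so that one notion covers functions, their squares and their
  gradients.\<close>

definition L2_Cauchy :: "'a measure \<Rightarrow> (nat \<Rightarrow> 'a \<Rightarrow> 'b::euclidean_space) \<Rightarrow> bool" where
  "L2_Cauchy M f \<longleftrightarrow> (\<forall>n. f n \<in> borel_measurable M \<and> integrable M (\<lambda>x. (norm (f n x))\<^sup>2)) \<and>
     (\<forall>\<epsilon>>0. \<exists>N. \<forall>m\<ge>N. \<forall>n\<ge>N. (\<integral>x. (norm (f m x - f n x))\<^sup>2 \<partial>M) < \<epsilon>)"

lemma L2_CauchyD:
  assumes "L2_Cauchy M f"
  shows "f n \<in> borel_measurable M" "integrable M (\<lambda>x. (norm (f n x))\<^sup>2)"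
    "0 < \<epsilon> \<Longrightarrow> \<exists>N. \<forall>m\<ge>N. \<forall>n\<ge>N. (\<integral>x. (norm (f m x - f n x))\<^sup>2 \<partial>M) < \<epsilon>"
  using assms unfolding L2_Cauchy_def by simp_all

text \<open>The Riesz-Fischer argument. Squared increments with integral at most 8^(-k), weighted by
  4^k, still have a convergent sum of integrals; almost everywhere they are therefore eventually
  below 4^(-k), and the increments themselves are dominated by 2^(-k).\<close>

lemma L2_Cauchy_AE_subseq:
  fixes f :: "nat \<Rightarrow> 'a \<Rightarrow> 'b::euclidean_space"
  assumes "L2_Cauchy M f"
  obtains r :: "nat \<Rightarrow> nat" and g where "strict_mono r" "g \<in> borel_measurable M"
    "AE x in M. (\<lambda>n. f (r n) x) \<longlonglongrightarrow> g x"
proof -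
  have [measurable]: "f n \<in> borel_measurable M" and i: "integrable M (\<lambda>x. (norm (f n x))\<^sup>2)" for n
    using L2_CauchyD[OF assms] by blast+
  have "\<forall>k. \<exists>N. \<forall>m\<ge>N. \<forall>n\<ge>N. (\<integral>x. (norm (f m x - f n x))\<^sup>2 \<partial>M) < (1/8) ^ k"
    by (intro allI L2_CauchyD[OF assms]) simp
  from choice[OF this] obtain N where N: "\<forall>k. \<forall>m\<ge>N k. \<forall>n\<ge>N k. (\<integral>x. (norm (f m x - f n x))\<^sup>2 \<partial>M) < (1/8) ^ k"
    by (elim exE)
  \<comment> \<open>Partial sums of the successors make the indices strictly increasing and at least
    \<open>N k\<close>.\<close>
  define r where "r k = (\<Sum>i\<le>k. Suc (N i))" for k
  have r: "strict_mono r" by (rule strict_monoI_Suc) (simp add: r_def)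
  have rN: "N k \<le> r k" for k
  proof -
    have "Suc (N k) \<le> r k" unfolding r_def by (rule member_le_sum) auto
    then show ?thesis by simp
  qed
  define d where "d k x = (norm (f (r (Suc k)) x - f (r k) x))\<^sup>2" for k x
  have di: "integrable M (d k)" for k unfolding d_def[abs_def] by (intro integrable_norm_diff_sq i) auto
  have dm[measurable]: "d k \<in> borel_measurable M" for k using di by blast
  have d0: "0 \<le> d k x" for k x by (simp add: d_def)
  have "r k \<le> r (Suc k)" for k using r by (simp add: strict_mono_less_eq)
  then have dN: "(\<integral>x. d k x \<partial>M) \<le> (1/8) ^ k" for k
    unfolding d_def using N[rule_format, of k "r (Suc k)" "r k"] rN[of k] by (simp add: order_trans[of "N k" "r k"] less_imp_le)
  have "(\<integral>\<^sup>+x. (\<Sum>k. ennreal (4 ^ k * d k x)) \<partial>M) = (\<Sum>k. \<integral>\<^sup>+x. ennreal (4 ^ k * d k x) \<partial>M)"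
    by (rule nn_integral_suminf) simp
  also have "\<dots> \<le> (\<Sum>k. ennreal ((1/2) ^ k))"
  proof (rule suminf_le)
    fix k
    have "(\<integral>\<^sup>+x. ennreal (4 ^ k * d k x) \<partial>M) = ennreal (4 ^ k * (\<integral>x. d k x \<partial>M))"
      using di[of k] d0[of k] by (subst nn_integral_eq_integral) auto
    also have "\<dots> \<le> ennreal (4 ^ k * (1/8) ^ k)" using dN[of k] by (intro ennreal_leI mult_left_mono) auto
    also have "4 ^ k * (1/8) ^ k = ((1/2) ^ k :: real)" by (simp add: power_mult_distrib[symmetric])
    finally show "(\<integral>\<^sup>+x. ennreal (4 ^ k * d k x) \<partial>M) \<le> ennreal ((1/2) ^ k)" .
  qed auto
  also have "\<dots> = ennreal (\<Sum>k. (1/2) ^ k)" by (rule suminf_ennreal2) (auto intro: summable_geometric)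
  also have "\<dots> < \<infinity>" by simp
  finally have "(\<integral>\<^sup>+x. (\<Sum>k. ennreal (4 ^ k * d k x)) \<partial>M) \<noteq> \<infinity>" by simp
  then have "AE x in M. (\<Sum>k. ennreal (4 ^ k * d k x)) \<noteq> \<infinity>"
    by (rule nn_integral_noteq_infinite[rotated]) simp
  then have conv: "AE x in M. convergent (\<lambda>n. f (r n) x)"
  proof eventually_elim
    fix x assume "(\<Sum>k. ennreal (4 ^ k * d k x)) \<noteq> \<infinity>"
    then have "summable (\<lambda>k. 4 ^ k * d k x)" by (intro summable_suminf_not_top) (auto simp: d0)
    then have "(\<lambda>k. 4 ^ k * d k x) \<longlonglongrightarrow> 0" by (rule summable_LIMSEQ_zero)
    then have "\<forall>\<^sub>F k in sequentially. 4 ^ k * d k x < 1" by (rule order_tendstoD) simp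
    then have "\<forall>\<^sub>F k in sequentially. norm (f (r (Suc k)) x - f (r k) x) \<le> (1/2) ^ k"
    proof eventually_elim
      fix k assume "4 ^ k * d k x < 1"
      then have "(2 ^ k * norm (f (r (Suc k)) x - f (r k) x))\<^sup>2 < 1\<^sup>2"
        by (simp add: d_def power_mult_distrib power_mult[symmetric] mult.commute[of k] power_mult)
      then have "2 ^ k * norm (f (r (Suc k)) x - f (r k) x) < 1" by (rule power2_less_imp_less) simp
      then show "norm (f (r (Suc k)) x - f (r k) x) \<le> (1/2) ^ k" by (simp add: field_simps)
    qed
    then have "summable (\<lambda>k. f (r (Suc k)) x - f (r k) x)"
      by (rule summable_comparison_test_ev) (auto intro: summable_geometric)
    then have "convergent (\<lambda>n. \<Sum>k<n. (f (r (Suc k)) x - f (r k) x))" by (simp add: summable_iff_convergent)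
    then have "convergent (\<lambda>n. f (r n) x - f (r 0) x)" unfolding sum_lessThan_telescope[of "\<lambda>k. f (r k) x"] .
    then show "convergent (\<lambda>n. f (r n) x)"
      using convergent_add[of "\<lambda>n. f (r n) x - f (r 0) x" "\<lambda>_. f (r 0) x"] by (simp add: convergent_const)
  qed
  show ?thesis
  proof (rule that[OF r])
    show "(\<lambda>x. lim (\<lambda>n. f (r n) x)) \<in> borel_measurable M" by (rule borel_measurable_lim_metric) simp
    show "AE x in M. (\<lambda>n. f (r n) x) \<longlonglongrightarrow> lim (\<lambda>n. f (r n) x)"
      using conv by eventually_elim (simp add: convergent_LIMSEQ_iff)
  qed
qed

lemma sqrt_tendsto_0: "(f \<longlongrightarrow> 0) F \<Longrightarrow> ((\<lambda>x. sqrt (f x)) \<longlongrightarrow> 0) F"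
  using tendsto_real_sqrt[of f 0 F] by simp

lemma L2_pairing_tendsto:
  fixes f :: "nat \<Rightarrow> 'a \<Rightarrow> real"
  assumes [measurable]: "\<And>n. f n \<in> borel_measurable M" "g \<in> borel_measurable M" "k \<in> borel_measurable M"
    and i: "\<And>n. integrable M (\<lambda>x. (f n x)\<^sup>2)" "integrable M (\<lambda>x. (g x)\<^sup>2)" "integrable M (\<lambda>x. (k x)\<^sup>2)"
    and lim: "(\<lambda>n. \<integral>x. (f n x - g x)\<^sup>2 \<partial>M) \<longlonglongrightarrow> 0"
  shows "(\<lambda>n. \<integral>x. f n x * k x \<partial>M) \<longlonglongrightarrow> (\<integral>x. g x * k x \<partial>M)"
proof -
  have id: "integrable M (\<lambda>x. (f n x - g x)\<^sup>2)" for n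
    using integrable_norm_diff_sq[of "f n" M g] i by simp
  have A: "(\<lambda>n. sqrt ((\<integral>x. (f n x - g x)\<^sup>2 \<partial>M) * (\<integral>x. (k x)\<^sup>2 \<partial>M))) \<longlonglongrightarrow> 0"
    by (intro sqrt_tendsto_0 tendsto_mult_left_zero lim)
  have B: "norm ((\<integral>x. f n x * k x \<partial>M) - (\<integral>x. g x * k x \<partial>M)) \<le> sqrt ((\<integral>x. (f n x - g x)\<^sup>2 \<partial>M) * (\<integral>x. (k x)\<^sup>2 \<partial>M))" for n
  proof -
    have "(\<integral>x. f n x * k x \<partial>M) - (\<integral>x. g x * k x \<partial>M) = (\<integral>x. (f n x - g x) * k x \<partial>M)"
      unfolding left_diff_distrib using i by (intro Bochner_Integration.integral_diff[symmetric] integrable_mult_sq) auto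
    moreover have "(\<integral>x. (f n x - g x) * k x \<partial>M)\<^sup>2 \<le> (\<integral>x. (f n x - g x)\<^sup>2 \<partial>M) * (\<integral>x. (k x)\<^sup>2 \<partial>M)"
      using i id by (intro integral_Cauchy_Schwarz integrable_mult_sq) auto
    ultimately show ?thesis by (simp add: real_le_rsqrt)
  qed
  have "(\<lambda>n. (\<integral>x. f n x * k x \<partial>M) - (\<integral>x. g x * k x \<partial>M)) \<longlonglongrightarrow> 0"
    by (rule Lim_null_comparison[OF always_eventually A]) (intro allI B)
  then show ?thesis by (simp add: LIM_zero_iff)
qed

lemma L2_norm_tendsto:
  fixes f :: "nat \<Rightarrow> 'a \<Rightarrow> 'b::euclidean_space"
  assumes [measurable]: "\<And>n. f n \<in> borel_measurable M" "g \<in> borel_measurable M"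
    and i: "\<And>n. integrable M (\<lambda>x. (norm (f n x))\<^sup>2)" "integrable M (\<lambda>x. (norm (g x))\<^sup>2)"
    and lim: "(\<lambda>n. \<integral>x. (norm (f n x - g x))\<^sup>2 \<partial>M) \<longlonglongrightarrow> 0"
  shows "(\<lambda>n. \<integral>x. (norm (f n x))\<^sup>2 \<partial>M) \<longlonglongrightarrow> (\<integral>x. (norm (g x))\<^sup>2 \<partial>M)"
proof -
  have id: "integrable M (\<lambda>x. (norm (f n x - g x))\<^sup>2)" for n
    using i by (intro integrable_norm_diff_sq) auto
  define e where "e n = (\<integral>x. (norm (f n x - g x))\<^sup>2 \<partial>M)" for n
  define G where "G = (\<integral>x. (norm (g x))\<^sup>2 \<partial>M)"
  have "(\<lambda>n. e n + 2 * sqrt (e n * G)) \<longlonglongrightarrow> 0 + 2 * 0"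
    using lim unfolding e_def[symmetric] by (intro tendsto_add tendsto_mult tendsto_const sqrt_tendsto_0 tendsto_mult_left_zero)
  then have A: "(\<lambda>n. e n + 2 * sqrt (e n * G)) \<longlonglongrightarrow> 0" by simp
  have B: "norm ((\<integral>x. (norm (f n x))\<^sup>2 \<partial>M) - G) \<le> e n + 2 * sqrt (e n * G)" for n
  proof -
    have inn: "integrable M (\<lambda>x. norm (f n x - g x) * norm (g x))" using i id by (intro integrable_mult_sq) auto
    have "(\<integral>x. norm (f n x - g x) * norm (g x) \<partial>M)\<^sup>2 \<le> e n * G"
      unfolding e_def G_def using i id inn by (intro integral_Cauchy_Schwarz)
    then have cs: "(\<integral>x. norm (f n x - g x) * norm (g x) \<partial>M) \<le> sqrt (e n * G)" by (simp add: real_le_rsqrt)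
    have pt: "\<bar>(norm a)\<^sup>2 - (norm b)\<^sup>2\<bar> \<le> (norm (a - b))\<^sup>2 + 2 * (norm (a - b) * norm b)" for a b :: 'b
    proof -
      have "(norm a)\<^sup>2 - (norm b)\<^sup>2 = (norm (a - b))\<^sup>2 + 2 * ((a - b) \<bullet> b)"
        by (simp add: power2_norm_eq_inner inner_diff_left inner_diff_right inner_commute)
      moreover have "\<bar>(a - b) \<bullet> b\<bar> \<le> norm (a - b) * norm b" by (rule Cauchy_Schwarz_ineq2)
      ultimately show ?thesis using zero_le_power2[of "norm (a - b)"] by linarith
    qed
    have "\<bar>(\<integral>x. (norm (f n x))\<^sup>2 \<partial>M) - G\<bar> = \<bar>\<integral>x. (norm (f n x))\<^sup>2 - (norm (g x))\<^sup>2 \<partial>M\<bar>"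
      unfolding G_def using i by simp
    also have "\<dots> \<le> (\<integral>x. \<bar>(norm (f n x))\<^sup>2 - (norm (g x))\<^sup>2\<bar> \<partial>M)" by (rule integral_abs_bound)
    also have "\<dots> \<le> (\<integral>x. (norm (f n x - g x))\<^sup>2 + 2 * (norm (f n x - g x) * norm (g x)) \<partial>M)"
      using i id inn by (intro integral_mono pt) auto
    also have "\<dots> = e n + 2 * (\<integral>x. norm (f n x - g x) * norm (g x) \<partial>M)"
      unfolding e_def using id inn by simp
    finally show ?thesis using cs by simp
  qed
  have "(\<lambda>n. (\<integral>x. (norm (f n x))\<^sup>2 \<partial>M) - G) \<longlonglongrightarrow> 0"
    by (rule Lim_null_comparison[OF always_eventually A]) (intro allI B)
  then show ?thesis unfolding G_def by (simp add: LIM_zero_iff)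
qed

text \<open>With n fixed, Fatou's lemma along the subsequence transfers the Cauchy bound to the
  limit, so the whole sequence converges in L2 and its norms converge.\<close>

lemma L2_Cauchy_limit:
  fixes f :: "nat \<Rightarrow> 'a \<Rightarrow> 'b::euclidean_space"
  assumes C: "L2_Cauchy M f" and r: "strict_mono (r :: nat \<Rightarrow> nat)" and [measurable]: "g \<in> borel_measurable M"
    and lim: "AE x in M. (\<lambda>n. f (r n) x) \<longlonglongrightarrow> g x"
  shows "integrable M (\<lambda>x. (norm (g x))\<^sup>2)"
    "(\<lambda>n. \<integral>x. (norm (f n x - g x))\<^sup>2 \<partial>M) \<longlonglongrightarrow> 0"
    "(\<lambda>n. \<integral>x. (norm (f n x))\<^sup>2 \<partial>M) \<longlonglongrightarrow> (\<integral>x. (norm (g x))\<^sup>2 \<partial>M)"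
proof -
  have [measurable]: "f n \<in> borel_measurable M" and i: "integrable M (\<lambda>x. (norm (f n x))\<^sup>2)" for n
    using L2_CauchyD[OF C] by blast+
  have *: "\<exists>N. \<forall>n\<ge>N. integrable M (\<lambda>x. (norm (f n x - g x))\<^sup>2) \<and> (\<integral>x. (norm (f n x - g x))\<^sup>2 \<partial>M) \<le> e"
    if "0 < e" for e
  proof -
    obtain N where N: "\<forall>m\<ge>N. \<forall>n\<ge>N. (\<integral>x. (norm (f m x - f n x))\<^sup>2 \<partial>M) < e"
      using L2_CauchyD(3)[OF C \<open>0 < e\<close>] by (elim exE)
    have "integrable M (\<lambda>x. (norm (f n x - g x))\<^sup>2) \<and> (\<integral>x. (norm (f n x - g x))\<^sup>2 \<partial>M) \<le> e" if "N \<le> n" for n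
    proof -
      have 1: "AE x in M. (\<lambda>m. (norm (f n x - f (r m) x))\<^sup>2) \<longlonglongrightarrow> (norm (f n x - g x))\<^sup>2"
        using lim by eventually_elim (intro tendsto_intros)
      have 2: "(\<integral>x. (norm (f n x - f (r m) x))\<^sup>2 \<partial>M) \<le> e" if "N \<le> m" for m
        using N[rule_format, OF \<open>N \<le> n\<close>, of "r m"] that seq_suble[OF r, of m] by simp
      have 3: "integrable M (\<lambda>x. (norm (f n x - f (r m) x))\<^sup>2)" for m
        by (intro integrable_norm_diff_sq i) auto
      have 4: "(\<lambda>x. (norm (f n x - g x))\<^sup>2) \<in> borel_measurable M" by measurable
      show ?thesis
        using integrable_Fatou[OF 4 3 _ 2 1] by simp
    qed
    then show ?thesis by (intro exI[of _ N]) simp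
  qed
  obtain n where n: "integrable M (\<lambda>x. (norm (f n x - g x))\<^sup>2)" using *[of 1] by auto
  have "integrable M (\<lambda>x. (norm (f n x - (f n x - g x)))\<^sup>2)"
    by (rule integrable_norm_diff_sq) (use n i in auto)
  then show gi: "integrable M (\<lambda>x. (norm (g x))\<^sup>2)" by simp
  show l: "(\<lambda>n. \<integral>x. (norm (f n x - g x))\<^sup>2 \<partial>M) \<longlonglongrightarrow> 0"
  proof (rule LIMSEQ_I)
    fix e :: real assume "0 < e"
    then obtain N where N: "\<forall>n\<ge>N. integrable M (\<lambda>x. (norm (f n x - g x))\<^sup>2) \<and> (\<integral>x. (norm (f n x - g x))\<^sup>2 \<partial>M) \<le> e / 2"
      using *[OF half_gt_zero] by blast
    have "norm ((\<integral>x. (norm (f n x - g x))\<^sup>2 \<partial>M) - 0) < e" if "N \<le> n" for n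
    proof -
      have "(\<integral>x. (norm (f n x - g x))\<^sup>2 \<partial>M) \<le> e / 2" using N that by blast
      moreover have "0 \<le> (\<integral>x. (norm (f n x - g x))\<^sup>2 \<partial>M)" by simp
      ultimately show ?thesis using \<open>0 < e\<close> by simp
    qed
    then show "\<exists>N. \<forall>n\<ge>N. norm ((\<integral>x. (norm (f n x - g x))\<^sup>2 \<partial>M) - 0) < e" by (intro exI[of _ N]) simp
  qed
  show "(\<lambda>n. \<integral>x. (norm (f n x))\<^sup>2 \<partial>M) \<longlonglongrightarrow> (\<integral>x. (norm (g x))\<^sup>2 \<partial>M)"
    by (rule L2_norm_tendsto) (use i gi l in auto)
qed

section \<open>Weak gradients on bounded open sets\<close>

definition grad :: "(real \<times> real \<Rightarrow> real) \<Rightarrow> real \<times> real \<Rightarrow> real \<times> real" where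
  "grad \<phi> p = (dx \<phi> p, dy \<phi> p)"

lemma grad_inner_Basis: "i \<in> Basis \<Longrightarrow> grad \<phi> p \<bullet> i = partial_deriv i \<phi> p"
  by (auto simp: grad_def Basis_plane)

lemma norm_grad_sq: "(norm (grad \<phi> p))\<^sup>2 = (dx \<phi> p)\<^sup>2 + (dy \<phi> p)\<^sup>2"
  by (simp add: grad_def norm_Pair)

lemma grad_diff:
  assumes "smooth \<phi>" "smooth \<psi>"
  shows "grad (\<lambda>x. \<phi> x - \<psi> x) p = grad \<phi> p - grad \<psi> p"
  using assms by (simp add: grad_def partial_deriv_diff)

lemma Lp_norm_2_sq: "(Lp_norm \<Omega> 2 f)\<^sup>2 = (\<integral>x. (norm (f x))\<^sup>2 \<partial>lebesgue_on \<Omega>)"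
proof -
  have "0 \<le> (\<integral>x. (norm (f x))\<^sup>2 \<partial>lebesgue_on \<Omega>)" by simp
  then show ?thesis by (simp add: Lp_norm_def powr_half_sqrt)
qed

lemma Lp_norm_4_sq: "(Lp_norm \<Omega> 4 (f :: _ \<Rightarrow> real))\<^sup>2 = sqrt (\<integral>x. (f x) ^ 4 \<partial>lebesgue_on \<Omega>)"
proof -
  define I where "I = (\<integral>x. (f x) ^ 4 \<partial>lebesgue_on \<Omega>)"
  have "0 \<le> I" by (simp add: I_def)
  have "Lp_norm \<Omega> 4 f = I powr (1 / 4)" by (simp add: Lp_norm_def I_def)
  then have "(Lp_norm \<Omega> 4 f)\<^sup>2 = (I powr (1 / 4)) powr 2" by simp
  also have "\<dots> = sqrt I" using \<open>0 \<le> I\<close> by (simp add: powr_powr powr_half_sqrt del: powr_numeral)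
  finally show ?thesis by (simp add: I_def)
qed

lemma L2_diff:
  assumes "f \<in> L2 \<Omega>" "g \<in> L2 \<Omega>"
  shows "(\<lambda>x. f x - g x) \<in> L2 \<Omega>"
  using assms by (auto simp: L2_def intro!: integrable_norm_diff_sq)

lemma integrable_inner_Basis_sq:
  fixes g :: "'a \<Rightarrow> 'b::euclidean_space"
  assumes "g \<in> borel_measurable M" "integrable M (\<lambda>x. (norm (g x))\<^sup>2)" "i \<in> Basis"
  shows "(\<lambda>x. g x \<bullet> i) \<in> borel_measurable M" "integrable M (\<lambda>x. (g x \<bullet> i)\<^sup>2)"
proof -
  show m: "(\<lambda>x. g x \<bullet> i) \<in> borel_measurable M" using assms(1) by measurable
  have "(g x \<bullet> i)\<^sup>2 \<le> (norm (g x))\<^sup>2" for x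
    using power_mono[OF Basis_le_norm[OF assms(3), of "g x"], of 2] by simp
  then show "integrable M (\<lambda>x. (g x \<bullet> i)\<^sup>2)"
    using m by (intro Bochner_Integration.integrable_bound[OF assms(2)]) auto
qed

text \<open>Boundedness provides finite measure, a Poincare inequality, and the common support for
  Rellich's theorem.\<close>

locale plane_domain =
  fixes \<Omega> :: "(real \<times> real) set"
  assumes open_dom: "open \<Omega>" and bounded_dom: "bounded \<Omega>"
begin

abbreviation "TF \<equiv> test_functions \<Omega>"
abbreviation "L \<equiv> lebesgue_on \<Omega>"

lemma finite_measure_L: "finite_measure L"
  by (intro finite_measure_lebesgue_on lmeasurable_open bounded_dom open_dom)

lemma smooth_borel: "smooth f \<Longrightarrow> f \<in> borel_measurable borel"
  by (intro borel_measurable_continuous_onI smooth_continuous_on)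

lemma smooth_L: "smooth f \<Longrightarrow> f \<in> borel_measurable L"
  by (intro borel_measurable_lebesgue_on smooth_borel)

lemma smooth_integral_L:
  assumes "smooth f" "csupp f" "\<And>x. x \<notin> \<Omega> \<Longrightarrow> f x = 0"
  shows "(\<integral>x. f x \<partial>L) = (\<integral>x. f x \<partial>lborel)" "integrable L f"
  using integral_lebesgue_on_eq[OF open_dom smooth_borel[OF assms(1)] assms(3)] integrable_csupp_smooth[OF assms(1,2)]
  by simp_all

lemma TF_facts:
  assumes "\<phi> \<in> TF"
  shows "smooth \<phi>" "csupp \<phi>" "\<phi> \<in> borel_measurable L" "integrable L (\<lambda>x. (\<phi> x)\<^sup>2)"
    "(\<integral>x. (\<phi> x)\<^sup>2 \<partial>L) = (\<integral>x. (\<phi> x)\<^sup>2 \<partial>lborel)" "integrable L (\<lambda>x. (\<phi> x) ^ 4)"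
    "(\<integral>x. (\<phi> x) ^ 4 \<partial>L) = (\<integral>x. (\<phi> x) ^ 4 \<partial>lborel)"
    "i \<in> Basis \<Longrightarrow> partial_deriv i \<phi> \<in> borel_measurable L"
proof -
  show s: "smooth \<phi>" "csupp \<phi>" using assms by (rule test_functions_smooth, rule test_functions_csupp)
  show "\<phi> \<in> borel_measurable L" using s(1) by (rule smooth_L)
  have p: "smooth (\<lambda>x. \<phi> x ^ n)" "n > 0 \<Longrightarrow> csupp (\<lambda>x. \<phi> x ^ n)" "n > 0 \<Longrightarrow> x \<notin> \<Omega> \<Longrightarrow> \<phi> x ^ n = 0" for n x
    using s test_functions_outside[OF assms] by (auto intro: smooth_power csupp_power)
  show "integrable L (\<lambda>x. (\<phi> x)\<^sup>2)" "(\<integral>x. (\<phi> x)\<^sup>2 \<partial>L) = (\<integral>x. (\<phi> x)\<^sup>2 \<partial>lborel)"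
    using smooth_integral_L[OF p(1,2,3), of 2] by simp_all
  show "integrable L (\<lambda>x. (\<phi> x) ^ 4)" "(\<integral>x. (\<phi> x) ^ 4 \<partial>L) = (\<integral>x. (\<phi> x) ^ 4 \<partial>lborel)"
    using smooth_integral_L[OF p(1,2,3), of 4] by simp_all
  show "partial_deriv i \<phi> \<in> borel_measurable L" if "i \<in> Basis" using s(1) that by (intro smooth_L smooth_intros)
qed

lemma TF_L2: "\<phi> \<in> TF \<Longrightarrow> \<phi> \<in> L2 \<Omega>"
  using TF_facts[of \<phi>] by (simp add: L2_def)

lemma TF_grad_facts:
  assumes "\<phi> \<in> TF"
  shows "grad \<phi> \<in> borel_measurable L" "integrable L (\<lambda>x. (norm (grad \<phi> x))\<^sup>2)"
    "(\<integral>x. (norm (grad \<phi> x))\<^sup>2 \<partial>L) = energy \<phi>"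
proof -
  have s: "smooth \<phi>" "csupp \<phi>" using TF_facts(1,2)[OF assms] by (auto simp: Basis_plane)
  have "continuous_on UNIV (grad \<phi>)"
    unfolding grad_def[abs_def] using s by (intro continuous_intros smooth_continuous_on smooth_intros)
  then show "grad \<phi> \<in> borel_measurable L"
    by (intro borel_measurable_lebesgue_on borel_measurable_continuous_onI)
  have "smooth (\<lambda>x. (dx \<phi> x)\<^sup>2 + (dy \<phi> x)\<^sup>2)" "csupp (\<lambda>x. (dx \<phi> x)\<^sup>2 + (dy \<phi> x)\<^sup>2)"
    using s by (intro smooth_intros csupp_intros; simp)+
  from smooth_integral_L[OF this] show "integrable L (\<lambda>x. (norm (grad \<phi> x))\<^sup>2)"
    "(\<integral>x. (norm (grad \<phi> x))\<^sup>2 \<partial>L) = energy \<phi>"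
    by (simp_all add: norm_grad_sq energy_def test_functions_outside[OF assms])
qed

lemma TF_grad_L2: "\<phi> \<in> TF \<Longrightarrow> grad \<phi> \<in> L2 \<Omega>"
  using TF_grad_facts[of \<phi>] by (simp add: L2_def)

lemma energy_diff_eq:
  assumes "\<phi> \<in> TF" "\<psi> \<in> TF"
  shows "energy (\<lambda>x. \<phi> x - \<psi> x) = (\<integral>x. (norm (grad \<phi> x - grad \<psi> x))\<^sup>2 \<partial>L)"
  using TF_grad_facts(3)[OF test_functions_diff[OF assms]] assms
  by (simp add: grad_diff test_functions_smooth)

lemma TF_weak_gradient:
  assumes "\<phi> \<in> TF"
  shows "is_weak_gradient \<Omega> \<phi> (grad \<phi>)"
  unfolding is_weak_gradient_def
proof (intro ballI)
  fix \<psi> and i :: "real \<times> real" assume \<psi>: "\<psi> \<in> TF" and i: "i \<in> Basis"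
  have s: "smooth \<phi>" "csupp \<phi>" "smooth \<psi>" using TF_facts(1,2)[OF assms] TF_facts(1)[OF \<psi>] by auto
  have "(\<integral>x. \<phi> x * partial_deriv i \<psi> x \<partial>L) = (\<integral>x. \<phi> x * partial_deriv i \<psi> x \<partial>lborel)"
    using s i test_functions_outside[OF assms] by (intro smooth_integral_L smooth_intros csupp_mult_left) auto
  also have "\<dots> = - (\<integral>x. partial_deriv i \<phi> x * \<psi> x \<partial>lborel)" using s i by (intro integration_by_parts) auto
  also have "(\<integral>x. partial_deriv i \<phi> x * \<psi> x \<partial>lborel) = (\<integral>x. partial_deriv i \<phi> x * \<psi> x \<partial>L)"
    using s i test_functions_outside[OF assms]
    by (intro smooth_integral_L(1)[symmetric] smooth_intros csupp_mult_left csupp_partial_deriv) auto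
  finally show "(\<integral>x. \<phi> x * partial_deriv i \<psi> x \<partial>L) = - (\<integral>x. grad \<phi> x \<bullet> i * \<psi> x \<partial>L)"
    by (simp add: grad_inner_Basis[OF i])
qed

lemma TF_partial_sq:
  assumes "\<psi> \<in> TF" "i \<in> Basis"
  shows "integrable L (\<lambda>x. (partial_deriv i \<psi> x)\<^sup>2)"
  using integrable_inner_Basis_sq(2)[OF TF_grad_facts(1,2)[OF assms(1)] assms(2)]
  by (simp add: grad_inner_Basis[OF assms(2)])

lemma L2D: "u \<in> L2 \<Omega> \<Longrightarrow> u \<in> borel_measurable L \<and> integrable L (\<lambda>x. (norm (u x))\<^sup>2)"
  by (simp add: L2_def)

lemma is_weak_gradient_diff:
  assumes u: "u \<in> L2 \<Omega>" "v \<in> L2 \<Omega>" and g: "g \<in> L2 \<Omega>" "k \<in> L2 \<Omega>"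
    and w: "is_weak_gradient \<Omega> u g" "is_weak_gradient \<Omega> v k"
  shows "is_weak_gradient \<Omega> (\<lambda>x. u x - v x) (\<lambda>x. g x - k x)"
  unfolding is_weak_gradient_def
proof (intro ballI)
  fix \<psi> and i :: "real \<times> real" assume \<psi>: "\<psi> \<in> TF" and i: "i \<in> Basis"
  have 1: "integrable L (\<lambda>x. f x * partial_deriv i \<psi> x)" if "f \<in> L2 \<Omega>" for f
    using L2D[OF that] TF_facts(8)[OF \<psi> i] TF_partial_sq[OF \<psi> i] by (intro integrable_mult_sq) auto
  have 2: "integrable L (\<lambda>x. (f x \<bullet> i) * \<psi> x)" if "f \<in> L2 \<Omega>" for f
    using L2D[OF that] TF_facts(3,4)[OF \<psi>] integrable_inner_Basis_sq[of f L, OF _ _ i] by (intro integrable_mult_sq) auto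
  show "(\<integral>x. (u x - v x) * partial_deriv i \<psi> x \<partial>L) = - (\<integral>x. (g x - k x) \<bullet> i * \<psi> x \<partial>L)"
    using w \<psi> i 1[OF u(1)] 1[OF u(2)] 2[OF g(1)] 2[OF g(2)]
    by (simp add: is_weak_gradient_def left_diff_distrib inner_diff_left)
qed

lemma L2_integrable:
  fixes f :: "real \<times> real \<Rightarrow> real"
  assumes "f \<in> borel_measurable L" "integrable L (\<lambda>x. (f x)\<^sup>2)"
  shows "integrable L f"
proof -
  interpret finite_measure L by (rule finite_measure_L)
  show ?thesis using integrable_mult_sq[of f L "\<lambda>_. 1"] assms by simp
qed

text \<open>The fundamental lemma is applied to each component of the difference; square integrable
  functions are integrable since the domain has finite measure.\<close>

lemma weak_gradient_unique:
  assumes g: "g \<in> L2 \<Omega>" "k \<in> L2 \<Omega>" and w: "is_weak_gradient \<Omega> u g" "is_weak_gradient \<Omega> u k"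
  shows "AE x in L. g x = k x"
proof -
  have "AE x in L. (g x - k x) \<bullet> i = 0" if i: "i \<in> Basis" for i
  proof (rule fundamental_lemma[OF open_dom])
    have d: "(\<lambda>x. g x - k x) \<in> borel_measurable L" "integrable L (\<lambda>x. (norm (g x - k x))\<^sup>2)"
      using L2D[OF L2_diff[OF g]] by auto
    show "integrable L (\<lambda>x. (g x - k x) \<bullet> i)"
      using integrable_inner_Basis_sq[OF d i] by (rule L2_integrable)
    fix \<psi> assume \<psi>: "\<psi> \<in> TF"
    have 2: "integrable L (\<lambda>x. (f x \<bullet> i) * \<psi> x)" if "f \<in> L2 \<Omega>" for f
      using L2D[OF that] TF_facts(3,4)[OF \<psi>] integrable_inner_Basis_sq[of f L, OF _ _ i] by (intro integrable_mult_sq) auto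
    show "(\<integral>x. (g x - k x) \<bullet> i * \<psi> x \<partial>L) = 0"
      using w \<psi> i 2[OF g(1)] 2[OF g(2)]
      by (simp add: is_weak_gradient_def left_diff_distrib inner_diff_left)
  qed
  then have "AE x in L. \<forall>i\<in>Basis. (g x - k x) \<bullet> i = 0" by (intro AE_finite_allI) auto
  then show ?thesis
  proof eventually_elim
    fix x assume "\<forall>i\<in>Basis. (g x - k x) \<bullet> i = 0"
    then have "g x - k x = 0" by (simp only: euclidean_all_zero_iff)
    then show "g x = k x" by simp
  qed
qed

lemma weak_gradient_H1:
  assumes "u \<in> H1 \<Omega>"
  shows "weak_gradient \<Omega> u \<in> L2 \<Omega>" "is_weak_gradient \<Omega> u (weak_gradient \<Omega> u)"
proof -
  have "\<exists>g. g \<in> L2 \<Omega> \<and> is_weak_gradient \<Omega> u g" using assms by (auto simp: H1_def)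
  from someI_ex[OF this] show "weak_gradient \<Omega> u \<in> L2 \<Omega>" "is_weak_gradient \<Omega> u (weak_gradient \<Omega> u)"
    by (auto simp: weak_gradient_def)
qed

text \<open>Removes the choice operator in \<open>weak_gradient\<close>: any square integrable weak
  gradient at hand computes the Dirichlet integral.\<close>

lemma weak_gradient_eq:
  assumes "u \<in> L2 \<Omega>" "g \<in> L2 \<Omega>" "is_weak_gradient \<Omega> u g"
  shows "u \<in> H1 \<Omega>" "AE x in L. weak_gradient \<Omega> u x = g x"
    "(Lp_norm \<Omega> 2 (weak_gradient \<Omega> u))\<^sup>2 = (\<integral>x. (norm (g x))\<^sup>2 \<partial>L)"
proof -
  show h: "u \<in> H1 \<Omega>" using assms by (auto simp: H1_def)
  show ae: "AE x in L. weak_gradient \<Omega> u x = g x"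
    using weak_gradient_H1[OF h] assms by (intro weak_gradient_unique)
  have [measurable]: "weak_gradient \<Omega> u \<in> borel_measurable L" "g \<in> borel_measurable L"
    using L2D weak_gradient_H1[OF h] assms by auto
  show "(Lp_norm \<Omega> 2 (weak_gradient \<Omega> u))\<^sup>2 = (\<integral>x. (norm (g x))\<^sup>2 \<partial>L)"
    unfolding Lp_norm_2_sq by (rule integral_cong_AE) (use ae in \<open>auto elim: eventually_mono\<close>)
qed

section \<open>Completion of the test functions in energy\<close>

lemma Poincare_TF: "\<exists>C\<ge>0. \<forall>\<phi>\<in>TF. (\<integral>x. (\<phi> x)\<^sup>2 \<partial>lborel) \<le> C * energy \<phi>"
proof -
  obtain H where H: "\<And>p. p \<in> \<Omega> \<Longrightarrow> norm p \<le> H" using bounded_dom unfolding bounded_iff by blast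
  have "(\<integral>x. (\<phi> x)\<^sup>2 \<partial>lborel) \<le> 4 * H\<^sup>2 * energy \<phi>" if \<phi>: "\<phi> \<in> TF" for \<phi>
  proof (rule Poincare_strip[OF test_functions_smooth[OF \<phi>] test_functions_csupp[OF \<phi>]])
    fix p :: "real \<times> real" assume "H < \<bar>snd p\<bar>"
    then have "p \<notin> \<Omega>" using H[of p] norm_snd_le[of "snd p" "fst p"] by auto
    then show "\<phi> p = 0" using test_functions_outside[OF \<phi>] by blast
  qed
  then show ?thesis by (intro exI[of _ "4 * H\<^sup>2"]) auto
qed

text \<open>Only the gradients are required to be Cauchy; the Poincare inequality supplies the L2
  part of the H1 norm.\<close>

definition energy_Cauchy :: "(nat \<Rightarrow> real \<times> real \<Rightarrow> real) \<Rightarrow> bool" where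
  "energy_Cauchy \<phi> \<longleftrightarrow> (\<forall>n. \<phi> n \<in> TF) \<and>
     (\<forall>\<epsilon>>0. \<exists>N. \<forall>m\<ge>N. \<forall>n\<ge>N. energy (\<lambda>x. \<phi> m x - \<phi> n x) < \<epsilon>)"

lemma energy_CauchyD:
  assumes "energy_Cauchy \<phi>"
  shows "\<phi> n \<in> TF" "0 < \<epsilon> \<Longrightarrow> \<exists>N. \<forall>m\<ge>N. \<forall>n\<ge>N. energy (\<lambda>x. \<phi> m x - \<phi> n x) < \<epsilon>"
  using assms by (simp_all add: energy_Cauchy_def)

lemma energy_Cauchy_subseq:
  assumes "energy_Cauchy \<phi>" "strict_mono (r :: nat \<Rightarrow> nat)"
  shows "energy_Cauchy (\<lambda>n. \<phi> (r n))"
  unfolding energy_Cauchy_def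
proof (intro conjI allI impI)
  show "\<phi> (r n) \<in> TF" for n using energy_CauchyD(1)[OF assms(1)] .
  fix \<epsilon> :: real assume "0 < \<epsilon>"
  from energy_CauchyD(2)[OF assms(1) this] obtain N where N: "\<forall>m\<ge>N. \<forall>n\<ge>N. energy (\<lambda>x. \<phi> m x - \<phi> n x) < \<epsilon>"
    by (elim exE)
  show "\<exists>N. \<forall>m\<ge>N. \<forall>n\<ge>N. energy (\<lambda>x. \<phi> (r m) x - \<phi> (r n) x) < \<epsilon>"
    using N seq_suble[OF assms(2)] by (intro exI[of _ N]) (meson order_trans)
qed

lemma energy_Cauchy_L2_Cauchy_grad:
  assumes "energy_Cauchy \<phi>"
  shows "L2_Cauchy L (\<lambda>n. grad (\<phi> n))"
  unfolding L2_Cauchy_def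
proof (intro conjI allI impI)
  note t = energy_CauchyD(1)[OF assms]
  show "grad (\<phi> n) \<in> borel_measurable L" "integrable L (\<lambda>x. (norm (grad (\<phi> n) x))\<^sup>2)" for n
    using TF_grad_facts[OF t] by auto
  show "\<exists>N. \<forall>m\<ge>N. \<forall>n\<ge>N. (\<integral>x. (norm (grad (\<phi> m) x - grad (\<phi> n) x))\<^sup>2 \<partial>L) < \<epsilon>" if "0 < \<epsilon>" for \<epsilon>
    using energy_CauchyD(2)[OF assms that] by (simp add: energy_diff_eq t)
qed

lemma energy_Cauchy_bounded:
  assumes "energy_Cauchy \<phi>"
  obtains E where "0 < E" "\<And>n. energy (\<phi> n) \<le> E"
proof -
  have "(\<lambda>n. energy (\<phi> n)) \<longlonglongrightarrow> x \<Longrightarrow> bounded (range (\<lambda>n. energy (\<phi> n)))" for x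
    by (intro convergent_imp_bounded) (auto simp: convergent_def)
  moreover obtain r g where r: "strict_mono (r :: nat \<Rightarrow> nat)" and g: "g \<in> borel_measurable L"
    "AE x in L. (\<lambda>n. grad (\<phi> (r n)) x) \<longlonglongrightarrow> g x"
    by (rule L2_Cauchy_AE_subseq[OF energy_Cauchy_L2_Cauchy_grad[OF assms]])
  have "(\<lambda>n. energy (\<phi> n)) \<longlonglongrightarrow> (\<integral>x. (norm (g x))\<^sup>2 \<partial>L)"
    using L2_Cauchy_limit(3)[OF energy_Cauchy_L2_Cauchy_grad[OF assms] r g]
    by (simp add: TF_grad_facts(3)[OF energy_CauchyD(1)[OF assms]])
  ultimately have "bounded (range (\<lambda>n. energy (\<phi> n)))" by blast
  then show ?thesis using that unfolding bounded_pos by (auto simp: abs_le_iff)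
qed

text \<open>The claim on squares stands for convergence in L4. The difference of two squares is sum
  times difference; by Cauchy-Schwarz its L2 norm is bounded by L4 norms, and these by the energy
  through the case k = 2 of \<open>integral_even_power_le\<close> and Poincare's inequality.\<close>

lemma energy_Cauchy_L2_Cauchy:
  assumes "energy_Cauchy \<phi>"
  shows "L2_Cauchy L \<phi>" "L2_Cauchy L (\<lambda>n x. (\<phi> n x)\<^sup>2)"
proof -
  note t = energy_CauchyD(1)[OF assms]
  obtain C where C: "0 \<le> C" "\<And>\<phi>. \<phi> \<in> TF \<Longrightarrow> (\<integral>x. (\<phi> x)\<^sup>2 \<partial>lborel) \<le> C * energy \<phi>"
    using Poincare_TF by blast
  obtain E where E: "0 < E" "\<And>n. energy (\<phi> n) \<le> E" by (rule energy_Cauchy_bounded[OF assms]) blast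
  note f = TF_facts
  show "L2_Cauchy L \<phi>"
    unfolding L2_Cauchy_def
  proof (intro conjI allI impI)
    show "\<phi> n \<in> borel_measurable L" "integrable L (\<lambda>x. (norm (\<phi> n x))\<^sup>2)" for n
      using f(3,4)[OF t] by auto
    fix \<epsilon> :: real assume \<epsilon>: "0 < \<epsilon>"
    then obtain N where N: "\<forall>m\<ge>N. \<forall>n\<ge>N. energy (\<lambda>x. \<phi> m x - \<phi> n x) < \<epsilon> / (C + 1)"
      using energy_CauchyD(2)[OF assms, of "\<epsilon> / (C + 1)"] C(1) by auto
    have "(\<integral>x. (norm (\<phi> m x - \<phi> n x))\<^sup>2 \<partial>L) < \<epsilon>" if "m \<ge> N" "n \<ge> N" for m n
    proof -
      have d: "(\<lambda>x. \<phi> m x - \<phi> n x) \<in> TF" by (intro test_functions_diff t)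
      have "(\<integral>x. (norm (\<phi> m x - \<phi> n x))\<^sup>2 \<partial>L) \<le> C * energy (\<lambda>x. \<phi> m x - \<phi> n x)"
        using f(5)[OF d] C(2)[OF d] by simp
      also have "\<dots> \<le> (C + 1) * energy (\<lambda>x. \<phi> m x - \<phi> n x)" by (intro mult_right_mono) auto
      also have "\<dots> < (C + 1) * (\<epsilon> / (C + 1))" using N that C(1) by (intro mult_strict_left_mono) auto
      finally show ?thesis using C(1) by simp
    qed
    then show "\<exists>N. \<forall>m\<ge>N. \<forall>n\<ge>N. (\<integral>x. (norm (\<phi> m x - \<phi> n x))\<^sup>2 \<partial>L) < \<epsilon>" by blast
  qed
  show "L2_Cauchy L (\<lambda>n x. (\<phi> n x)\<^sup>2)"
    unfolding L2_Cauchy_def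
  proof (intro conjI allI impI)
    show "(\<lambda>x. (\<phi> n x)\<^sup>2) \<in> borel_measurable L" "integrable L (\<lambda>x. (norm ((\<phi> n x)\<^sup>2))\<^sup>2)" for n
      using f(3,6)[OF t[of n]] by (auto simp: power_mult[symmetric])
    fix \<epsilon> :: real assume \<epsilon>: "0 < \<epsilon>"
    \<comment> \<open>The estimate ends with 4 C times the energies of sum and difference, and the
      sum has energy at most 4 E; the summand 1 makes \<open>K\<close> positive.\<close>
    define K where "K = 16 * C * E + 1"
    have K: "0 < K" using C(1) E(1) by (simp add: K_def add_nonneg_pos)
    obtain N where N: "\<forall>m\<ge>N. \<forall>n\<ge>N. energy (\<lambda>x. \<phi> m x - \<phi> n x) < \<epsilon> / K"
      using energy_CauchyD(2)[OF assms, of "\<epsilon> / K"] K \<epsilon> by auto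
    have "(\<integral>x. (norm ((\<phi> m x)\<^sup>2 - (\<phi> n x)\<^sup>2))\<^sup>2 \<partial>L) < \<epsilon>" if "m \<ge> N" "n \<ge> N" for m n
    proof -
      define d s where "d x = \<phi> m x - \<phi> n x" and "s x = \<phi> m x + \<phi> n x" for x
      have d: "d \<in> TF" and s: "s \<in> TF" unfolding d_def[abs_def] s_def[abs_def] by (intro test_functions_diff test_functions_add t)+
      have ps: "(\<lambda>x. s x * d x) \<in> TF" using d by (rule test_functions_mult) (rule test_functions_smooth[OF s])
      have q: "(\<integral>x. (\<psi> x) ^ 4 \<partial>lborel) \<le> (2 * energy \<psi>)\<^sup>2 * C" if \<psi>: "\<psi> \<in> TF" for \<psi>
      proof -
        have "(\<integral>x. (\<psi> x) ^ 4 \<partial>lborel) \<le> 4 * energy \<psi> * (\<integral>x. (\<psi> x)\<^sup>2 \<partial>lborel)"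
          using integral_even_power_le[OF f(1,2)[OF \<psi>], of 2] by simp
        also have "\<dots> \<le> 4 * energy \<psi> * (C * energy \<psi>)" by (intro mult_left_mono C(2) \<psi>) auto
        finally show ?thesis by (simp add: power2_eq_square algebra_simps)
      qed
      have i1: "integrable lborel (\<lambda>x. ((\<psi> x)\<^sup>2)\<^sup>2)" if "\<psi> \<in> TF" for \<psi>
        using f(1,2)[OF that] by (intro integrable_csupp_smooth smooth_power csupp_power) auto
      have i2: "integrable lborel (\<lambda>x. (d x)\<^sup>2 * (s x)\<^sup>2)"
        using f(1,2)[OF d] f(1,2)[OF s] by (intro integrable_csupp_smooth smooth_mult smooth_power csupp_power csupp_mult_left) auto
      have "(\<integral>x. (norm ((\<phi> m x)\<^sup>2 - (\<phi> n x)\<^sup>2))\<^sup>2 \<partial>L) = (\<integral>x. (s x * d x)\<^sup>2 \<partial>L)"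
        by (intro Bochner_Integration.integral_cong) (auto simp: d_def s_def power2_eq_square algebra_simps)
      also have "\<dots> = (\<integral>x. (d x)\<^sup>2 * (s x)\<^sup>2 \<partial>lborel)" using f(5)[OF ps] by (simp add: power_mult_distrib mult.commute)
      finally have eq: "(\<integral>x. (norm ((\<phi> m x)\<^sup>2 - (\<phi> n x)\<^sup>2))\<^sup>2 \<partial>L) = (\<integral>x. (d x)\<^sup>2 * (s x)\<^sup>2 \<partial>lborel)" .
      have "(\<integral>x. (d x)\<^sup>2 * (s x)\<^sup>2 \<partial>lborel)\<^sup>2 \<le> (\<integral>x. ((d x)\<^sup>2)\<^sup>2 \<partial>lborel) * (\<integral>x. ((s x)\<^sup>2)\<^sup>2 \<partial>lborel)"
        by (intro integral_Cauchy_Schwarz i1 i2 d s)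
      also have "\<dots> = (\<integral>x. (d x) ^ 4 \<partial>lborel) * (\<integral>x. (s x) ^ 4 \<partial>lborel)" by (simp add: power_mult[symmetric])
      also have "\<dots> \<le> ((2 * energy d)\<^sup>2 * C) * ((2 * energy s)\<^sup>2 * C)"
        using C(1) by (intro mult_mono q d s) auto
      also have "\<dots> = (4 * C * energy s * energy d)\<^sup>2" by (simp add: power2_eq_square algebra_simps)
      finally have "(\<integral>x. (d x)\<^sup>2 * (s x)\<^sup>2 \<partial>lborel) \<le> 4 * C * energy s * energy d"
        using C(1) by (intro power2_le_imp_le[of "\<integral>x. (d x)\<^sup>2 * (s x)\<^sup>2 \<partial>lborel"]) auto
      also have "energy s \<le> 2 * energy (\<phi> m) + 2 * energy (\<phi> n)"
        using energy_parallelogram[OF f(1,2)[OF t[of m]] f(1,2)[OF t[of n]]] energy_nonneg[of d] unfolding d_def[abs_def] s_def[abs_def] by linarith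
      then have "4 * C * energy s * energy d \<le> 4 * C * (4 * E) * energy d"
        using E(2)[of m] E(2)[of n] C(1) by (intro mult_right_mono mult_left_mono) auto
      also have "4 * C * (4 * E) * energy d \<le> K * energy d" by (intro mult_right_mono) (auto simp: K_def)
      also have "\<dots> < K * (\<epsilon> / K)" using N that K unfolding d_def[abs_def] by (intro mult_strict_left_mono) auto
      also have "\<dots> = \<epsilon>" using K by simp
      finally show ?thesis using eq by simp
    qed
    then show "\<exists>N. \<forall>m\<ge>N. \<forall>n\<ge>N. (\<integral>x. (norm ((\<phi> m x)\<^sup>2 - (\<phi> n x)\<^sup>2))\<^sup>2 \<partial>L) < \<epsilon>" by blast
  qed
qed

text \<open>Working form of membership in \<open>H1_0\<close>: by \<open>approximates_limits\<close>
  and \<open>H1_0_approximates\<close>, the functions admitting such a sequence are exactly the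
  members of that space.\<close>

definition approximates :: "(nat \<Rightarrow> real \<times> real \<Rightarrow> real) \<Rightarrow> (real \<times> real \<Rightarrow> real) \<Rightarrow> bool" where
  "approximates \<phi> u \<longleftrightarrow> energy_Cauchy \<phi> \<and> u \<in> borel_measurable L \<and> (AE x in L. (\<lambda>n. \<phi> n x) \<longlonglongrightarrow> u x)"

lemma energy_Cauchy_approximates:
  assumes "energy_Cauchy \<phi>"
  obtains r :: "nat \<Rightarrow> nat" and u where "strict_mono r" "approximates (\<lambda>n. \<phi> (r n)) u"
proof -
  obtain r :: "nat \<Rightarrow> nat" and u where "strict_mono r" "u \<in> borel_measurable L" "AE x in L. (\<lambda>n. \<phi> (r n) x) \<longlonglongrightarrow> u x"
    by (rule L2_Cauchy_AE_subseq[OF energy_Cauchy_L2_Cauchy(1)[OF assms]])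
  then show ?thesis using energy_Cauchy_subseq[OF assms] that by (simp add: approximates_def)
qed

text \<open>The gradients have a limit in L2, and passing to the limit in the integration by parts
  formula shows that it is a weak gradient of \<open>u\<close>. Energies then converge as L2 norms
  of gradients, and quartic integrals as L2 norms of squares.\<close>

lemma approximates_limits:
  assumes a: "approximates \<phi> u"
  shows "u \<in> H1_0 \<Omega>" "integrable L (\<lambda>x. (u x) ^ 4)"
    "(\<lambda>n. \<integral>x. (\<phi> n x) ^ 4 \<partial>lborel) \<longlonglongrightarrow> (\<integral>x. (u x) ^ 4 \<partial>L)"
    "(\<lambda>n. energy (\<phi> n)) \<longlonglongrightarrow> (Lp_norm \<Omega> 2 (weak_gradient \<Omega> u))\<^sup>2"
proof -
  have C: "energy_Cauchy \<phi>" and [measurable]: "u \<in> borel_measurable L" and lim: "AE x in L. (\<lambda>n. \<phi> n x) \<longlonglongrightarrow> u x"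
    using a by (auto simp: approximates_def)
  note t = energy_CauchyD(1)[OF C]
  note f = TF_facts[OF t]
  \<comment> \<open>Almost everywhere convergence is known along the full sequence, so the identity
    plays the subsequence.\<close>
  have id: "strict_mono (\<lambda>n::nat. n)" by (simp add: strict_mono_def)
  have u2: "integrable L (\<lambda>x. (norm (u x))\<^sup>2)" "(\<lambda>n. \<integral>x. (norm (\<phi> n x - u x))\<^sup>2 \<partial>L) \<longlonglongrightarrow> 0"
    using L2_Cauchy_limit[OF energy_Cauchy_L2_Cauchy(1)[OF C] id _ lim] by simp_all
  have lim2: "AE x in L. (\<lambda>n. (\<phi> n x)\<^sup>2) \<longlonglongrightarrow> (u x)\<^sup>2"
    using lim by eventually_elim (intro tendsto_power)
  have u4: "integrable L (\<lambda>x. (norm ((u x)\<^sup>2))\<^sup>2)"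
    "(\<lambda>n. \<integral>x. (norm ((\<phi> n x)\<^sup>2))\<^sup>2 \<partial>L) \<longlonglongrightarrow> (\<integral>x. (norm ((u x)\<^sup>2))\<^sup>2 \<partial>L)"
    using L2_Cauchy_limit[OF energy_Cauchy_L2_Cauchy(2)[OF C] id _ lim2] by simp_all
  show "integrable L (\<lambda>x. (u x) ^ 4)" using u4(1) by (simp add: power_mult[symmetric])
  show "(\<lambda>n. \<integral>x. (\<phi> n x) ^ 4 \<partial>lborel) \<longlonglongrightarrow> (\<integral>x. (u x) ^ 4 \<partial>L)"
    using u4(2) f(7) by (simp add: power_mult[symmetric])
  obtain r :: "nat \<Rightarrow> nat" and g where r: "strict_mono r" and g: "g \<in> borel_measurable L"
    "AE x in L. (\<lambda>n. grad (\<phi> (r n)) x) \<longlonglongrightarrow> g x"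
    by (rule L2_Cauchy_AE_subseq[OF energy_Cauchy_L2_Cauchy_grad[OF C]])
  note gl = L2_Cauchy_limit[OF energy_Cauchy_L2_Cauchy_grad[OF C] r g]
  have uL: "u \<in> L2 \<Omega>" and gL: "g \<in> L2 \<Omega>" using u2 gl g by (simp_all add: L2_def)
  have wg: "is_weak_gradient \<Omega> u g"
    unfolding is_weak_gradient_def
  proof (intro ballI)
    fix \<psi> and i :: "real \<times> real" assume \<psi>: "\<psi> \<in> TF" and i: "i \<in> Basis"
    have 1: "(\<lambda>n. \<integral>x. \<phi> n x * partial_deriv i \<psi> x \<partial>L) \<longlonglongrightarrow> (\<integral>x. u x * partial_deriv i \<psi> x \<partial>L)"
      using u2 f(3,4) TF_facts(8)[OF \<psi> i] TF_partial_sq[OF \<psi> i] by (intro L2_pairing_tendsto) auto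
    have G: "(\<lambda>x. grad (\<phi> n) x \<bullet> i) \<in> borel_measurable L" "integrable L (\<lambda>x. (grad (\<phi> n) x \<bullet> i)\<^sup>2)" for n
      using integrable_inner_Basis_sq[OF TF_grad_facts(1,2)[OF t] i] by auto
    have g': "(\<lambda>x. g x \<bullet> i) \<in> borel_measurable L" "integrable L (\<lambda>x. (g x \<bullet> i)\<^sup>2)"
      using integrable_inner_Basis_sq[OF g(1) gl(1) i] by auto
    have dI: "(\<lambda>x. grad (\<phi> n) x - g x) \<in> borel_measurable L" "integrable L (\<lambda>x. (norm (grad (\<phi> n) x - g x))\<^sup>2)" for n
      using L2D[OF L2_diff[OF TF_grad_L2[OF t] gL]] by auto
    have sq: "(\<lambda>n. \<integral>x. (grad (\<phi> n) x \<bullet> i - g x \<bullet> i)\<^sup>2 \<partial>L) \<longlonglongrightarrow> 0"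
    proof (rule tendsto_sandwich[OF _ _ tendsto_const gl(2)])
      show "\<forall>\<^sub>F n in sequentially. (\<integral>x. (grad (\<phi> n) x \<bullet> i - g x \<bullet> i)\<^sup>2 \<partial>L) \<le> (\<integral>x. (norm (grad (\<phi> n) x - g x))\<^sup>2 \<partial>L)"
      proof (intro always_eventually allI integral_mono)
        fix n x
        show "integrable L (\<lambda>x. (grad (\<phi> n) x \<bullet> i - g x \<bullet> i)\<^sup>2)"
          using integrable_inner_Basis_sq(2)[OF dI i] by (simp add: inner_diff_left)
        show "integrable L (\<lambda>x. (norm (grad (\<phi> n) x - g x))\<^sup>2)" by (rule dI)
        show "(grad (\<phi> n) x \<bullet> i - g x \<bullet> i)\<^sup>2 \<le> (norm (grad (\<phi> n) x - g x))\<^sup>2"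
          using power_mono[OF Basis_le_norm[OF i, of "grad (\<phi> n) x - g x"], of 2] by (simp add: inner_diff_left)
      qed
    qed simp
    have 2: "(\<lambda>n. \<integral>x. (grad (\<phi> n) x \<bullet> i) * \<psi> x \<partial>L) \<longlonglongrightarrow> (\<integral>x. (g x \<bullet> i) * \<psi> x \<partial>L)"
      by (intro L2_pairing_tendsto G g' sq TF_facts(3,4)[OF \<psi>])
    have 3: "(\<integral>x. \<phi> n x * partial_deriv i \<psi> x \<partial>L) = - (\<integral>x. (grad (\<phi> n) x \<bullet> i) * \<psi> x \<partial>L)" for n
      using TF_weak_gradient[OF t] \<psi> i unfolding is_weak_gradient_def by blast
    show "(\<integral>x. u x * partial_deriv i \<psi> x \<partial>L) = - (\<integral>x. (g x \<bullet> i) * \<psi> x \<partial>L)"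
      using LIMSEQ_unique[OF 1[unfolded 3] tendsto_minus[OF 2]] .
  qed
  note W = weak_gradient_eq[OF uL gL wg]
  show "(\<lambda>n. energy (\<phi> n)) \<longlonglongrightarrow> (Lp_norm \<Omega> 2 (weak_gradient \<Omega> u))\<^sup>2"
    using gl(3) unfolding W(3) by (simp add: TF_grad_facts(3)[OF t])
  have hn: "H1_norm \<Omega> (\<lambda>x. u x - \<phi> n x) = sqrt ((\<integral>x. (norm (\<phi> n x - u x))\<^sup>2 \<partial>L) + (\<integral>x. (norm (grad (\<phi> n) x - g x))\<^sup>2 \<partial>L))" for n
  proof -
    have "is_weak_gradient \<Omega> (\<lambda>x. u x - \<phi> n x) (\<lambda>x. g x - grad (\<phi> n) x)"
      by (intro is_weak_gradient_diff uL TF_L2 t gL TF_grad_L2 wg TF_weak_gradient)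
    from weak_gradient_eq(3)[OF L2_diff[OF uL TF_L2[OF t]] L2_diff[OF gL TF_grad_L2[OF t]] this]
    show ?thesis unfolding H1_norm_def Lp_norm_2_sq[of _ "\<lambda>x. u x - \<phi> n x"] by (simp add: norm_minus_commute power2_commute)
  qed
  have hl: "(\<lambda>n. H1_norm \<Omega> (\<lambda>x. u x - \<phi> n x)) \<longlonglongrightarrow> 0"
    unfolding hn using tendsto_add[OF u2(2) gl(2)] by (intro sqrt_tendsto_0) simp
  show "u \<in> H1_0 \<Omega>"
    unfolding H1_0_def
  proof (intro CollectI conjI allI impI W(1))
    fix \<epsilon> :: real assume "0 < \<epsilon>"
    from order_tendstoD(2)[OF hl this] obtain n where "H1_norm \<Omega> (\<lambda>x. u x - \<phi> n x) < \<epsilon>"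
      by (auto simp: eventually_sequentially)
    then show "\<exists>\<phi>\<in>TF. H1_norm \<Omega> (\<lambda>x. u x - \<phi> x) < \<epsilon>" using t by blast
  qed
qed

text \<open>The gradient part of the H1 norm makes the approximating test functions Cauchy in
  energy, the L2 part gives almost everywhere convergence along a subsequence.\<close>

lemma H1_0_approximates:
  assumes u: "u \<in> H1_0 \<Omega>"
  obtains \<phi> where "approximates \<phi> u"
proof -
  have uH: "u \<in> H1 \<Omega>" and ap: "\<And>\<epsilon>. 0 < \<epsilon> \<Longrightarrow> \<exists>\<phi>\<in>TF. H1_norm \<Omega> (\<lambda>x. u x - \<phi> x) < \<epsilon>"
    using u by (auto simp: H1_0_def)
  have uL: "u \<in> L2 \<Omega>" using uH by (simp add: H1_def)
  define g where "g = weak_gradient \<Omega> u"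
  note g = weak_gradient_H1[OF uH, folded g_def]
  have "\<forall>n. \<exists>\<phi>. \<phi> \<in> TF \<and> H1_norm \<Omega> (\<lambda>x. u x - \<phi> x) < 1 / real (Suc n)"
    using ap by (auto simp: Bex_def)
  from choice[OF this] obtain \<psi> where \<psi>: "\<And>n. \<psi> n \<in> TF" "\<And>n. H1_norm \<Omega> (\<lambda>x. u x - \<psi> n x) < 1 / real (Suc n)"
    by auto
  define a where "a n = (\<integral>x. (norm (u x - \<psi> n x))\<^sup>2 \<partial>L)" for n
  define b where "b n = (\<integral>x. (norm (g x - grad (\<psi> n) x))\<^sup>2 \<partial>L)" for n
  have ab0: "0 \<le> a n" "0 \<le> b n" for n by (simp_all add: a_def b_def)
  have "a n + b n \<le> 1 / real (Suc n)" for n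
  proof -
    have "is_weak_gradient \<Omega> (\<lambda>x. u x - \<psi> n x) (\<lambda>x. g x - grad (\<psi> n) x)"
      by (intro is_weak_gradient_diff uL TF_L2 \<psi> g TF_grad_L2 TF_weak_gradient)
    from weak_gradient_eq(3)[OF L2_diff[OF uL TF_L2[OF \<psi>(1)]] L2_diff[OF g(1) TF_grad_L2[OF \<psi>(1)]] this]
    have "H1_norm \<Omega> (\<lambda>x. u x - \<psi> n x) = sqrt (a n + b n)"
      unfolding H1_norm_def Lp_norm_2_sq[of _ "\<lambda>x. u x - \<psi> n x"] a_def b_def by simp
    then have "sqrt (a n + b n) < 1 / real (Suc n)" using \<psi>(2)[of n] by simp
    then have "(sqrt (a n + b n))\<^sup>2 \<le> (1 / real (Suc n))\<^sup>2" using ab0[of n] by (intro power_mono) auto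
    also have "\<dots> \<le> 1 / real (Suc n)" unfolding power2_eq_square by (intro mult_left_le) auto
    finally show ?thesis using ab0[of n] by simp
  qed
  then have le: "a n \<le> inverse (real (Suc n))" "b n \<le> inverse (real (Suc n))" for n
    using ab0[of n] by (smt (verit) inverse_eq_divide)+
  have a0: "a \<longlonglongrightarrow> 0" and b0: "b \<longlonglongrightarrow> 0"
    by (rule tendsto_sandwich[OF always_eventually always_eventually tendsto_const LIMSEQ_inverse_real_of_nat]; use ab0 le in blast)+
  have C: "energy_Cauchy \<psi>"
    unfolding energy_Cauchy_def
  proof (intro conjI allI impI \<psi>(1))
    fix \<epsilon> :: real assume "0 < \<epsilon>"
    then have "\<forall>\<^sub>F n in sequentially. b n < \<epsilon> / 4" by (intro order_tendstoD(2)[OF b0]) simp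
    then obtain N where N: "\<And>n. N \<le> n \<Longrightarrow> b n < \<epsilon> / 4" by (auto simp: eventually_sequentially)
    have "energy (\<lambda>x. \<psi> m x - \<psi> n x) < \<epsilon>" if "N \<le> m" "N \<le> n" for m n
    proof -
      have "energy (\<lambda>x. \<psi> m x - \<psi> n x) = (\<integral>x. (norm ((g x - grad (\<psi> n) x) - (g x - grad (\<psi> m) x)))\<^sup>2 \<partial>L)"
        by (simp add: energy_diff_eq \<psi>)
      also have "\<dots> \<le> 2 * b n + 2 * b m"
        unfolding b_def using L2D[OF L2_diff[OF g(1) TF_grad_L2[OF \<psi>(1)]]] by (intro integral_norm_diff_sq_le) auto
      finally show ?thesis using N[OF that(1)] N[OF that(2)] by simp
    qed
    then show "\<exists>N. \<forall>m\<ge>N. \<forall>n\<ge>N. energy (\<lambda>x. \<psi> m x - \<psi> n x) < \<epsilon>" by blast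
  qed
  have i: "integrable L (\<lambda>x. (u x - \<psi> n x)\<^sup>2)" for n
    using L2D[OF L2_diff[OF uL TF_L2[OF \<psi>(1)]], of n] by simp
  have "(\<lambda>n. \<integral>x. norm ((u x - \<psi> n x)\<^sup>2) \<partial>L) \<longlonglongrightarrow> 0" using a0 by (simp add: a_def[abs_def])
  from tendsto_L1_AE_subseq[OF i this] obtain r where r: "strict_mono r" "AE x in L. (\<lambda>n. (u x - \<psi> (r n) x)\<^sup>2) \<longlonglongrightarrow> 0"
    by blast
  have "AE x in L. (\<lambda>n. \<psi> (r n) x) \<longlonglongrightarrow> u x"
    using r(2)
  proof eventually_elim
    fix x assume "(\<lambda>n. (u x - \<psi> (r n) x)\<^sup>2) \<longlonglongrightarrow> 0"
    then have "(\<lambda>n. u x - \<psi> (r n) x) \<longlonglongrightarrow> 0" using sqrt_tendsto_0 by (fastforce simp: tendsto_rabs_zero_iff)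
    from tendsto_diff[OF tendsto_const[of "u x"] this] show "(\<lambda>n. \<psi> (r n) x) \<longlonglongrightarrow> u x" by simp
  qed
  then have "approximates (\<lambda>n. \<psi> (r n)) u"
    using energy_Cauchy_subseq[OF C r(1)] L2D[OF uL] by (simp add: approximates_def)
  then show ?thesis by (rule that)
qed

end

section \<open>Attainment of the Sobolev constants\<close>

abbreviation quartic :: "(real \<times> real \<Rightarrow> real) \<Rightarrow> real" where
  "quartic u \<equiv> \<integral>x. (u x) ^ 4 \<partial>lborel"

lemma quartic_nonneg: "0 \<le> quartic u"
  by simp

lemma quartic_cmult: "quartic (\<lambda>x. c * u x) = c ^ 4 * quartic u"
  by (simp add: power_mult_distrib)

lemma energy_cmult:
  assumes "smooth u"
  shows "energy (\<lambda>x. c * u x) = c\<^sup>2 * energy u"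
  using assms by (simp add: energy_def partial_deriv_cmult power_mult_distrib distrib_left[symmetric])

lemma quartic_pos:
  assumes u: "smooth u" "csupp u" and p: "u p \<noteq> 0"
  shows "0 < quartic u"
proof (rule ccontr)
  assume "\<not> 0 < quartic u"
  then have "quartic u = 0" using quartic_nonneg[of u] by linarith
  moreover have "integrable lborel (\<lambda>x. (u x) ^ 4)"
    using u by (intro integrable_csupp_smooth smooth_power csupp_power) auto
  ultimately have "AE x in lborel. u x = 0"
    by (subst (asm) integral_nonneg_eq_0_iff_AE) auto
  then have N: "{x. u x \<noteq> 0} \<in> null_sets lborel"
    using smooth_continuous_on[OF u(1), of UNIV]
    by (subst (asm) AE_iff_null) (auto intro!: borel_open open_Collect_neq)
  have "open {x. u x \<noteq> 0}" using smooth_continuous_on[OF u(1), of UNIV] by (intro open_Collect_neq) auto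
  with p obtain e where e: "0 < e" "ball p e \<subseteq> {x. u x \<noteq> 0}" by (metis mem_Collect_eq openE)
  have "ball p e \<in> null_sets lborel" by (rule null_sets_subset[OF N]) (use e in auto)
  then have "measure lborel (ball p e) = 0" by (rule measure_eq_0_null_sets)
  with content_ball_pos[OF e(1), of p] show False by simp
qed

text \<open>The factor is \<open>quartic \<psi>\<close> to the power -1/4. The second equation
  records that \<open>energy\<close> and the square root of \<open>quartic\<close> are both
  homogeneous of degree 2, which transfers inequalities to and from the normalized function.\<close>

lemma normalize_quartic:
  assumes "0 < quartic \<psi>"
  shows "\<exists>c>0. quartic (\<lambda>x. c * \<psi> x) = 1 \<and> c\<^sup>2 * sqrt (quartic \<psi>) = 1"
proof (intro exI conjI)
  define s where "s = sqrt (quartic \<psi>)"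
  have s: "0 < s" "s\<^sup>2 = quartic \<psi>" using assms by (auto simp: s_def)
  show "0 < 1 / sqrt s" using s by simp
  have "(1 / sqrt s) ^ 4 = ((1 / sqrt s)\<^sup>2)\<^sup>2" by (simp add: power_mult[symmetric])
  also have "(1 / sqrt s)\<^sup>2 = 1 / s" using s by (simp add: power_divide)
  finally show "quartic (\<lambda>x. (1 / sqrt s) * \<psi> x) = 1"
    unfolding quartic_cmult using s assms by (simp add: power_divide)
  show "(1 / sqrt s)\<^sup>2 * sqrt (quartic \<psi>) = 1" using s by (simp add: power_divide s_def[symmetric])
qed

text \<open>The parallelogram law \<open>8 a\<^sup>4 + 8 b\<^sup>4 = (a + b)\<^sup>4 + 6 (a + b)\<^sup>2 (a - b)\<^sup>2 + (a - b)\<^sup>4\<close> integrated,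
  with the mixed term bounded by Cauchy--Schwarz.\<close>

lemma quartic_add_ge:
  assumes u: "smooth u" "csupp u" and v: "smooth v" "csupp v" and 1: "quartic u = 1" "quartic v = 1"
  shows "16 - 24 * sqrt (quartic (\<lambda>x. u x - v x)) - quartic (\<lambda>x. u x - v x) \<le> quartic (\<lambda>x. u x + v x)"
proof -
  define s d where "s x = u x + v x" and "d x = u x - v x" for x
  have s: "smooth s" "csupp s" and d: "smooth d" "csupp d"
    unfolding s_def[abs_def] d_def[abs_def] using u v by (auto intro: smooth_add csupp_add smooth_diff csupp_diff)
  note i = integrable_csupp_smooth smooth_power csupp_power smooth_mult csupp_mult_left
  have "16 = (\<integral>x. 8 * (u x) ^ 4 + 8 * (v x) ^ 4 \<partial>lborel)"
    using u v 1 by (subst Bochner_Integration.integral_add) (auto intro!: i integrable_mult_right)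
  also have "\<dots> = (\<integral>x. (s x) ^ 4 + (6 * ((d x)\<^sup>2 * (s x)\<^sup>2) + (d x) ^ 4) \<partial>lborel)"
    by (intro Bochner_Integration.integral_cong) (auto simp: s_def d_def power4_eq_xxxx power2_eq_square algebra_simps)
  also have "\<dots> = quartic s + (6 * (\<integral>x. (d x)\<^sup>2 * (s x)\<^sup>2 \<partial>lborel) + quartic d)"
  proof -
    have a: "integrable lborel (\<lambda>x. (s x) ^ 4)" "integrable lborel (\<lambda>x. 6 * ((d x)\<^sup>2 * (s x)\<^sup>2))" "integrable lborel (\<lambda>x. (d x) ^ 4)"
      using s d by (auto intro!: i integrable_mult_right)
    show ?thesis using a by (simp add: Bochner_Integration.integral_add Bochner_Integration.integrable_add)
  qed
  finally have eq: "16 = quartic s + 6 * (\<integral>x. (d x)\<^sup>2 * (s x)\<^sup>2 \<partial>lborel) + quartic d" by simp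
  define X where "X = (\<integral>x. (d x)\<^sup>2 * (s x)\<^sup>2 \<partial>lborel)"
  have X0: "0 \<le> X" by (simp add: X_def)
  have s16: "quartic s \<le> 16" using eq X0 quartic_nonneg[of d] unfolding X_def by linarith
  have "X\<^sup>2 \<le> (\<integral>x. ((d x)\<^sup>2)\<^sup>2 \<partial>lborel) * (\<integral>x. ((s x)\<^sup>2)\<^sup>2 \<partial>lborel)"
    unfolding X_def using s d by (intro integral_Cauchy_Schwarz i) auto
  also have "\<dots> = quartic d * quartic s" by (simp add: power_mult[symmetric])
  also have "\<dots> \<le> quartic d * 16" using s16 by (intro mult_left_mono) auto
  also have "\<dots> = (4 * sqrt (quartic d))\<^sup>2" by (simp add: power_mult_distrib)
  finally have "X \<le> 4 * sqrt (quartic d)" by (rule power2_le_imp_le) simp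
  with eq show ?thesis unfolding X_def s_def[abs_def] d_def[abs_def] by linarith
qed

context plane_domain
begin

lemma approximates_nonzero:
  assumes "approximates \<phi> u"
  shows "ae_zero \<Omega> u \<longleftrightarrow> (\<integral>x. (u x) ^ 4 \<partial>L) = 0"
  using integral_nonneg_eq_0_iff_AE[OF approximates_limits(2)[OF assms]] by (auto simp: ae_zero_def)

lemma sobolev_quotient_eq:
  "sobolev_quotient \<Omega> u = (Lp_norm \<Omega> 2 (weak_gradient \<Omega> u))\<^sup>2 / sqrt (\<integral>x. (u x) ^ 4 \<partial>L)"
  by (simp add: sobolev_quotient_def Lp_norm_4_sq)

text \<open>Energy and quartic integral both converge, so lower bounds need to be proved for test
  functions only.\<close>

lemma approximates_quotient_ge:
  assumes a: "approximates \<phi> u" and nz: "\<not> ae_zero \<Omega> u"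
    and I: "\<And>n. I * sqrt (quartic (\<phi> n)) \<le> energy (\<phi> n)"
  shows "I \<le> sobolev_quotient \<Omega> u"
proof -
  note l = approximates_limits[OF a]
  have "0 < (\<integral>x. (u x) ^ 4 \<partial>L)" using nz approximates_nonzero[OF a] by (simp add: less_le)
  moreover have "I * sqrt (\<integral>x. (u x) ^ 4 \<partial>L) \<le> (Lp_norm \<Omega> 2 (weak_gradient \<Omega> u))\<^sup>2"
    by (rule tendsto_le[OF _ l(4) tendsto_mult_left[OF tendsto_real_sqrt[OF l(3)]]]) (use I in auto)
  ultimately show ?thesis by (simp add: sobolev_quotient_eq pos_le_divide_eq)
qed

text \<open>A minimizing sequence converges in \<open>L\<^sup>4\<close> by Rellich's theorem; by the parallelogram laws it then
  converges in energy as well.\<close>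

lemma minimizer_exists:
  assumes V: "V \<subseteq> TF" "\<And>\<phi> \<psi>. \<phi> \<in> V \<Longrightarrow> \<psi> \<in> V \<Longrightarrow> (\<lambda>x. \<phi> x + \<psi> x) \<in> V" "\<And>\<phi> c. \<phi> \<in> V \<Longrightarrow> (\<lambda>x. c * \<phi> x) \<in> V"
    and ne: "\<phi>\<^sub>0 \<in> V" "\<phi>\<^sub>0 p \<noteq> 0"
  obtains I \<phi> u where "\<And>\<psi>. \<psi> \<in> V \<Longrightarrow> I * sqrt (quartic \<psi>) \<le> energy \<psi>"
    "\<And>n. \<phi> n \<in> V" "approximates \<phi> u" "\<not> ae_zero \<Omega> u" "sobolev_quotient \<Omega> u = I"
proof -
  have VT: "\<psi> \<in> V \<Longrightarrow> \<psi> \<in> TF" for \<psi> using V(1) by blast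
  note f = TF_facts(1,2)[OF VT]
  define Q where "Q = {energy \<psi> | \<psi>. \<psi> \<in> V \<and> quartic \<psi> = 1}"
  define I where "I = Inf Q"
  have "0 < quartic \<phi>\<^sub>0" using f[OF ne(1)] ne(2) by (rule quartic_pos)
  from normalize_quartic[OF this] have Qne: "Q \<noteq> {}" unfolding Q_def using V(3)[OF ne(1)] by blast
  have Qbd: "bdd_below Q" by (rule bdd_belowI[of _ 0]) (auto simp: Q_def)
  have I0: "0 \<le> I" unfolding I_def by (rule cInf_greatest[OF Qne]) (auto simp: Q_def)
  have low: "I * sqrt (quartic \<psi>) \<le> energy \<psi>" if \<psi>: "\<psi> \<in> V" for \<psi>
  proof (cases "quartic \<psi> = 0")
    case False
    then have "0 < quartic \<psi>" using quartic_nonneg[of \<psi>] by linarith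
    from normalize_quartic[OF this] obtain c where c: "0 < c" "quartic (\<lambda>x. c * \<psi> x) = 1" "c\<^sup>2 * sqrt (quartic \<psi>) = 1" by blast
    have "energy (\<lambda>x. c * \<psi> x) \<in> Q" unfolding Q_def using V(3)[OF \<psi>] c(2) by blast
    then have "I \<le> energy (\<lambda>x. c * \<psi> x)" unfolding I_def using Qbd by (rule cInf_lower)
    also have "\<dots> = c\<^sup>2 * energy \<psi>" by (rule energy_cmult[OF f(1)[OF \<psi>]])
    finally have "I * (c\<^sup>2 * sqrt (quartic \<psi>)) \<le> c\<^sup>2 * energy \<psi>" using c(3) by simp
    then have "c\<^sup>2 * (I * sqrt (quartic \<psi>)) \<le> c\<^sup>2 * energy \<psi>" by (simp add: mult_ac)
    then show ?thesis using c(1) by simp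
  qed simp
  have "\<exists>\<psi>. \<psi> \<in> V \<and> quartic \<psi> = 1 \<and> energy \<psi> < I + inverse (real (Suc n))" for n
  proof -
    have "Inf Q < I + inverse (real (Suc n))" by (simp add: I_def)
    from cInf_lessD[OF Qne this] show ?thesis unfolding Q_def by blast
  qed
  then have "\<exists>\<phi>. \<forall>n. \<phi> n \<in> V \<and> quartic (\<phi> n) = 1 \<and> energy (\<phi> n) < I + inverse (real (Suc n))"
    by (intro choice[of "\<lambda>n \<psi>. \<psi> \<in> V \<and> quartic \<psi> = 1 \<and> energy \<psi> < I + inverse (real (Suc n))"] allI)
  then obtain \<phi> where \<phi>: "\<And>n. \<phi> n \<in> V" "\<And>n. quartic (\<phi> n) = 1" "\<And>n. energy (\<phi> n) < I + inverse (real (Suc n))"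
    by blast
  have \<phi>1: "energy (\<phi> n) \<le> I + 1" for n
    using \<phi>(3)[of n] inverse_le_1_iff[of "real (Suc n)"] by simp
  obtain C where C: "0 \<le> C" "\<And>\<phi>. \<phi> \<in> TF \<Longrightarrow> (\<integral>x. (\<phi> x)\<^sup>2 \<partial>lborel) \<le> C * energy \<phi>"
    using Poincare_TF by blast
  obtain H where H: "\<And>p. p \<in> \<Omega> \<Longrightarrow> norm p \<le> H" using bounded_dom unfolding bounded_iff by blast
  have sm: "smooth (\<phi> n)" "csupp (\<phi> n)" for n using f[OF \<phi>(1)] by blast+
  have out: "\<phi> n x = 0" if "H < norm x" for n x
    using H[of x] that test_functions_outside(1)[OF VT[OF \<phi>(1)], of x n] by fastforce
  have E': "(\<integral>p. (\<phi> n p)\<^sup>2 \<partial>lborel) \<le> C * (I + 1)" for n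
    using C(2)[OF VT[OF \<phi>(1)], of n] mult_left_mono[OF \<phi>1 C(1), of n] by linarith
  obtain k where k: "strict_mono (k :: nat \<Rightarrow> nat)" and
    kC: "\<And>\<epsilon>. 0 < \<epsilon> \<Longrightarrow> \<exists>N. \<forall>m\<ge>N. \<forall>n\<ge>N. (\<integral>p. (\<phi> (k m) p - \<phi> (k n) p)\<^sup>2 \<partial>lborel) < \<epsilon>"
    by (rule Rellich[where \<phi> = \<phi> and r = H, OF sm(1) _ \<phi>1 E']) (rule out, assumption, rule that)
  define \<psi> where "\<psi> n = \<phi> (k n)" for n
  have \<psi>: "\<psi> n \<in> V" "quartic (\<psi> n) = 1" "energy (\<psi> n) \<le> I + inverse (real (Suc n))" "energy (\<psi> n) \<le> I + 1" for n
  proof -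
    show "\<psi> n \<in> V" "quartic (\<psi> n) = 1" "energy (\<psi> n) \<le> I + 1" by (simp_all add: \<psi>_def \<phi> \<phi>1)
    have "inverse (real (Suc (k n))) \<le> inverse (real (Suc n))" using seq_suble[OF k, of n] by simp
    then show "energy (\<psi> n) \<le> I + inverse (real (Suc n))" using \<phi>(3)[of "k n"] unfolding \<psi>_def by linarith
  qed
  note g = f[OF \<psi>(1)]
  have C': "energy_Cauchy \<psi>"
    unfolding energy_Cauchy_def
  proof (intro conjI allI impI)
    show "\<psi> n \<in> TF" for n using \<psi> VT by blast
    fix \<epsilon> :: real assume \<epsilon>: "0 < \<epsilon>"
    \<comment> \<open>At t = 0 the value is half of \<epsilon>, because sqrt 16 = 4. The terms 4 I +
      \<epsilon>/2 come from the parallelogram law with both energies within \<epsilon>/8 of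
      \<open>I\<close>.\<close>
    have cont: "((\<lambda>t::real. 4 * I + \<epsilon> / 2 - I * sqrt (16 - 24 * sqrt t - t)) \<longlongrightarrow> 4 * I + \<epsilon> / 2 - I * sqrt (16 - 24 * sqrt 0 - 0)) (at_right 0)"
      by (intro tendsto_intros)
    then have "\<forall>\<^sub>F t in at_right 0. 4 * I + \<epsilon> / 2 - I * sqrt (16 - 24 * sqrt t - t) < \<epsilon>"
      by (rule order_tendstoD(2)) (use \<epsilon> in simp)
    then obtain b where b: "0 < b" "\<And>t. 0 < t \<Longrightarrow> t < b \<Longrightarrow> 4 * I + \<epsilon> / 2 - I * sqrt (16 - 24 * sqrt t - t) < \<epsilon>"
      by (auto simp: eventually_at_right_field)
    define t where "t = b / 2"
    have t: "0 < t" "4 * I + \<epsilon> / 2 - I * sqrt (16 - 24 * sqrt t - t) < \<epsilon>" using b by (auto simp: t_def)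
    \<comment> \<open>A difference has energy at most 4 (I + 1), and the quartic inequality has
      another factor 4; so \<open>K\<close> converts squared L2 distance into quartic
      distance.\<close>
    define K where "K = 16 * (I + 1)"
    have K: "0 < K" using I0 by (simp add: K_def)
    obtain N1 where N1: "\<forall>m\<ge>N1. \<forall>n\<ge>N1. (\<integral>p. (\<psi> m p - \<psi> n p)\<^sup>2 \<partial>lborel) < t / K"
      using kC[of "t / K"] t K unfolding \<psi>_def by (auto simp del: split_paired_All)
    obtain N2 where N2: "inverse (real (Suc N2)) < \<epsilon> / 8" using reals_Archimedean[of "\<epsilon> / 8"] \<epsilon> by auto
    have "energy (\<lambda>x. \<psi> m x - \<psi> n x) < \<epsilon>" if m: "max N1 N2 \<le> m" and n: "max N1 N2 \<le> n" for m n
    proof -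
      define q where "q = quartic (\<lambda>x. \<psi> m x - \<psi> n x)"
      have d: "smooth (\<lambda>x. \<psi> m x - \<psi> n x)" "csupp (\<lambda>x. \<psi> m x - \<psi> n x)"
        using g by (auto intro: smooth_diff csupp_diff)
      have "energy (\<lambda>x. \<psi> m x - \<psi> n x) \<le> 2 * energy (\<psi> m) + 2 * energy (\<psi> n)"
        by (rule energy_diff_le[OF g g])
      also have "\<dots> \<le> 2 * (I + 1) + 2 * (I + 1)" by (intro add_mono mult_left_mono \<psi>(4)) auto
      finally have "energy (\<lambda>x. \<psi> m x - \<psi> n x) \<le> 4 * (I + 1)" by simp
      then have "4 * energy (\<lambda>x. \<psi> m x - \<psi> n x) \<le> K" by (simp add: K_def)
      moreover have "q \<le> 4 * energy (\<lambda>x. \<psi> m x - \<psi> n x) * (\<integral>p. (\<psi> m p - \<psi> n p)\<^sup>2 \<partial>lborel)"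
        unfolding q_def using integral_even_power_le[OF d, of 2] by simp
      moreover have "0 \<le> (\<integral>p. (\<psi> m p - \<psi> n p)\<^sup>2 \<partial>lborel)" by simp
      ultimately have "q \<le> K * (\<integral>p. (\<psi> m p - \<psi> n p)\<^sup>2 \<partial>lborel)"
        by (blast intro: order_trans mult_right_mono)
      also have "\<dots> \<le> K * (t / K)" using N1 m n K by (intro mult_left_mono less_imp_le) auto
      finally have q: "q \<le> t" using K by simp
      have "16 - 24 * sqrt t - t \<le> 16 - 24 * sqrt q - q" using q real_sqrt_le_mono[OF q] by linarith
      also have "\<dots> \<le> quartic (\<lambda>x. \<psi> m x + \<psi> n x)"
        unfolding q_def by (rule quartic_add_ge[OF g g \<psi>(2) \<psi>(2)])
      finally have "I * sqrt (16 - 24 * sqrt t - t) \<le> I * sqrt (quartic (\<lambda>x. \<psi> m x + \<psi> n x))"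
        using I0 by (intro mult_left_mono) auto
      \<comment> \<open>The midpoint, up to scaling, competes for the infimum because
        \<open>V\<close> is closed under sums.\<close>
      also have "\<dots> \<le> energy (\<lambda>x. \<psi> m x + \<psi> n x)" by (intro low V(2) \<psi>(1))
      finally have 1: "I * sqrt (16 - 24 * sqrt t - t) \<le> energy (\<lambda>x. \<psi> m x + \<psi> n x)" .
      have 2: "energy (\<psi> j) < I + \<epsilon> / 8" if "N2 \<le> j" for j
      proof -
        have "inverse (real (Suc j)) \<le> inverse (real (Suc N2))" using that by simp
        then show ?thesis using \<psi>(3)[of j] N2 by linarith
      qed
      show ?thesis using energy_parallelogram[OF g g, of m n] 1 2[of m] 2[of n] m n t(2) by simp
    qed
    then show "\<exists>N. \<forall>m\<ge>N. \<forall>n\<ge>N. energy (\<lambda>x. \<psi> m x - \<psi> n x) < \<epsilon>" by blast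
  qed
  obtain r u where r: "strict_mono (r :: nat \<Rightarrow> nat)" and a: "approximates (\<lambda>n. \<psi> (r n)) u"
    by (rule energy_Cauchy_approximates[OF C'])
  note l = approximates_limits[OF a]
  have 4: "(\<integral>x. (u x) ^ 4 \<partial>L) = 1" using l(3) by (simp add: \<psi>(2) LIMSEQ_const_iff)
  have "(\<lambda>n. energy (\<psi> n)) \<longlonglongrightarrow> I"
  proof (rule tendsto_sandwich[OF always_eventually always_eventually tendsto_const])
    show "\<forall>n. I \<le> energy (\<psi> n)" using low[OF \<psi>(1)] \<psi>(2) by simp
    show "\<forall>n. energy (\<psi> n) \<le> I + inverse (real (Suc n))" using \<psi>(3) by simp
    show "(\<lambda>n. I + inverse (real (Suc n))) \<longlonglongrightarrow> I"
      using tendsto_add[OF tendsto_const LIMSEQ_inverse_real_of_nat, of I] by simp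
  qed
  then have "(\<lambda>n. energy (\<psi> (r n))) \<longlonglongrightarrow> I" using LIMSEQ_subseq_LIMSEQ[OF _ r] by (auto simp: comp_def)
  from LIMSEQ_unique[OF l(4) this] have "sobolev_quotient \<Omega> u = I" by (simp add: sobolev_quotient_eq 4)
  moreover have "\<not> ae_zero \<Omega> u" using approximates_nonzero[OF a] 4 by simp
  ultimately show ?thesis using that[OF low \<psi>(1) a] by blast
qed

end

section \<open>Symmetrization and the minimum over even functions\<close>

lemma partial_deriv_reflect_x_plane:
  assumes "smooth (f :: real \<times> real \<Rightarrow> real)"
  shows "dx (\<lambda>p. f (reflect_x p)) p = - dx f (reflect_x p)" "dy (\<lambda>p. f (reflect_x p)) p = dy f (reflect_x p)"
  unfolding partial_deriv_reflect_x[OF assms] frechet_derivative_plane[OF assms] by (simp_all add: reflect_x_def)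

lemma energy_reflect_x:
  assumes "smooth f"
  shows "energy (\<lambda>p. f (reflect_x p)) = energy f"
proof -
  have "(\<lambda>p. (dx f p)\<^sup>2 + (dy f p)\<^sup>2) \<in> borel_measurable borel"
    using assms by (intro borel_measurable_continuous_onI smooth_continuous_on smooth_intros)
  from integral_reflect_x[OF this] show ?thesis
    by (simp add: energy_def partial_deriv_reflect_x_plane assms)
qed

definition symmetrize :: "(real \<times> real \<Rightarrow> real) \<Rightarrow> real \<times> real \<Rightarrow> real" where
  "symmetrize f p = (f p + f (reflect_x p)) / 2"

text \<open>Convexity of the energy: the parallelogram law for \<open>f\<close> and its reflection,
  which have equal energy.\<close>

lemma energy_symmetrize_le:
  assumes "smooth f" "csupp f"
  shows "energy (symmetrize f) \<le> energy f"
proof -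
  have r: "smooth (\<lambda>p. f (reflect_x p))" "csupp (\<lambda>p. f (reflect_x p))"
    using assms by (auto intro: smooth_reflect_x csupp_reflect_x)
  have "symmetrize f = (\<lambda>p. (1 / 2) * (f p + f (reflect_x p)))"
    by (auto simp: symmetrize_def fun_eq_iff)
  then have "energy (symmetrize f) = (1 / 2)\<^sup>2 * energy (\<lambda>p. f p + f (reflect_x p))"
    using assms r energy_cmult[of "\<lambda>p. f p + f (reflect_x p)" "1 / 2"] by (simp add: smooth_add)
  also have "\<dots> \<le> (1 / 2)\<^sup>2 * (2 * energy f + 2 * energy (\<lambda>p. f (reflect_x p)))"
    using energy_parallelogram[OF assms r] energy_nonneg[of "\<lambda>p. f p - f (reflect_x p)"]
    by (intro mult_left_mono) (linarith, simp)
  finally show ?thesis by (simp add: energy_reflect_x[OF assms(1)] power2_eq_square)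
qed

context plane_domain
begin

text \<open>The inequality on test functions is kept in the conclusion so that a single explicit
  test function can later bound \<open>I\<close> from above.\<close>

lemma sobolev_attained:
  assumes "\<phi>\<^sub>0 \<in> TF" "\<phi>\<^sub>0 p \<noteq> 0"
  obtains I u where "\<And>\<psi>. \<psi> \<in> TF \<Longrightarrow> I * sqrt (quartic \<psi>) \<le> energy \<psi>" "u \<in> H1_0 \<Omega>" "\<not> ae_zero \<Omega> u"
    "sobolev_quotient \<Omega> u = I" "\<And>v. v \<in> H1_0 \<Omega> \<Longrightarrow> \<not> ae_zero \<Omega> v \<Longrightarrow> I \<le> sobolev_quotient \<Omega> v"
proof -
  obtain I \<phi> u where I: "\<And>\<psi>. \<psi> \<in> TF \<Longrightarrow> I * sqrt (quartic \<psi>) \<le> energy \<psi>"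
    and \<phi>: "\<And>n. \<phi> n \<in> TF" and a: "approximates \<phi> u" and u: "\<not> ae_zero \<Omega> u" "sobolev_quotient \<Omega> u = I"
    by (rule minimizer_exists[of TF, OF _ test_functions_add test_functions_cmult assms]) (simp, assumption+, rule that)
  have "I \<le> sobolev_quotient \<Omega> v" if v: "v \<in> H1_0 \<Omega>" "\<not> ae_zero \<Omega> v" for v
  proof -
    obtain \<psi> where \<psi>: "approximates \<psi> v" by (rule H1_0_approximates[OF v(1)])
    then have "\<psi> n \<in> TF" for n by (simp add: approximates_def energy_Cauchy_def)
    with v \<psi> I show ?thesis by (intro approximates_quotient_ge) auto
  qed
  with I u approximates_limits(1)[OF a] show ?thesis by (intro that) auto
qed

end

locale symmetric_plane_domain = plane_domain +
  assumes symmetric_dom: "p \<in> \<Omega> \<Longrightarrow> reflect_x p \<in> \<Omega>"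
begin

lemma TF_reflect_x:
  assumes "\<phi> \<in> TF"
  shows "(\<lambda>p. \<phi> (reflect_x p)) \<in> TF"
proof -
  obtain K where K: "smooth \<phi>" "compact K" "K \<subseteq> \<Omega>" "\<And>x. x \<notin> K \<Longrightarrow> \<phi> x = 0"
    using assms by (rule test_functionsE) blast
  show ?thesis
  proof (rule test_functionsI)
    show "compact (reflect_x ` K)"
      using K(2) by (intro compact_continuous_image linear_continuous_on) (simp_all add: linear_linear linear_reflect_x)
    show "reflect_x ` K \<subseteq> \<Omega>" using K(3) symmetric_dom by blast
    show "\<phi> (reflect_x x) = 0" if "x \<notin> reflect_x ` K" for x
      using that K(4) by (metis imageI reflect_x_reflect_x)
  qed (intro smooth_reflect_x K)
qed

lemma symmetrize_TF:
  assumes "\<phi> \<in> TF"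
  shows "symmetrize \<phi> \<in> TF"
  using test_functions_cmult[OF test_functions_add[OF assms TF_reflect_x[OF assms]], of "1 / 2"]
  by (simp add: symmetrize_def[abs_def])

text \<open>The reflection preserves Lebesgue measure, hence null sets, and maps the domain into
  itself.\<close>

lemma AE_reflect_x:
  assumes "AE x in L. P x"
  shows "AE x in L. P (reflect_x x)"
proof -
  have m: "\<Omega> \<inter> space lebesgue \<in> sets lebesgue" using open_dom by auto
  have "AE x in lborel. x \<in> \<Omega> \<longrightarrow> P x"
    using assms unfolding AE_restrict_space_iff[OF m] by (simp add: AE_completion_iff)
  then have "AE x in distr lborel borel reflect_x. x \<in> \<Omega> \<longrightarrow> P x" unfolding distr_reflect_x .
  then have "AE x in lborel. reflect_x x \<in> \<Omega> \<longrightarrow> P (reflect_x x)"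
    by (rule AE_distrD[rotated]) simp
  then show ?thesis
    unfolding AE_restrict_space_iff[OF m] AE_completion_iff
    by eventually_elim (use symmetric_dom in auto)
qed

lemma even_x_iff: "even_x \<Omega> u \<longleftrightarrow> (AE x in L. u x = u (reflect_x x))"
  by (simp add: even_x_def reflect_x_def)

text \<open>Evenness of \<open>u\<close> holds only almost everywhere, which suffices for the
  symmetrized sequence to have the same limit. Even members of \<open>H1_0\<close> are thus limits
  of test functions that are even at every point.\<close>

lemma approximates_symmetrize:
  assumes a: "approximates \<phi> u" and ev: "even_x \<Omega> u"
  shows "approximates (\<lambda>n. symmetrize (\<phi> n)) u"
proof -
  have C: "energy_Cauchy \<phi>" and u: "u \<in> borel_measurable L" and lim: "AE x in L. (\<lambda>n. \<phi> n x) \<longlonglongrightarrow> u x"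
    using a by (auto simp: approximates_def)
  note t = energy_CauchyD(1)[OF C]
  have "energy_Cauchy (\<lambda>n. symmetrize (\<phi> n))"
    unfolding energy_Cauchy_def
  proof (intro conjI allI impI)
    show "symmetrize (\<phi> n) \<in> TF" for n using t by (rule symmetrize_TF)
    fix \<epsilon> :: real assume "0 < \<epsilon>"
    then obtain N where N: "\<forall>m\<ge>N. \<forall>n\<ge>N. energy (\<lambda>x. \<phi> m x - \<phi> n x) < \<epsilon>" using energy_CauchyD(2)[OF C] by blast
    have "energy (\<lambda>x. symmetrize (\<phi> m) x - symmetrize (\<phi> n) x) \<le> energy (\<lambda>x. \<phi> m x - \<phi> n x)" for m n
    proof -
      have d: "(\<lambda>x. \<phi> m x - \<phi> n x) \<in> TF" by (intro test_functions_diff t)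
      have "(\<lambda>x. symmetrize (\<phi> m) x - symmetrize (\<phi> n) x) = symmetrize (\<lambda>x. \<phi> m x - \<phi> n x)"
        by (auto simp: symmetrize_def fun_eq_iff field_simps)
      with energy_symmetrize_le[OF TF_facts(1,2)[OF d]] show ?thesis by simp
    qed
    with N show "\<exists>N. \<forall>m\<ge>N. \<forall>n\<ge>N. energy (\<lambda>x. symmetrize (\<phi> m) x - symmetrize (\<phi> n) x) < \<epsilon>"
      by (meson le_less_trans)
  qed
  moreover have "AE x in L. (\<lambda>n. symmetrize (\<phi> n) x) \<longlonglongrightarrow> u x"
    using lim AE_reflect_x[OF lim] ev[unfolded even_x_iff]
  proof eventually_elim
    fix x assume "(\<lambda>n. \<phi> n x) \<longlonglongrightarrow> u x" "(\<lambda>n. \<phi> n (reflect_x x)) \<longlonglongrightarrow> u (reflect_x x)" "u x = u (reflect_x x)"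
    from tendsto_divide[OF tendsto_add[OF this(1,2)] tendsto_const[of 2]] this(3)
    show "(\<lambda>n. symmetrize (\<phi> n) x) \<longlonglongrightarrow> u x" by (simp add: symmetrize_def)
  qed
  ultimately show ?thesis using u by (simp add: approximates_def)
qed

text \<open>The minimizing sequence is taken in the even test functions, and its almost everywhere
  limit inherits evenness. The bound \<open>c\<close>, assumed on even test functions only, passes
  to the minimum.\<close>

lemma even_sobolev_attained:
  assumes "\<phi>\<^sub>0 \<in> TF" "\<phi>\<^sub>0 p \<noteq> 0" "\<And>p. \<phi>\<^sub>0 (reflect_x p) = \<phi>\<^sub>0 p"
    and c: "\<And>\<psi>. \<psi> \<in> TF \<Longrightarrow> (\<And>p. \<psi> (reflect_x p) = \<psi> p) \<Longrightarrow> 0 < quartic \<psi> \<Longrightarrow> c * sqrt (quartic \<psi>) \<le> energy \<psi>"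
  obtains I u where "c \<le> I" "u \<in> H1_0 \<Omega>" "even_x \<Omega> u" "\<not> ae_zero \<Omega> u"
    "sobolev_quotient \<Omega> u = I" "\<And>v. v \<in> H1_0 \<Omega> \<Longrightarrow> even_x \<Omega> v \<Longrightarrow> \<not> ae_zero \<Omega> v \<Longrightarrow> I \<le> sobolev_quotient \<Omega> v"
proof -
  define V where "V = {\<phi> \<in> TF. \<forall>p. \<phi> (reflect_x p) = \<phi> p}"
  obtain I \<phi> u where I: "\<And>\<psi>. \<psi> \<in> V \<Longrightarrow> I * sqrt (quartic \<psi>) \<le> energy \<psi>"
    and \<phi>: "\<And>n. \<phi> n \<in> V" and a: "approximates \<phi> u" and u: "\<not> ae_zero \<Omega> u" "sobolev_quotient \<Omega> u = I"
  proof (rule minimizer_exists[of V \<phi>\<^sub>0 p])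
    show "V \<subseteq> TF" by (auto simp: V_def)
    show "\<phi> \<in> V \<Longrightarrow> \<psi> \<in> V \<Longrightarrow> (\<lambda>x. \<phi> x + \<psi> x) \<in> V" "\<phi> \<in> V \<Longrightarrow> (\<lambda>x. c * \<phi> x) \<in> V" for \<phi> \<psi> c
      by (simp_all add: V_def test_functions_add test_functions_cmult)
    show "\<phi>\<^sub>0 \<in> V" using assms by (simp add: V_def)
  qed (rule assms(2), rule that)
  have u': "u \<in> H1_0 \<Omega>" using approximates_limits(1)[OF a] .
  have lim: "AE x in L. (\<lambda>n. \<phi> n x) \<longlonglongrightarrow> u x" using a by (simp add: approximates_def)
  have ev: "even_x \<Omega> u"
    unfolding even_x_iff using lim AE_reflect_x[OF lim]
  proof eventually_elim
    fix x assume "(\<lambda>n. \<phi> n x) \<longlonglongrightarrow> u x" "(\<lambda>n. \<phi> n (reflect_x x)) \<longlonglongrightarrow> u (reflect_x x)"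
    moreover have "\<phi> n (reflect_x x) = \<phi> n x" for n using \<phi>[of n] by (simp add: V_def del: split_paired_All)
    ultimately show "u x = u (reflect_x x)" by (simp add: LIMSEQ_unique)
  qed
  have low: "I \<le> sobolev_quotient \<Omega> v" if v: "v \<in> H1_0 \<Omega>" "even_x \<Omega> v" "\<not> ae_zero \<Omega> v" for v
  proof -
    obtain \<psi> where \<psi>: "approximates \<psi> v" by (rule H1_0_approximates[OF v(1)])
    then have "\<psi> n \<in> TF" for n by (simp add: approximates_def energy_Cauchy_def)
    then have "symmetrize (\<psi> n) \<in> V" for n by (auto simp: V_def symmetrize_TF symmetrize_def)
    with approximates_symmetrize[OF \<psi> v(2)] v(3) I show ?thesis by (intro approximates_quotient_ge) auto
  qed
  have "c \<le> sobolev_quotient \<Omega> u"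
  proof (rule approximates_quotient_ge[OF a u(1)])
    fix n
    show "c * sqrt (quartic (\<phi> n)) \<le> energy (\<phi> n)"
    proof (cases "quartic (\<phi> n) = 0")
      case False
      then have "0 < quartic (\<phi> n)" using quartic_nonneg[of "\<phi> n"] by linarith
      then show ?thesis using \<phi>[of n] by (intro c) (simp_all add: V_def del: split_paired_All)
    qed simp
  qed
  with u u' ev low show ?thesis by (intro that[of I u]) auto
qed

end

section \<open>The gap for even functions\<close>

definition strip :: "real \<Rightarrow> (real \<times> real) set" where
  "strip h = UNIV \<times> {-h<..<h}"

lemma strip_outside:
  assumes "u \<in> test_functions (strip h)" "h \<le> \<bar>snd p\<bar>"
  shows "u p = 0"
  using test_functions_outside(1)[OF assms(1), of p] assms(2) by (cases p) (auto simp: strip_def abs_if split: if_splits)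

text \<open>The case k = 2 of \<open>integral_even_power_le\<close> together with Poincare's
  inequality; it makes the Sobolev constant of the strip positive.\<close>

lemma strip_quartic_le:
  assumes u: "u \<in> test_functions (strip h)"
  shows "quartic u \<le> (4 * h * energy u)\<^sup>2"
proof -
  note s = test_functions_smooth[OF u] test_functions_csupp[OF u]
  have "quartic u \<le> 4 * energy u * (\<integral>p. (u p)\<^sup>2 \<partial>lborel)"
    using integral_even_power_le[OF s, of 2] by simp
  also have "\<dots> \<le> 4 * energy u * (4 * h\<^sup>2 * energy u)"
    using strip_outside[OF u] by (intro mult_left_mono Poincare_strip[OF s]) auto
  finally show ?thesis by (simp add: power2_eq_square mult_ac)
qed

text \<open>On the unbounded strip minimizing sequences lack the common bounded support that
  Rellich's theorem requires, so the constant is recorded as an infimum with almost optimal test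
  functions.\<close>

lemma strip_constant:
  assumes h: "0 < h"
  obtains S where "0 < S" "\<And>\<phi>. \<phi> \<in> test_functions (strip h) \<Longrightarrow> S * sqrt (quartic \<phi>) \<le> energy \<phi>"
    "\<And>\<eta>. 0 < \<eta> \<Longrightarrow> \<exists>\<phi>\<in>test_functions (strip h). 0 < quartic \<phi> \<and> energy \<phi> < (S + \<eta>) * sqrt (quartic \<phi>)"
proof -
  define Q where "Q = {energy \<phi> / sqrt (quartic \<phi>) | \<phi>. \<phi> \<in> test_functions (strip h) \<and> 0 < quartic \<phi>}"
  have low: "1 / (4 * h) \<le> q" if q: "q \<in> Q" for q
  proof -
    obtain \<phi> where \<phi>: "\<phi> \<in> test_functions (strip h)" "0 < quartic \<phi>" "q = energy \<phi> / sqrt (quartic \<phi>)"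
      using q unfolding Q_def by blast
    have "sqrt (quartic \<phi>) \<le> 4 * h * energy \<phi>"
      using strip_quartic_le[OF \<phi>(1)] h by (intro real_le_lsqrt) auto
    then have "1 / (4 * h) * sqrt (quartic \<phi>) \<le> energy \<phi>" using h by (simp add: field_simps)
    then show ?thesis unfolding \<phi>(3) using \<phi>(2) by (subst pos_le_divide_eq) auto
  qed
  then have bd: "bdd_below Q" by (rule bdd_belowI)
  have ne: "Q \<noteq> {}"
  proof -
    have "cball (0::real\<times>real) (h / 2) \<subseteq> strip h"
    proof
      fix p :: "real \<times> real" assume "p \<in> cball 0 (h / 2)"
      then have "\<bar>snd p\<bar> \<le> h / 2" using norm_snd_le[of "snd p" "fst p"] by simp
      then show "p \<in> strip h" using h by (cases p) (auto simp: strip_def)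
    qed
    then have b: "bump 0 (h / 2) \<in> test_functions (strip h)" using h by (intro bump_test_function) auto
    have "bump 0 (h / 2) 0 \<noteq> 0" using bump_pos_iff[of "h / 2" 0 0] h by simp
    with b have "0 < quartic (bump 0 (h / 2))"
      by (intro quartic_pos test_functions_smooth test_functions_csupp)
    with b show ?thesis by (auto simp: Q_def)
  qed
  show ?thesis
  proof (rule that[of "Inf Q"])
    have "1 / (4 * h) \<le> Inf Q" using ne low by (intro cInf_greatest)
    then show "0 < Inf Q" using h by (smt (verit) divide_pos_pos)
    show "Inf Q * sqrt (quartic \<phi>) \<le> energy \<phi>" if "\<phi> \<in> test_functions (strip h)" for \<phi>
    proof (cases "quartic \<phi> = 0")
      case False
      then have q: "0 < quartic \<phi>" using quartic_nonneg[of \<phi>] by linarith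
      then have "Inf Q \<le> energy \<phi> / sqrt (quartic \<phi>)" using that by (intro cInf_lower bd) (auto simp: Q_def)
      then show ?thesis using q by (simp add: field_simps)
    qed simp
    show "\<exists>\<phi>\<in>test_functions (strip h). 0 < quartic \<phi> \<and> energy \<phi> < (Inf Q + \<eta>) * sqrt (quartic \<phi>)" if "0 < \<eta>" for \<eta>
    proof -
      have "Inf Q < Inf Q + \<eta>" using that by simp
      from cInf_lessD[OF ne this] obtain \<phi> where \<phi>: "\<phi> \<in> test_functions (strip h)" "0 < quartic \<phi>"
        "energy \<phi> / sqrt (quartic \<phi>) < Inf Q + \<eta>" unfolding Q_def by blast
      then show ?thesis by (intro bexI[of _ \<phi>]) (simp_all add: field_simps)
    qed
  qed
qed

text \<open>The localization formula for two cutoffs whose squares sum to 1: turning (u, 0) by the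
  angle \<theta> at each point leaves the total squared gradient unchanged except for the term with
  the gradient of \<theta>, as the mixed terms cancel.\<close>

lemma energy_rotate:
  assumes u: "smooth u" "csupp u" and \<theta>: "smooth \<theta>"
  shows "energy (\<lambda>p. cos (\<theta> p) * u p) + energy (\<lambda>p. sin (\<theta> p) * u p)
    = energy u + (\<integral>p. ((dx \<theta> p)\<^sup>2 + (dy \<theta> p)\<^sup>2) * (u p)\<^sup>2 \<partial>lborel)"
proof -
  define f g where "f p = cos (\<theta> p) * u p" and "g p = sin (\<theta> p) * u p" for p
  have sc: "smooth (\<lambda>p. cos (\<theta> p))" "smooth (\<lambda>p. sin (\<theta> p))"
    by (rule smooth_compose[OF smooth_cos \<theta>] smooth_compose[OF smooth_sin \<theta>])+
  have f: "smooth f" "csupp f" and g: "smooth g" "csupp g"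
    unfolding f_def[abs_def] g_def[abs_def] using u sc by (auto intro: smooth_mult csupp_mult_right)
  have p: "partial_deriv i f p = cos (\<theta> p) * partial_deriv i u p - sin (\<theta> p) * partial_deriv i \<theta> p * u p"
    "partial_deriv i g p = sin (\<theta> p) * partial_deriv i u p + cos (\<theta> p) * partial_deriv i \<theta> p * u p" for i p
    unfolding f_def[abs_def] g_def[abs_def]
    using partial_deriv_compose[OF DERIV_cos \<theta>] partial_deriv_compose[OF DERIV_sin \<theta>]
    by (simp_all add: partial_deriv_mult sc u(1))
  have rot: "(c * a - s * t)\<^sup>2 + (s * a + c * t)\<^sup>2 = a\<^sup>2 + t\<^sup>2" if "c\<^sup>2 + s\<^sup>2 = 1" for a c s t :: real
  proof -
    have "(c * a - s * t)\<^sup>2 + (s * a + c * t)\<^sup>2 = (c\<^sup>2 + s\<^sup>2) * (a\<^sup>2 + t\<^sup>2)" by (simp add: power2_eq_square algebra_simps)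
    then show ?thesis using that by simp
  qed
  have "(partial_deriv i f p)\<^sup>2 + (partial_deriv i g p)\<^sup>2 = (partial_deriv i u p)\<^sup>2 + (partial_deriv i \<theta> p)\<^sup>2 * (u p)\<^sup>2" for i p
    unfolding p using rot[of "cos (\<theta> p)" "sin (\<theta> p)" "partial_deriv i u p" "partial_deriv i \<theta> p * u p"]
    by (simp add: mult_ac power_mult_distrib)
  note pt = this
  have "energy f + energy g = (\<integral>p. ((dx f p)\<^sup>2 + (dy f p)\<^sup>2) + ((dx g p)\<^sup>2 + (dy g p)\<^sup>2) \<partial>lborel)"
    unfolding energy_def by (intro Bochner_Integration.integral_add[symmetric] integrable_grad_sq f g)
  also have "\<dots> = (\<integral>p. ((dx u p)\<^sup>2 + (dy u p)\<^sup>2) + ((dx \<theta> p)\<^sup>2 + (dy \<theta> p)\<^sup>2) * (u p)\<^sup>2 \<partial>lborel)"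
    using pt[of "(1, 0)"] pt[of "(0, 1)"] by (intro Bochner_Integration.integral_cong refl) (simp add: algebra_simps)
  also have "\<dots> = energy u + (\<integral>p. ((dx \<theta> p)\<^sup>2 + (dy \<theta> p)\<^sup>2) * (u p)\<^sup>2 \<partial>lborel)"
    unfolding energy_def using u \<theta>
    by (intro Bochner_Integration.integral_add integrable_grad_sq integrable_csupp_smooth smooth_intros csupp_mult_right csupp_power) auto
  finally show ?thesis unfolding f_def[abs_def] g_def[abs_def] .
qed

text \<open>An even function of almost minimal quotient is not spread out far in \<open>x\<close>: otherwise splitting it into
  the left part \<open>cos \<theta> u\<close> and the right part \<open>sin \<theta> u\<close>, which have the same \<open>L\<^sup>4\<close> norm, would be favourable.\<close>

lemma even_concentration:
  assumes h: "0 < h" and S: "0 < S" "\<And>\<phi>. \<phi> \<in> test_functions (strip h) \<Longrightarrow> S * sqrt (quartic \<phi>) \<le> energy \<phi>"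
    and u: "u \<in> test_functions (strip h)" "\<And>p. u (reflect_x p) = u p" "quartic u = 1" "energy u \<le> 21 / 20 * S"
  shows "1 / 2 \<le> (\<integral>p. indicator {p. \<bar>fst p\<bar> < 5 * h} p * (u p) ^ 4 \<partial>lborel)"
proof -
  \<comment> \<open>With this width the splitting costs 1/25 of the energy: the squared gradient of
    \<theta> is at most 1/(4 L^2), and Poincare's constant is 4 h^2.\<close>
  define L where "L = 5 * h"
  have L: "0 < L" using h by (simp add: L_def)
  note s = test_functions_smooth[OF u(1)] test_functions_csupp[OF u(1)]
  \<comment> \<open>The angle runs from 0 to pi/2 and satisfies \<theta>(-x) = pi/2 - \<theta>(x),
    so reflection exchanges its cosine and sine. With \<open>arctan\<close>, the square of sin(2
    \<theta>) is the rational function L^2/(L^2 + x^2).\<close>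
  define \<theta> where "\<theta> p = pi / 4 + arctan (fst p / L) / 2" for p :: "real \<times> real"
  have \<theta>: "smooth \<theta>"
    unfolding \<theta>_def[abs_def] by (intro smooth_intros smooth_compose[OF smooth_arctan])
  have d\<theta>: "(dx \<theta> p)\<^sup>2 + (dy \<theta> p)\<^sup>2 \<le> 1 / (4 * L\<^sup>2)" for p
  proof -
    have a: "partial_deriv i \<theta> p = 1 / (1 + (fst p / L)\<^sup>2) / (2 * L) * fst i" for i
    proof -
      have "((\<lambda>x. pi / 4 + arctan (x / L) / 2) has_real_derivative 1 / (1 + (fst p / L)\<^sup>2) / (2 * L)) (at (fst p))"
        using L by (auto intro!: derivative_eq_intros) (simp add: inverse_eq_divide)
      then have "partial_deriv i \<theta> p = (1 / (1 + (fst p / L)\<^sup>2) / (2 * L)) * partial_deriv i fst p"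
        unfolding \<theta>_def[abs_def] by (rule partial_deriv_compose[OF _ smooth_fst])
      then show ?thesis by simp
    qed
    have "1 / (1 + (fst p / L)\<^sup>2) / (2 * L) \<le> 1 / (2 * L)"
      using L by (intro divide_right_mono) (auto simp: divide_le_eq_1 add_pos_nonneg)
    then have "(1 / (1 + (fst p / L)\<^sup>2) / (2 * L))\<^sup>2 \<le> (1 / (2 * L))\<^sup>2"
      using L by (intro power_mono) (auto intro!: divide_nonneg_nonneg add_nonneg_nonneg)
    then show ?thesis unfolding a using L by (simp add: power_divide power_mult_distrib)
  qed
  define f g where "f p = cos (\<theta> p) * u p" and "g p = sin (\<theta> p) * u p" for p
  have sc: "smooth (\<lambda>p. cos (\<theta> p))" "smooth (\<lambda>p. sin (\<theta> p))"
    by (rule smooth_compose[OF smooth_cos \<theta>] smooth_compose[OF smooth_sin \<theta>])+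
  have f: "f \<in> test_functions (strip h)" and g: "g \<in> test_functions (strip h)"
    unfolding f_def[abs_def] g_def[abs_def] using u(1) sc by (auto intro: test_functions_mult)
  have "(\<integral>p. ((dx \<theta> p)\<^sup>2 + (dy \<theta> p)\<^sup>2) * (u p)\<^sup>2 \<partial>lborel) \<le> (\<integral>p. 1 / (4 * L\<^sup>2) * (u p)\<^sup>2 \<partial>lborel)"
    using s \<theta> d\<theta> by (intro integral_mono mult_right_mono integrable_mult_right integrable_csupp_smooth smooth_intros csupp_mult_right csupp_power) auto
  also have "\<dots> = 1 / (4 * L\<^sup>2) * (\<integral>p. (u p)\<^sup>2 \<partial>lborel)" by simp
  also have "\<dots> \<le> 1 / (4 * L\<^sup>2) * (4 * h\<^sup>2 * energy u)"
    using strip_outside[OF u(1)] by (intro mult_left_mono Poincare_strip s) auto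
  also have "\<dots> = energy u / 25" using h by (simp add: L_def power2_eq_square)
  finally have E: "energy f + energy g \<le> 26 / 25 * energy u"
    using energy_rotate[OF s \<theta>] unfolding f_def[abs_def] g_def[abs_def] by simp
  have "f (reflect_x p) = g p" for p
    unfolding f_def g_def u(2) by (simp add: \<theta>_def reflect_x_def cos_sin_eq) (simp add: arctan_minus field_simps)
  then have "quartic g = (\<integral>p. f (reflect_x p) ^ 4 \<partial>lborel)" by simp
  also have "\<dots> = quartic f"
    using test_functions_smooth[OF f]
    by (intro integral_reflect_x[where f = "\<lambda>p. f p ^ 4"] borel_measurable_continuous_onI smooth_continuous_on smooth_power)
  finally have gf: "quartic g = quartic f" .
  have i4: "integrable lborel (\<lambda>p. v p ^ 4)" if "v \<in> test_functions (strip h)" for v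
    using test_functions_smooth[OF that] test_functions_csupp[OF that]
    by (intro integrable_csupp_smooth smooth_power csupp_power) auto
  \<comment> \<open>Quartic integral lost by the splitting, up to a factor 2: cos^4 + sin^4 is 1
    minus half the square of sin(2 \<theta>).\<close>
  define w where "w p = (sin (2 * \<theta> p))\<^sup>2 * (u p) ^ 4" for p
  have wi: "integrable lborel w"
    unfolding w_def[abs_def] using s \<theta>
    by (intro integrable_csupp_smooth smooth_mult smooth_power smooth_compose[OF smooth_sin] smooth_intros csupp_mult_right csupp_power) auto
  have pt: "f p ^ 4 + g p ^ 4 = u p ^ 4 - w p / 2" for p
  proof -
    have c: "(cos (\<theta> p))\<^sup>2 = 1 - (sin (\<theta> p))\<^sup>2" using sin_cos_squared_add[of "\<theta> p"] by linarith
    have "f p ^ 4 + g p ^ 4 = (((cos (\<theta> p))\<^sup>2)\<^sup>2 + ((sin (\<theta> p))\<^sup>2)\<^sup>2) * u p ^ 4"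
      by (simp add: f_def g_def power_mult_distrib power_mult[symmetric] distrib_right)
    also have "((cos (\<theta> p))\<^sup>2)\<^sup>2 + ((sin (\<theta> p))\<^sup>2)\<^sup>2 = 1 - (2 * sin (\<theta> p) * cos (\<theta> p))\<^sup>2 / 2"
      unfolding power_mult_distrib c by (simp add: power2_eq_square field_simps)
    also have "2 * sin (\<theta> p) * cos (\<theta> p) = sin (2 * \<theta> p)" by (simp add: sin_double)
    finally show ?thesis by (simp add: w_def algebra_simps)
  qed
  have "quartic f + quartic g = (\<integral>p. u p ^ 4 - w p / 2 \<partial>lborel)"
    using i4[OF f] i4[OF g] by (simp add: pt[symmetric])
  also have "\<dots> = 1 - (\<integral>p. w p \<partial>lborel) / 2"
    using i4[OF u(1)] wi u(3) by simp
  finally have q: "quartic f = (1 - (\<integral>p. w p \<partial>lborel) / 2) / 2" using gf by simp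
  define J where "J = (\<integral>p. w p \<partial>lborel)"
  \<comment> \<open>Both halves obey the Sobolev inequality with equal quartic integrals. As (26/25
    * 21/20)^2 = 1.092^2 < 5/4, the quartic of each half is at most 5/16, that is J \<ge>
    3/4.\<close>
  have "2 * S * sqrt (quartic f) \<le> energy f + energy g" using S(2)[OF f] S(2)[OF g] gf by simp
  also have "\<dots> \<le> 26 / 25 * (21 / 20 * S)" using E u(4) by linarith
  finally have "S * (2 * sqrt (quartic f)) \<le> S * (26 / 25 * (21 / 20))" by simp
  then have "2 * sqrt (quartic f) \<le> 26 / 25 * (21 / 20)" using S(1) by (rule mult_left_le_imp_le)
  then have "(2 * sqrt (quartic f))\<^sup>2 \<le> (26 / 25 * (21 / 20))\<^sup>2" by (intro power_mono) auto
  then have "4 * quartic f \<le> 5 / 4" by (simp add: power_mult_distrib power2_eq_square)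
  then have J: "3 / 4 \<le> J" using q by (simp add: J_def)
  have sw: "(sin (2 * \<theta> p))\<^sup>2 = L\<^sup>2 / (L\<^sup>2 + (fst p)\<^sup>2)" for p
  proof -
    have "2 * \<theta> p = pi / 2 + arctan (fst p / L)" by (simp add: \<theta>_def)
    then have "sin (2 * \<theta> p) = cos (arctan (fst p / L))" by (simp add: sin_add)
    then have "(sin (2 * \<theta> p))\<^sup>2 = 1 / (1 + (fst p / L)\<^sup>2)"
      by (simp add: cos_arctan power_divide add_nonneg_nonneg)
    also have "\<dots> = L\<^sup>2 / (L\<^sup>2 + (fst p)\<^sup>2)" using L by (simp add: field_simps power_divide)
    finally show ?thesis .
  qed
  have m: "{p::real\<times>real. \<bar>fst p\<bar> < L} \<in> sets lborel"
    by (auto intro!: borel_open open_Collect_less continuous_intros)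
  have ii: "integrable lborel (\<lambda>p. indicator {p. \<bar>fst p\<bar> < L} p * (u p) ^ 4)"
    using integrable_mult_indicator[OF m i4[OF u(1)]] by simp
  have "J \<le> (\<integral>p. (1 / 2) * (u p) ^ 4 + (1 / 2) * (indicator {p. \<bar>fst p\<bar> < L} p * (u p) ^ 4) \<partial>lborel)"
    unfolding J_def
  proof (intro integral_mono wi Bochner_Integration.integrable_add integrable_mult_right i4 u ii)
    fix p :: "real \<times> real"
    \<comment> \<open>The weight is at most 1 everywhere and at most 1/2 where \<bar>x\<bar> \<ge>
      L, so J \<ge> 3/4 leaves at least 1/2 for the part in \<bar>x\<bar> < L.\<close>
    have "L\<^sup>2 / (L\<^sup>2 + (fst p)\<^sup>2) \<le> 1 / 2 + 1 / 2 * indicator {p. \<bar>fst p\<bar> < L} p"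
    proof (cases "\<bar>fst p\<bar> < L")
      case True then show ?thesis using L by (simp add: divide_le_eq_1 add_pos_nonneg)
    next
      case False
      then have "L\<^sup>2 \<le> (fst p)\<^sup>2" using L abs_le_square_iff[of L "fst p"] by simp
      then show ?thesis using False L by (simp add: field_simps add_pos_nonneg)
    qed
    from mult_right_mono[OF this, of "u p ^ 4"]
    show "w p \<le> 1 / 2 * u p ^ 4 + 1 / 2 * (indicator {p. \<bar>fst p\<bar> < L} p * u p ^ 4)"
      unfolding w_def sw by (simp add: algebra_simps)
  qed
  also have "\<dots> = 1 / 2 + 1 / 2 * (\<integral>p. indicator {p. \<bar>fst p\<bar> < L} p * (u p) ^ 4 \<partial>lborel)"
    using i4[OF u(1)] ii u(3) by (subst Bochner_Integration.integral_add) auto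
  finally show ?thesis using J by (simp add: L_def)
qed

section \<open>The barrier and its laplacian\<close>

definition laplacian :: "(real \<times> real \<Rightarrow> real) \<Rightarrow> real \<times> real \<Rightarrow> real" where
  "laplacian f p = dx (dx f) p + dy (dy f) p"

lemma smooth_laplacian [smooth_intros]: "smooth f \<Longrightarrow> smooth (laplacian f)"
  unfolding laplacian_def[abs_def] by (intro smooth_intros)

text \<open>Integration by parts puts both derivatives of the mixed term on \<open>v\<close>, so the
  first variation becomes an integral of \<open>u\<close> against the laplacian of the
  perturbation.\<close>

lemma energy_perturb:
  assumes u: "smooth u" "csupp u" and v: "smooth v" "csupp v"
  shows "energy (\<lambda>p. u p + t * v p) = energy u - 2 * t * (\<integral>p. u p * laplacian v p \<partial>lborel) + t\<^sup>2 * energy v"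
proof -
  note i = integrable_csupp_smooth smooth_intros csupp_mult_left csupp_power csupp_partial_deriv
  have B: "(1, 0) \<in> (Basis :: (real \<times> real) set)" "(0, 1) \<in> (Basis :: (real \<times> real) set)" by (simp_all add: Basis_plane)
  have ibp: "(\<integral>p. partial_deriv i u p * partial_deriv i v p \<partial>lborel) = - (\<integral>p. u p * partial_deriv i (partial_deriv i v) p \<partial>lborel)"
    if "i \<in> Basis" for i
    using integration_by_parts[of u "partial_deriv i v" i] u v that by (simp add: smooth_partial_deriv)
  have "energy (\<lambda>p. u p + t * v p) = (\<integral>p. ((dx u p)\<^sup>2 + (dy u p)\<^sup>2) + (2 * t * (dx u p * dx v p + dy u p * dy v p) + t\<^sup>2 * ((dx v p)\<^sup>2 + (dy v p)\<^sup>2)) \<partial>lborel)"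
    unfolding energy_def using u v
    by (intro Bochner_Integration.integral_cong refl)
      (simp add: partial_deriv_add partial_deriv_cmult smooth_mult smooth_const power2_eq_square algebra_simps)
  also have "\<dots> = energy u + ((\<integral>p. 2 * t * (dx u p * dx v p + dy u p * dy v p) \<partial>lborel) + (\<integral>p. t\<^sup>2 * ((dx v p)\<^sup>2 + (dy v p)\<^sup>2) \<partial>lborel))"
  proof -
    have a: "integrable lborel (\<lambda>p. (dx u p)\<^sup>2 + (dy u p)\<^sup>2)" "integrable lborel (\<lambda>p. t\<^sup>2 * ((dx v p)\<^sup>2 + (dy v p)\<^sup>2))"
      by (intro integrable_mult_right integrable_grad_sq u v)+
    have b: "integrable lborel (\<lambda>p. 2 * t * (dx u p * dx v p + dy u p * dy v p))"
      using u v by (intro integrable_mult_right Bochner_Integration.integrable_add i) 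
    show ?thesis unfolding energy_def
      by (subst Bochner_Integration.integral_add[OF a(1) Bochner_Integration.integrable_add[OF b a(2)]],
          subst Bochner_Integration.integral_add[OF b a(2)]) simp
  qed
  also have "(\<integral>p. 2 * t * (dx u p * dx v p + dy u p * dy v p) \<partial>lborel) = 2 * t * ((\<integral>p. dx u p * dx v p \<partial>lborel) + (\<integral>p. dy u p * dy v p \<partial>lborel))"
    unfolding integral_mult_right_zero using u v by (subst Bochner_Integration.integral_add) (auto intro!: i)
  also have "(\<integral>p. dx u p * dx v p \<partial>lborel) + (\<integral>p. dy u p * dy v p \<partial>lborel) = - (\<integral>p. u p * laplacian v p \<partial>lborel)"
    unfolding ibp[OF B(1)] ibp[OF B(2)] laplacian_def distrib_left using u v
    by (subst Bochner_Integration.integral_add) (auto intro!: i)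
  finally show ?thesis by (simp add: energy_def)
qed

lemma partial_deriv_divide_const:
  assumes "smooth f"
  shows "partial_deriv i (\<lambda>x. f x / c) x = partial_deriv i f x / c"
  using partial_deriv_cmult[OF assms, of i "1 / c" x] by simp

lemma flat_0_mono: "s \<le> t \<Longrightarrow> flat 0 s \<le> flat 0 t"
  by (auto simp: flat_def intro!: divide_left_mono)

text \<open>The barrier is \<open>exp (- k / a)\<close> with \<open>a = 1 - x\<^sup>2 / A\<^sup>2 - y\<^sup>2 / b\<^sup>2\<close>, extended by zero outside the ellipse \<open>a > 0\<close>;
  its laplacian is positive away from the critical point \<open>0\<close> of \<open>a\<close> when \<open>k\<close> is large.\<close>

lemma barrier:
  assumes b: "0 < b" "b \<le> A" "b < h" and a0: "0 < a0"
  obtains \<phi> c where "\<phi> \<in> test_functions (strip h)" "\<And>p. 0 \<le> \<phi> p" "0 < c"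
    "\<And>p. 1 \<le> norm p \<Longrightarrow> 0 \<le> laplacian \<phi> p"
    "\<And>p. 1 \<le> norm p \<Longrightarrow> a0 \<le> 1 - (fst p)\<^sup>2 / A\<^sup>2 - (snd p)\<^sup>2 / b\<^sup>2 \<Longrightarrow> c \<le> laplacian \<phi> p"
proof -
  have A: "0 < A" using b by linarith
  define a where "a p = 1 - (fst p)\<^sup>2 / A\<^sup>2 - (snd p)\<^sup>2 / b\<^sup>2" for p :: "real \<times> real"
  \<comment> \<open>Chosen so that (k - 2) * 4/A^4 = 1 + 4/b^2. Here 4/A^4 bounds the squared
    gradient of \<open>a\<close> from below off the unit disk, 4/b^2 absorbs the second derivatives
    of \<open>a\<close>, and 1 is left over.\<close>
  define k where "k = 2 + A ^ 4 * (1 + 4 / b\<^sup>2) / 4"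
  have k: "2 \<le> k" using A b by (simp add: k_def)
  define \<phi> where "\<phi> p = flat 0 (a p / k)" for p
  have sa: "smooth a" unfolding a_def[abs_def] by (intro smooth_intros)
  have da: "dx a p = - 2 * fst p / A\<^sup>2" "dy a p = - 2 * snd p / b\<^sup>2" for p
  proof -
    have "partial_deriv i a p = - 2 * fst p * fst i / A\<^sup>2 - 2 * snd p * snd i / b\<^sup>2" for i
      unfolding a_def[abs_def]
      by (simp add: partial_deriv_diff partial_deriv_divide_const partial_deriv_power smooth_intros)
    then show "dx a p = - 2 * fst p / A\<^sup>2" "dy a p = - 2 * snd p / b\<^sup>2" by simp_all
  qed
  have dda: "dx (dx a) p = - 2 / A\<^sup>2" "dy (dy a) p = - 2 / b\<^sup>2" for p
  proof -
    have "dx a = (\<lambda>p. (- 2 / A\<^sup>2) * fst p)" "dy a = (\<lambda>p. (- 2 / b\<^sup>2) * snd p)" by (simp_all add: da fun_eq_iff)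
    then show "dx (dx a) p = - 2 / A\<^sup>2" "dy (dy a) p = - 2 / b\<^sup>2"
      by (simp_all only: partial_deriv_cmult[OF smooth_fst] partial_deriv_cmult[OF smooth_snd] partial_deriv_fst partial_deriv_snd) simp_all
  qed
  have dflat: "partial_deriv i (\<lambda>p. flat n (a p / k)) p = (flat (n + 2) (a p / k) - n * flat (n + 1) (a p / k)) / k * partial_deriv i a p"
    for i n p
    using partial_deriv_compose[OF flat_has_derivative smooth_divide_const[OF sa], of i n k p]
    by (simp add: partial_deriv_divide_const[OF sa])
  have sfl: "smooth (\<lambda>p. flat n (a p / k))" for n
    by (intro smooth_compose[OF smooth_flat] smooth_divide_const sa)
  have d2: "partial_deriv i (partial_deriv i \<phi>) p =
      (flat 4 (a p / k) - 2 * flat 3 (a p / k)) / k\<^sup>2 * (partial_deriv i a p)\<^sup>2 + flat 2 (a p / k) / k * partial_deriv i (partial_deriv i a) p"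
    if i: "i \<in> Basis" for i p
  proof -
    have "partial_deriv i \<phi> = (\<lambda>p. (1 / k) * (flat 2 (a p / k) * partial_deriv i a p))"
      unfolding \<phi>_def[abs_def] dflat fun_eq_iff by (simp add: numeral_2_eq_2)
    then have "partial_deriv i (partial_deriv i \<phi>) p = (1 / k) * partial_deriv i (\<lambda>p. flat 2 (a p / k) * partial_deriv i a p) p"
      using sfl sa i by (simp only: partial_deriv_cmult smooth_mult smooth_partial_deriv)
    also have "\<dots> = (1 / k) * (flat 2 (a p / k) * partial_deriv i (partial_deriv i a) p
        + (flat 4 (a p / k) - 2 * flat 3 (a p / k)) / k * partial_deriv i a p * partial_deriv i a p)"
      using sfl sa i by (simp add: partial_deriv_mult smooth_partial_deriv dflat numeral_eq_Suc del: split_paired_All)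
    finally show ?thesis by (simp add: power2_eq_square algebra_simps diff_divide_distrib)
  qed
  have B: "(1, 0) \<in> (Basis :: (real \<times> real) set)" "(0, 1) \<in> (Basis :: (real \<times> real) set)" by (simp_all add: Basis_plane)
  define G where "G p = (dx a p)\<^sup>2 + (dy a p)\<^sup>2" for p
  have lap: "laplacian \<phi> p = (flat 4 (a p / k) - 2 * flat 3 (a p / k)) / k\<^sup>2 * G p - flat 2 (a p / k) / k * (2 / A\<^sup>2 + 2 / b\<^sup>2)" for p
    unfolding laplacian_def d2[OF B(1)] d2[OF B(2)] dda G_def by (simp add: algebra_simps diff_divide_distrib add_divide_distrib)
  \<comment> \<open>A lower bound by \<open>flat 0\<close> of the same argument gives both claims:
    nonnegativity, and by monotonicity a uniform positive bound where \<open>a\<close> is at least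
    \<open>a0\<close>.\<close>
  have low: "flat 0 (a p / k) / k ^ 3 \<le> laplacian \<phi> p" if p: "1 \<le> norm p" for p
  proof (cases "0 < a p")
    case False
    then have "a p / k \<le> 0" using k by (simp add: divide_nonpos_pos)
    then show ?thesis unfolding lap by (simp add: flat_eq_0)
  next
    case True
    have "0 \<le> (fst p)\<^sup>2 / A\<^sup>2" "0 \<le> (snd p)\<^sup>2 / b\<^sup>2" by simp_all
    then have a1: "a p \<le> 1" unfolding a_def by linarith
    define t where "t = a p / k"
    have t: "0 < t" "t \<le> 1" "a p = t * k" using True a1 k by (auto simp: t_def divide_le_eq_1)
    define e where "e = exp (- (1 / t))"
    have fl: "flat n t = e / t ^ n" for n using t(1) by (simp add: flat_def e_def)
    have e: "0 < e" by (simp add: e_def)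
    have "1 \<le> (fst p)\<^sup>2 + (snd p)\<^sup>2"
    proof -
      have "1 \<le> (norm p)\<^sup>2" using p by simp
      then show ?thesis by (cases p) (simp add: norm_Pair)
    qed
    \<comment> \<open>The assumption \<open>b\<close> \<le> \<open>A\<close> makes the coefficient
      of y^2 the larger one, so the squared gradient is at least 4/A^4 times the squared norm of
      \<open>p\<close>.\<close>
    moreover have "4 / A ^ 4 * (snd p)\<^sup>2 \<le> 4 / b ^ 4 * (snd p)\<^sup>2"
      using b by (intro mult_right_mono divide_left_mono power_mono) auto
    moreover have "G p = 4 / A ^ 4 * (fst p)\<^sup>2 + 4 / b ^ 4 * (snd p)\<^sup>2"
      unfolding G_def da by (simp add: power_divide power_mult_distrib power_mult[symmetric])
    moreover have "4 / A ^ 4 * 1 \<le> 4 / A ^ 4 * ((fst p)\<^sup>2 + (snd p)\<^sup>2)"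
      using calculation(1) A by (intro mult_left_mono) auto
    ultimately have G: "4 / A ^ 4 \<le> G p" by (simp add: distrib_left)
    have "(1 + 4 / b\<^sup>2) = (k - 2) * (4 / A ^ 4)" using A by (simp add: k_def)
    also have "\<dots> \<le> (k - 2 * a p) * G p"
      using G k a1 A by (intro mult_mono) auto
    finally have 1: "1 + 4 / b\<^sup>2 \<le> (k - 2 * a p) * G p" .
    have "(a p)\<^sup>2 * (2 / A\<^sup>2 + 2 / b\<^sup>2) \<le> 1 * (2 / b\<^sup>2 + 2 / b\<^sup>2)"
      using a1 True b A by (intro mult_mono add_mono divide_left_mono power_mono) (auto simp: power_le_one)
    with 1 have 2: "1 \<le> (k - 2 * a p) * G p - (a p)\<^sup>2 * (2 / A\<^sup>2 + 2 / b\<^sup>2)" by simp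
    \<comment> \<open>The bracket is at least 1 by the choice of \<open>k\<close>, and t \<le> 1, so
      the product is at least e/k^3, where e is \<open>flat 0 t\<close>.\<close>
    have "laplacian \<phi> p = e / (t ^ 4 * k ^ 3) * ((k - 2 * a p) * G p - (a p)\<^sup>2 * (2 / A\<^sup>2 + 2 / b\<^sup>2))"
    proof -
      have X: "(e / t ^ 4 - 2 * (e / t ^ 3)) / k\<^sup>2 = e / (t ^ 4 * k ^ 3) * (k - 2 * a p)"
        using t k by (simp add: field_simps power_numeral_reduce)
      have Y: "e / t\<^sup>2 / k = e / (t ^ 4 * k ^ 3) * (a p)\<^sup>2"
        using t k by (simp add: field_simps power_numeral_reduce)
      have "c * x * v - c * y * w = c * (x * v - y * w)" for c x v y w :: real by (simp add: algebra_simps)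
      then show ?thesis unfolding lap t_def[symmetric] fl X Y by blast
    qed
    moreover have "e / k ^ 3 * 1 \<le> e / (t ^ 4 * k ^ 3) * ((k - 2 * a p) * G p - (a p)\<^sup>2 * (2 / A\<^sup>2 + 2 / b\<^sup>2))"
    proof (intro mult_mono 2)
      have "t ^ 4 * k ^ 3 \<le> 1 * k ^ 3" using t k by (intro mult_right_mono power_le_one) auto
      then show "e / k ^ 3 \<le> e / (t ^ 4 * k ^ 3)" using e t k by (intro divide_left_mono) auto
    qed (use e t k in auto)
    ultimately show ?thesis unfolding t_def[symmetric] fl by simp
  qed
  show ?thesis
  proof (rule that[of \<phi> "flat 0 (a0 / k) / k ^ 3"])
    show "\<phi> \<in> test_functions (strip h)"
    proof (rule test_functionsI[of _ "{-A..A} \<times> {-b..b}"])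
      show "smooth \<phi>" unfolding \<phi>_def[abs_def] by (rule sfl)
      show "compact ({-A..A} \<times> {-b..b})" by (intro compact_Times) auto
      show "{-A..A} \<times> {-b..b} \<subseteq> strip h" using b by (auto simp: strip_def)
      fix p assume p: "p \<notin> {-A..A} \<times> {-b..b}"
      have "1 \<le> x\<^sup>2 / r\<^sup>2" if "\<not> \<bar>x\<bar> \<le> r" "0 < r" for x r :: real
        using that abs_le_square_iff[of r x] by (simp add: pos_le_divide_eq)
      moreover have "\<not> \<bar>fst p\<bar> \<le> A \<or> \<not> \<bar>snd p\<bar> \<le> b" using p by (cases p) auto
      ultimately have "1 \<le> (fst p)\<^sup>2 / A\<^sup>2 \<or> 1 \<le> (snd p)\<^sup>2 / b\<^sup>2" using A b by blast
      moreover have "0 \<le> (fst p)\<^sup>2 / A\<^sup>2" "0 \<le> (snd p)\<^sup>2 / b\<^sup>2" by simp_all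
      ultimately have "a p \<le> 0" unfolding a_def by linarith
      then show "\<phi> p = 0" using k by (simp add: \<phi>_def flat_eq_0 divide_nonpos_pos)
    qed
    show "0 \<le> \<phi> p" for p by (simp add: \<phi>_def)
    show "0 < flat 0 (a0 / k) / k ^ 3" using a0 k by (simp add: flat_pos)
    show "0 \<le> laplacian \<phi> p" if "1 \<le> norm p" for p
      using low[OF that] k by (smt (verit) flat_nonneg divide_nonneg_nonneg zero_le_power)
    show "flat 0 (a0 / k) / k ^ 3 \<le> laplacian \<phi> p"
      if "1 \<le> norm p" "a0 \<le> 1 - (fst p)\<^sup>2 / A\<^sup>2 - (snd p)\<^sup>2 / b\<^sup>2" for p
    proof -
      have ak: "a0 / k \<le> a p / k" using that(2) k by (intro divide_right_mono) (auto simp: a_def)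
      have "flat 0 (a0 / k) / k ^ 3 \<le> flat 0 (a p / k) / k ^ 3" using k by (intro divide_right_mono flat_0_mono ak) auto
      with low[OF that(1)] show ?thesis by linarith
    qed
  qed
qed

text \<open>Replaces \<open>u\<close> by the smooth approximation \<open>sqrt (u\<^sup>2 + e\<^sup>2) - e\<close> of \<open>\<bar>u\<bar>\<close>.\<close>

lemma nonneg_normalization:
  assumes u: "u \<in> test_functions \<Omega>" "\<And>p. u (reflect_x p) = u p" "0 < quartic u" "energy u < c * sqrt (quartic u)"
  obtains w where "w \<in> test_functions \<Omega>" "\<And>p. w (reflect_x p) = w p" "\<And>p. 0 \<le> w p" "quartic w = 1" "energy w < c"
proof -
  note s = test_functions_smooth[OF u(1)] test_functions_csupp[OF u(1)]
  define e where "e n = inverse (real (Suc n))" for n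
  have e: "0 < e n" for n by (simp add: e_def)
  define W where "W n p = sqrt ((u p)\<^sup>2 + (e n)\<^sup>2) - e n" for n p
  have pos: "0 < (u p)\<^sup>2 + (e n)\<^sup>2" for n p using e[of n] by (simp add: add_nonneg_pos)
  have W0: "0 \<le> W n p" for n p
  proof -
    have "e n = sqrt ((e n)\<^sup>2)" using e[of n] by simp
    also have "\<dots> \<le> sqrt ((u p)\<^sup>2 + (e n)\<^sup>2)" by (intro real_sqrt_le_mono) simp
    finally show ?thesis by (simp add: W_def)
  qed
  have W1: "W n p \<le> \<bar>u p\<bar>" for n p
    using sqrt_sum_squares_le_sum_abs[of "u p" "e n"] e[of n] by (simp add: W_def)
  have Ws: "smooth (W n)" for n
  proof -
    have "W n = (\<lambda>p. ((u p)\<^sup>2 + (e n)\<^sup>2) powr (1 / 2) - e n)"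
      using pos by (auto simp: W_def fun_eq_iff powr_half_sqrt less_imp_le simp del: split_paired_All)
    then show ?thesis
      using smooth_compose[OF smooth_square_plus_powr[of "(e n)\<^sup>2" "1 / 2"] s(1)] e[of n]
      by (auto intro!: smooth_diff smooth_const)
  qed
  have Wt: "W n \<in> test_functions \<Omega>" for n
    by (rule test_functions_subset_support[OF u(1) Ws]) (use e[of n] in \<open>simp add: W_def\<close>)
  have WE: "energy (W n) \<le> energy u" for n
    unfolding energy_def
  proof (intro integral_mono integrable_grad_sq add_mono)
    show "smooth (W n)" "csupp (W n)" by (rule Ws, rule test_functions_csupp[OF Wt])
    show "smooth u" "csupp u" by fact+
    \<comment> \<open>The function sqrt(x^2 + e^2) has slope of modulus at most 1, so no partial
      derivative grows.\<close>
    have "(partial_deriv i (W n) p)\<^sup>2 \<le> (partial_deriv i u p)\<^sup>2" for i p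
    proof -
      have "((\<lambda>x. sqrt (x\<^sup>2 + (e n)\<^sup>2) - e n) has_real_derivative u p / sqrt ((u p)\<^sup>2 + (e n)\<^sup>2)) (at (u p))"
        using pos[of p n] by (auto intro!: derivative_eq_intros simp: field_simps)
      from partial_deriv_compose[OF this s(1)]
      have "partial_deriv i (W n) p = u p / sqrt ((u p)\<^sup>2 + (e n)\<^sup>2) * partial_deriv i u p" by (simp add: W_def[abs_def])
      then have "(partial_deriv i (W n) p)\<^sup>2 = (u p)\<^sup>2 / ((u p)\<^sup>2 + (e n)\<^sup>2) * (partial_deriv i u p)\<^sup>2"
        using pos[of p n] by (simp add: power_mult_distrib power_divide less_imp_le)
      also have "\<dots> \<le> 1 * (partial_deriv i u p)\<^sup>2" using pos[of p n] by (intro mult_right_mono) (auto simp: divide_le_eq_1)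
      finally show ?thesis by simp
    qed
    then show "(dx (W n) p)\<^sup>2 \<le> (dx u p)\<^sup>2" "(dy (W n) p)\<^sup>2 \<le> (dy u p)\<^sup>2" for p by blast+
  qed
  have e0: "e \<longlonglongrightarrow> 0" using LIMSEQ_inverse_real_of_nat by (simp add: e_def[abs_def])
  have lim: "(\<lambda>n. quartic (W n)) \<longlonglongrightarrow> quartic u"
  proof (rule integral_dominated_convergence[where w = "\<lambda>p. (u p) ^ 4"])
    show "integrable lborel (\<lambda>p. (u p) ^ 4)" using s by (intro integrable_csupp_smooth smooth_power csupp_power) auto
    then show "(\<lambda>p. (u p) ^ 4) \<in> borel_measurable lborel" by (rule borel_measurable_integrable)
    show "(\<lambda>p. (W n p) ^ 4) \<in> borel_measurable lborel" for n
      using Ws by (simp add: borel_measurable_continuous_onI smooth_continuous_on smooth_power)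
    show "AE p in lborel. (\<lambda>n. W n p ^ 4) \<longlonglongrightarrow> u p ^ 4"
    proof (rule AE_I2)
      fix p
      have "(\<lambda>n. W n p) \<longlonglongrightarrow> sqrt ((u p)\<^sup>2 + 0\<^sup>2) - 0" unfolding W_def by (intro tendsto_intros e0)
      then have "(\<lambda>n. W n p ^ 4) \<longlonglongrightarrow> \<bar>u p\<bar> ^ 4" by (intro tendsto_power) simp
      then show "(\<lambda>n. W n p ^ 4) \<longlonglongrightarrow> u p ^ 4" by (simp add: power_even_abs)
    qed
    show "AE p in lborel. norm (W n p ^ 4) \<le> u p ^ 4" for n
      using power_mono[OF W1 W0, of n _ 4] by (intro AE_I2) (simp add: power_even_abs)
  qed
  \<comment> \<open>The hypothesis on the quotient is strict, so it survives with \<open>W n\<close>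
    in the quartic for some n; normalization preserves it by homogeneity.\<close>
  have "(\<lambda>n. c * sqrt (quartic (W n))) \<longlonglongrightarrow> c * sqrt (quartic u)" by (intro tendsto_intros lim)
  from order_tendstoD(1)[OF this u(4)] obtain n where n: "energy u < c * sqrt (quartic (W n))"
    by (auto simp: eventually_sequentially)
  have "quartic (W n) \<noteq> 0" 
  proof
    assume "quartic (W n) = 0"
    with n have "energy u < 0" by simp
    with energy_nonneg[of u] show False by linarith
  qed
  then have "0 < quartic (W n)" using quartic_nonneg[of "W n"] by linarith
  from normalize_quartic[OF this] obtain k where k: "0 < k" "quartic (\<lambda>x. k * W n x) = 1" "k\<^sup>2 * sqrt (quartic (W n)) = 1" by blast
  show ?thesis
  proof (rule that)
    show "(\<lambda>x. k * W n x) \<in> test_functions \<Omega>" by (rule test_functions_cmult[OF Wt])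
    show "k * W n (reflect_x p) = k * W n p" for p by (simp add: W_def u(2))
    show "0 \<le> k * W n p" for p using k(1) W0 by simp
    show "quartic (\<lambda>x. k * W n x) = 1" by (rule k(2))
    have "energy (\<lambda>x. k * W n x) = k\<^sup>2 * energy (W n)" by (rule energy_cmult[OF Ws])
    also have "\<dots> \<le> k\<^sup>2 * energy u" by (intro mult_left_mono WE) auto
    also have "\<dots> < k\<^sup>2 * (c * sqrt (quartic (W n)))" using n k(1) by (intro mult_strict_left_mono) auto
    also have "\<dots> = c" using k(3) by (simp add: mult.left_commute)
    finally show "energy (\<lambda>x. k * W n x) < c" .
  qed
qed

text \<open>Adding a nonnegative multiple of \<phi> to the nonnegative \<open>u\<close> cannot lower
  the quartic integral, so the perturbed energy is still at least \<open>S\<close>; expanding it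
  isolates the first variation.\<close>

lemma almost_minimizer_laplacian_le:
  assumes S: "0 < S" "\<And>\<phi>. \<phi> \<in> test_functions \<Omega> \<Longrightarrow> S * sqrt (quartic \<phi>) \<le> energy \<phi>"
    and u: "u \<in> test_functions \<Omega>" "\<And>p. 0 \<le> u p" "quartic u = 1" "energy u \<le> S + d" and d: "0 < d"
    and \<phi>: "\<phi> \<in> test_functions \<Omega>" "\<And>p. 0 \<le> \<phi> p"
  shows "(\<integral>p. u p * laplacian \<phi> p \<partial>lborel) \<le> (1 + energy \<phi>) / 2 * sqrt d"
proof -
  note su = test_functions_smooth[OF u(1)] test_functions_csupp[OF u(1)]
  note s\<phi> = test_functions_smooth[OF \<phi>(1)] test_functions_csupp[OF \<phi>(1)]
  \<comment> \<open>The expansion gives 2 t X \<le> d + t^2 \<open>energy \<phi>\<close>; this t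
    balances the two terms.\<close>
  define t where "t = sqrt d"
  have t: "0 < t" "t\<^sup>2 = d" using d by (simp_all add: t_def)
  define X where "X = (\<integral>p. u p * laplacian \<phi> p \<partial>lborel)"
  have v: "(\<lambda>p. u p + t * \<phi> p) \<in> test_functions \<Omega>" using u(1) \<phi>(1) by (intro test_functions_add test_functions_cmult)
  have "quartic u \<le> quartic (\<lambda>p. u p + t * \<phi> p)"
  proof (rule integral_mono)
    show "integrable lborel (\<lambda>p. u p ^ 4)" using su by (intro integrable_csupp_smooth smooth_power csupp_power) auto
    show "integrable lborel (\<lambda>p. (u p + t * \<phi> p) ^ 4)"
      using test_functions_smooth[OF v] test_functions_csupp[OF v] by (intro integrable_csupp_smooth smooth_power csupp_power) auto
    show "u p ^ 4 \<le> (u p + t * \<phi> p) ^ 4" for p using u(2) \<phi>(2) t(1) by (intro power_mono) auto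
  qed
  then have "S * 1 \<le> S * sqrt (quartic (\<lambda>p. u p + t * \<phi> p))" using S(1) u(3) by (intro mult_left_mono) auto
  also have "\<dots> \<le> energy (\<lambda>p. u p + t * \<phi> p)" by (rule S(2)[OF v])
  also have "\<dots> = energy u - 2 * t * X + t\<^sup>2 * energy \<phi>" unfolding X_def by (rule energy_perturb[OF su s\<phi>])
  finally have "2 * t * X \<le> t\<^sup>2 * (1 + energy \<phi>)" using u(4) t(2) by (simp add: distrib_left)
  then have "t * X \<le> t * ((1 + energy \<phi>) / 2 * t)" by (simp add: power2_eq_square algebra_simps)
  then show ?thesis using t(1) unfolding X_def t_def by simp
qed

text \<open>Values up to \<open>M\<close> satisfy w^4 \<le> M^3 w, larger ones w^4 \<le> w^6/M^2.
  Thus a weighted L1 bound, with weight \<open>l\<close> bounded below only where w is small, and an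
  L6 bound control L4.\<close>

lemma quartic_pointwise_le:
  fixes w M l c :: real
  assumes "0 \<le> w" "0 < M" "0 < c" "w \<le> M \<Longrightarrow> c \<le> l" "0 \<le> l"
  shows "w ^ 4 \<le> M ^ 3 / c * (w * l) + w ^ 6 / M\<^sup>2"
proof (cases "w \<le> M")
  case True
  have "w ^ 4 = w ^ 3 * w" by (simp add: power_numeral_reduce)
  also have "\<dots> \<le> M ^ 3 * w" using True assms by (intro mult_right_mono power_mono) auto
  also have "\<dots> = M ^ 3 / c * (w * c)" using assms by simp
  also have "\<dots> \<le> M ^ 3 / c * (w * l)" using assms True by (intro mult_left_mono) auto
  also have "\<dots> \<le> M ^ 3 / c * (w * l) + w ^ 6 / M\<^sup>2" using assms by simp
  finally show ?thesis .
next
  case False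
  have "w ^ 4 * M\<^sup>2 \<le> w ^ 4 * w\<^sup>2" using False assms by (intro mult_left_mono power_mono) auto
  also have "\<dots> = w ^ 6" by (simp add: power_add[symmetric])
  finally have "w ^ 4 \<le> w ^ 6 / M\<^sup>2" using assms by (simp add: pos_le_divide_eq)
  moreover have "0 \<le> M ^ 3 / c * (w * l)" using assms by simp
  ultimately show ?thesis by linarith
qed

text \<open>For an even \<open>u\<close> of almost minimal quotient, half of \<open>\<integral> u\<^sup>4\<close> lies in \<open>\<bar>x\<bar> < 5 h\<close>; but there the barrier
  forces \<open>u\<close> to be small in \<open>L\<^sup>1\<close>, hence in \<open>L\<^sup>4\<close> by the bound on \<open>\<integral> u\<^sup>6\<close>, except in a thin layer
  at the boundary of the strip.\<close>

lemma even_gap: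
  assumes h: "0 < h" and S: "0 < S" "\<And>\<phi>. \<phi> \<in> test_functions (strip h) \<Longrightarrow> S * sqrt (quartic \<phi>) \<le> energy \<phi>"
  shows "\<exists>d>0. \<forall>u \<in> test_functions (strip h - cball 0 1). (\<forall>p. u (reflect_x p) = u p) \<longrightarrow>
    0 < quartic u \<longrightarrow> (S + d) * sqrt (quartic u) \<le> energy u"
proof -
  \<comment> \<open>Bound for \<integral> w^6: 9 is the squared exponent 3 in
    \<open>integral_even_power_le\<close>, the energy is at most 21/20 S, and the quartic is 1. The
    height \<open>M\<close> is then chosen so that K/M^2 = 1/8.\<close>
  define K where "K = 9 * (21 / 20 * S)"
  define M where "M = sqrt (8 * K)"
  have K: "0 < K" using S(1) by (simp add: K_def)
  have M: "0 < M" "M\<^sup>2 = 8 * K" using K by (simp_all add: M_def)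
  \<comment> \<open>Thickness of the two layers at the boundary of the strip, where the barrier has
    no uniform bound: inside \<bar>x\<bar> \<le> 5 h their area is 20 h \<eta>, so values up to
    \<open>M\<close> contribute at most 1/8.\<close>
  define \<eta> where "\<eta> = min (h / 2) (1 / (160 * h * M ^ 4))"
  have \<eta>: "0 < \<eta>" "\<eta> \<le> h / 2" using h M by (simp_all add: \<eta>_def)
  have "M ^ 4 * (20 * h * \<eta>) \<le> M ^ 4 * (20 * h * (1 / (160 * h * M ^ 4)))"
    using h M by (intro mult_left_mono) (auto simp: \<eta>_def)
  also have "\<dots> = 1 / 8" using h M by (simp add: field_simps)
  finally have \<eta>M: "M ^ 4 * (20 * h * \<eta>) \<le> 1 / 8" .
  define b where "b = h - \<eta> / 2"
  have b: "0 < b" "b < h" "0 < h - \<eta>" "h - \<eta> < b" using h \<eta> by (simp_all add: b_def)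
  define \<rho> where "\<rho> = (h - \<eta>)\<^sup>2 / b\<^sup>2"
  \<comment> \<open>Half of 1 - \<rho>. Away from the layers y^2/b^2 is at most \<rho>; taking
    \<open>A\<close> so large that x^2/A^2 \<le> a0 for \<bar>x\<bar> \<le> 5 h leaves at least a0.
    It is positive because \<open>b\<close> lies strictly above h - \<eta>.\<close>
  define a0 where "a0 = (1 - \<rho>) / 2"
  have "(h - \<eta>)\<^sup>2 < b\<^sup>2" using b by (intro power_strict_mono) auto
  then have a0: "0 < a0" using b by (simp add: a0_def \<rho>_def divide_less_eq_1)
  define A where "A = max b (5 * h / sqrt a0)"
  have A: "b \<le> A" "0 < A" "(5 * h)\<^sup>2 / A\<^sup>2 \<le> a0"
  proof -
    show "b \<le> A" "0 < A" using b by (simp_all add: A_def less_max_iff_disj)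
    have "(5 * h / sqrt a0)\<^sup>2 \<le> A\<^sup>2" using h a0 by (intro power_mono) (auto simp: A_def)
    then have "(5 * h)\<^sup>2 / a0 \<le> A\<^sup>2" using a0 by (simp add: power_divide)
    then show "(5 * h)\<^sup>2 / A\<^sup>2 \<le> a0" using a0 \<open>0 < A\<close> by (simp add: field_simps)
  qed
  obtain \<phi> c where \<phi>: "\<phi> \<in> test_functions (strip h)" "\<And>p. 0 \<le> \<phi> p" and c: "0 < c"
    and lap0: "\<And>p. 1 \<le> norm p \<Longrightarrow> 0 \<le> laplacian \<phi> p"
    and lapc: "\<And>p. 1 \<le> norm p \<Longrightarrow> a0 \<le> 1 - (fst p)\<^sup>2 / A\<^sup>2 - (snd p)\<^sup>2 / b\<^sup>2 \<Longrightarrow> c \<le> laplacian \<phi> p"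
    by (rule barrier[OF b(1) A(1) b(2) a0]) blast
  define C where "C = M ^ 3 / c * ((1 + energy \<phi>) / 2)"
  have C: "0 < C" using M c energy_nonneg[of \<phi>] by (simp add: C_def add_pos_nonneg)
  \<comment> \<open>The first bound gives the energy hypothesis of
    \<open>even_concentration\<close>; the second makes the barrier contribution C sqrt d at most
    1/8.\<close>
  define d where "d = min (S / 20) ((1 / (8 * C))\<^sup>2)"
  have d: "0 < d" "d \<le> S / 20" using S(1) C by (simp_all add: d_def)
  have "sqrt d \<le> sqrt ((1 / (8 * C))\<^sup>2)" by (intro real_sqrt_le_mono) (simp add: d_def)
  then have "C * sqrt d \<le> C * (1 / (8 * C))" using C by (intro mult_left_mono) auto
  then have dC: "C * sqrt d \<le> 1 / 8" using C by simp
  define B1 B2 where "B1 = cbox (- (5 * h), - h) (5 * h, - (h - \<eta>))" and "B2 = cbox (- (5 * h), h - \<eta>) (5 * h, h)"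
  have Bm: "measure lborel B1 = 10 * h * \<eta>" "measure lborel B2 = 10 * h * \<eta>"
    using h \<eta> by (simp_all add: B1_def B2_def content_Pair)
  have Bi: "integrable lborel (indicator B1 :: _ \<Rightarrow> real)" "integrable lborel (indicator B2 :: _ \<Rightarrow> real)"
    by (simp_all add: B1_def B2_def integrable_indicator_iff emeasure_lborel_cbox_finite[unfolded infinity_ennreal_def])
  have "(S + d) * sqrt (quartic u) \<le> energy u"
    if u: "u \<in> test_functions (strip h - cball 0 1)" "\<And>p. u (reflect_x p) = u p" "0 < quartic u" for u
  proof (rule ccontr)
    assume "\<not> (S + d) * sqrt (quartic u) \<le> energy u"
    then have "energy u < (S + d) * sqrt (quartic u)" by simp
    from nonneg_normalization[OF u this] obtain w where w: "w \<in> test_functions (strip h - cball 0 1)"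
      "\<And>p. w (reflect_x p) = w p" "\<And>p. 0 \<le> w p" "quartic w = 1" "energy w < S + d" by blast
    have ws: "w \<in> test_functions (strip h)" by (rule test_functions_mono[OF _ w(1)]) auto
    note s = test_functions_smooth[OF ws] test_functions_csupp[OF ws]
    have E: "energy w \<le> 21 / 20 * S" using w(5) d(2) by simp
    have conc: "1 / 2 \<le> (\<integral>p. indicator {p. \<bar>fst p\<bar> < 5 * h} p * (w p) ^ 4 \<partial>lborel)"
      by (rule even_concentration[OF h S ws w(2,4) E])
    have w6: "(\<integral>p. w p ^ 6 \<partial>lborel) \<le> K"
      using integral_even_power_le[OF s, of 3] w(4) E by (simp add: K_def)
    have X: "(\<integral>p. w p * laplacian \<phi> p \<partial>lborel) \<le> (1 + energy \<phi>) / 2 * sqrt d"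
      by (rule almost_minimizer_laplacian_le[OF S ws w(3,4) less_imp_le[OF w(5)] d(1) \<phi>])
    have iX: "integrable lborel (\<lambda>p. w p * laplacian \<phi> p)"
      using s test_functions_smooth[OF \<phi>(1)] by (intro integrable_csupp_smooth smooth_intros csupp_mult_left)
    have i6: "integrable lborel (\<lambda>p. w p ^ n)" if "0 < n" for n
      using s that by (intro integrable_csupp_smooth smooth_power csupp_power)
    have m: "{p::real\<times>real. \<bar>fst p\<bar> < 5 * h} \<in> sets lborel"
      by (auto intro!: borel_open open_Collect_less continuous_intros)
    have pt: "indicator {p. \<bar>fst p\<bar> < 5 * h} p * w p ^ 4
      \<le> (M ^ 3 / c * (w p * laplacian \<phi> p) + w p ^ 6 / M\<^sup>2) + M ^ 4 * (indicator B1 p + indicator B2 p)" for p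
    \<comment> \<open>In the hole and off the strip \<open>w\<close> vanishes; at the remaining
      points the norm is at least 1, as the barrier requires.\<close>
    proof (cases "norm p < 1 \<or> h \<le> \<bar>snd p\<bar>")
      case True
      then have "w p = 0"
        using strip_outside[OF ws, of p] test_functions_outside(1)[OF w(1), of p] by auto
      then show ?thesis using M by simp
    next
      case False
      then have p: "1 \<le> norm p" "\<bar>snd p\<bar> < h" by simp_all
      have r0: "0 \<le> M ^ 3 / c * (w p * laplacian \<phi> p) + w p ^ 6 / M\<^sup>2"
        using lap0[OF p(1)] w(3)[of p] M(1) c by simp
      have B0: "0 \<le> M ^ 4 * (indicator B1 p + indicator B2 p)" using M(1) by simp
      \<comment> \<open>The last case unites interior points, where the barrier is uniformly
        subharmonic, with points where \<open>w\<close> exceeds \<open>M\<close>, where the lower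
        bound on the laplacian is asked for vacuously.\<close>
      consider "5 * h \<le> \<bar>fst p\<bar>" | "\<bar>fst p\<bar> < 5 * h" "h - \<eta> \<le> \<bar>snd p\<bar>" "w p \<le> M"
        | "\<bar>fst p\<bar> < 5 * h" "w p \<le> M \<Longrightarrow> \<bar>snd p\<bar> < h - \<eta>" by linarith
      then show ?thesis
      proof cases
        case 1
        then show ?thesis using r0 B0 by simp
      next
        case 2
        then have "p \<in> B1 \<or> p \<in> B2" using p(2) by (cases p) (auto simp: B1_def B2_def cbox_Pair_eq)
        then have "M ^ 4 * 1 \<le> M ^ 4 * (indicator B1 p + indicator B2 p)"
          using M(1) by (intro mult_left_mono) (auto simp: indicator_def)
        moreover have "w p ^ 4 \<le> M ^ 4" using 2(3) w(3) by (intro power_mono)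
        ultimately show ?thesis using r0 2(1) by simp
      next
        case 3
        have "c \<le> laplacian \<phi> p" if "w p \<le> M"
        proof (rule lapc[OF p(1)])
          have "(fst p)\<^sup>2 \<le> (5 * h)\<^sup>2" using 3(1) h abs_le_square_iff[of "fst p" "5 * h"] by simp
          then have "(fst p)\<^sup>2 / A\<^sup>2 \<le> (5 * h)\<^sup>2 / A\<^sup>2" by (intro divide_right_mono) auto
          moreover have "(snd p)\<^sup>2 \<le> (h - \<eta>)\<^sup>2" using 3(2)[OF that] b abs_le_square_iff[of "snd p" "h - \<eta>"] by simp
          then have "(snd p)\<^sup>2 / b\<^sup>2 \<le> \<rho>" unfolding \<rho>_def by (intro divide_right_mono) auto
          moreover have "\<rho> = 1 - 2 * a0" by (simp add: a0_def field_simps)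
          ultimately show "a0 \<le> 1 - (fst p)\<^sup>2 / A\<^sup>2 - (snd p)\<^sup>2 / b\<^sup>2" using A(3) by linarith
        qed
        then have "w p ^ 4 \<le> M ^ 3 / c * (w p * laplacian \<phi> p) + w p ^ 6 / M\<^sup>2"
          using w(3) M(1) c lap0[OF p(1)] by (intro quartic_pointwise_le)
        from add_mono[OF this B0] show ?thesis using 3(1) by simp
      qed
    qed
    have j1: "integrable lborel (\<lambda>p. M ^ 3 / c * (w p * laplacian \<phi> p))" by (rule integrable_mult_right[OF iX])
    have j2: "integrable lborel (\<lambda>p. w p ^ 6 / M\<^sup>2)" by (rule integrable_divide_zero[OF i6]) simp
    have j3: "integrable lborel (\<lambda>p. M ^ 4 * (indicator B1 p + indicator B2 p :: real))"
      by (intro integrable_mult_right Bochner_Integration.integrable_add Bi)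
    \<comment> \<open>Barrier, sixth power and layers contribute at most 1/8 each, which contradicts
      the lower bound 1/2 from concentration.\<close>
    have "1 / 2 \<le> (\<integral>p. (M ^ 3 / c * (w p * laplacian \<phi> p) + w p ^ 6 / M\<^sup>2) + M ^ 4 * (indicator B1 p + indicator B2 p) \<partial>lborel)"
      using integrable_mult_indicator[OF m i6, of 4] pt
      by (intro order_trans[OF conc integral_mono] Bochner_Integration.integrable_add j1 j2 j3) auto
    also have "\<dots> = (M ^ 3 / c * (\<integral>p. w p * laplacian \<phi> p \<partial>lborel) + (\<integral>p. w p ^ 6 \<partial>lborel) / M\<^sup>2)
        + M ^ 4 * (measure lborel B1 + measure lborel B2)"
      unfolding Bochner_Integration.integral_add[OF Bochner_Integration.integrable_add[OF j1 j2] j3]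
        Bochner_Integration.integral_add[OF j1 j2]
      using Bi by (simp add: B1_def B2_def)
    also have "M ^ 3 / c * (\<integral>p. w p * laplacian \<phi> p \<partial>lborel) \<le> M ^ 3 / c * ((1 + energy \<phi>) / 2 * sqrt d)"
      using M(1) c by (intro mult_left_mono X) auto
    also have "M ^ 3 / c * ((1 + energy \<phi>) / 2 * sqrt d) \<le> 1 / 8" using dC by (simp add: C_def)
    also have "(\<integral>p. w p ^ 6 \<partial>lborel) / M\<^sup>2 \<le> K / M\<^sup>2" by (intro divide_right_mono w6) auto
    also have "K / M\<^sup>2 = 1 / 8" using K by (simp add: M(2))
    also have "M ^ 4 * (measure lborel B1 + measure lborel B2) \<le> 1 / 8" using \<eta>M by (simp add: Bm mult_ac)
    finally show False by simp
  qed
  with d(1) show ?thesis by blast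
qed

section \<open>Moving test functions of the strip into the perforated rectangle\<close>

lemma energy_translate:
  assumes "smooth f"
  shows "energy (\<lambda>p. f (p + c)) = energy f"
proof -
  have "(\<lambda>p. (dx f p)\<^sup>2 + (dy f p)\<^sup>2) \<in> borel_measurable borel"
    using assms by (intro borel_measurable_continuous_onI smooth_continuous_on smooth_intros)
  from integral_translate[OF this, of c] show ?thesis
    by (simp add: energy_def partial_deriv_translate assms)
qed

lemma test_functions_translate:
  assumes "\<phi> \<in> test_functions \<Omega>"
  shows "(\<lambda>p. \<phi> (p + c)) \<in> test_functions ((\<lambda>p. p - c) ` \<Omega>)"
proof -
  obtain K where K: "smooth \<phi>" "compact K" "K \<subseteq> \<Omega>" "\<And>x. x \<notin> K \<Longrightarrow> \<phi> x = 0"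
    using assms by (rule test_functionsE) blast
  show ?thesis
  proof (rule test_functionsI)
    show "compact ((\<lambda>p. p - c) ` K)" using K(2) by (intro compact_continuous_image continuous_intros)
    show "\<phi> (x + c) = 0" if "x \<notin> (\<lambda>p. p - c) ` K" for x
      using that K(4)[of "x + c"] by (metis add_diff_cancel image_eqI)
  qed (use K in \<open>auto intro: smooth_translate\<close>)
qed

lemma Omega_eq: "Omega h R = ({-R<..<R} \<times> {-h<..<h}) - cball 0 1"
  by (simp add: Omega_def Q_rect_def)

lemma symmetric_plane_domain_Omega: "symmetric_plane_domain (Omega h R)"
proof
  show "open (Omega h R)" unfolding Omega_eq by (intro open_Diff open_Times) auto
  have "bounded ({-R<..<R} \<times> {-h<..<h})" by (intro bounded_Times) auto
  then show "bounded (Omega h R)" unfolding Omega_eq by (rule bounded_subset) blast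
  fix p assume "p \<in> Omega h R"
  then have "fst p \<in> {-R<..<R}" "snd p \<in> {-h<..<h}" "\<not> norm p \<le> 1" unfolding Omega_eq by auto
  then have "fst (reflect_x p) \<in> {-R<..<R}" "snd (reflect_x p) \<in> {-h<..<h}" "\<not> norm (reflect_x p) \<le> 1"
    unfolding norm_reflect_x by (simp_all add: reflect_x_def)
  then show "reflect_x p \<in> Omega h R" unfolding Omega_eq by (simp add: mem_Times_iff)
qed

text \<open>A support contained in \<bar>x\<bar> \<le> r is shifted into 2 \<le> x \<le> 2 r + 2,
  clear of the unit disk; one function then serves all larger \<open>R\<close>.\<close>

lemma strip_translate_Omega:
  assumes \<phi>: "\<phi> \<in> test_functions (strip h)"
  obtains R\<^sub>0 \<psi> where "0 < R\<^sub>0" "\<And>R. R\<^sub>0 < R \<Longrightarrow> \<psi> \<in> test_functions (Omega h R)" "quartic \<psi> = quartic \<phi>" "energy \<psi> = energy \<phi>"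
proof -
  obtain K where K: "smooth \<phi>" "compact K" "K \<subseteq> strip h" "\<And>x. x \<notin> K \<Longrightarrow> \<phi> x = 0"
    using \<phi> by (rule test_functionsE) blast
  obtain r where r: "0 < r" "\<And>p. p \<in> K \<Longrightarrow> norm p \<le> r"
    using compact_imp_bounded[OF K(2)] unfolding bounded_pos by blast
  define c where "c = (- (r + 2), 0::real)"
  define \<psi> where "\<psi> p = \<phi> (p + c)" for p
  have K1: "\<phi> \<in> test_functions (strip h \<inter> {p. \<bar>fst p\<bar> \<le> r})"
  proof (rule test_functionsI[OF K(1,2) _ K(4)])
    show "K \<subseteq> strip h \<inter> {p. \<bar>fst p\<bar> \<le> r}"
    proof
      fix p assume "p \<in> K"
      then show "p \<in> strip h \<inter> {p. \<bar>fst p\<bar> \<le> r}" using K(3) r(2)[of p] norm_fst_le[of "fst p" "snd p"] by auto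
    qed
  qed
  show ?thesis
  proof (rule that[of "2 * r + 2" \<psi>])
    show "0 < 2 * r + 2" using r(1) by simp
    show "\<psi> \<in> test_functions (Omega h R)" if "2 * r + 2 < R" for R
    proof (rule test_functions_mono)
      show "\<psi> \<in> test_functions ((\<lambda>p. p - c) ` (strip h \<inter> {p. \<bar>fst p\<bar> \<le> r}))"
        unfolding \<psi>_def[abs_def] by (rule test_functions_translate[OF K1])
      show "(\<lambda>p. p - c) ` (strip h \<inter> {p. \<bar>fst p\<bar> \<le> r}) \<subseteq> Omega h R"
      proof (rule image_subsetI)
        fix p assume "p \<in> strip h \<inter> {p. \<bar>fst p\<bar> \<le> r}"
        then obtain x y where p: "p = (x, y)" and a: "\<bar>x\<bar> \<le> r" "- h < y" "y < h"
          by (cases p) (auto simp: strip_def)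
        have eq: "(x, y) - c = (x + (r + 2), y)" by (simp add: c_def)
        have "\<bar>x + (r + 2)\<bar> \<le> norm (x + (r + 2), y)" using norm_fst_le[of "x + (r + 2)" y] by simp
        then have "\<not> norm (x + (r + 2), y) \<le> 1" using a(1) by linarith
        then show "p - c \<in> Omega h R" using a that unfolding p Omega_eq eq by auto
      qed
    qed
    have "(\<lambda>p. \<phi> p ^ 4) \<in> borel_measurable borel"
      using K(1) by (intro borel_measurable_continuous_onI smooth_continuous_on smooth_power)
    from integral_translate[OF this, of c] show "quartic \<psi> = quartic \<phi>" by (simp add: \<psi>_def)
    show "energy \<psi> = energy \<phi>" unfolding \<psi>_def[abs_def] by (rule energy_translate[OF K(1)])
  qed
qed

section \<open>Comparison of the two constants\<close>

lemma quartic_nonzero_point: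
  assumes "0 < quartic \<psi>"
  obtains p where "\<psi> p \<noteq> 0"
  using assms by (cases "\<forall>p. \<psi> p = 0") (auto simp del: split_paired_All split_paired_Ex)

theorem theorem3p1:
  fixes h :: real
  assumes "h > 1"
  shows "\<exists>R0>0. \<forall>R>R0. R > h \<longrightarrow>
           S_Re h R > S_R h R \<and>
           (\<forall>v. is_arg_min (sobolev_quotient (Omega h R))
                   (\<lambda>w. w \<in> H1_0 (Omega h R) \<and> \<not> ae_zero (Omega h R) w) v
                \<longrightarrow> \<not> even_x (Omega h R) v)"
proof -
  have h: "0 < h" using assms by simp
  obtain S where S: "0 < S" "\<And>\<phi>. \<phi> \<in> test_functions (strip h) \<Longrightarrow> S * sqrt (quartic \<phi>) \<le> energy \<phi>"
    "\<And>\<eta>. 0 < \<eta> \<Longrightarrow> \<exists>\<phi>\<in>test_functions (strip h). 0 < quartic \<phi> \<and> energy \<phi> < (S + \<eta>) * sqrt (quartic \<phi>)"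
    by (rule strip_constant[OF h]) blast
  obtain d where d: "0 < d" "\<And>u. u \<in> test_functions (strip h - cball 0 1) \<Longrightarrow> (\<And>p. u (reflect_x p) = u p) \<Longrightarrow>
    0 < quartic u \<Longrightarrow> (S + d) * sqrt (quartic u) \<le> energy u"
    using even_gap[OF h S(1,2)] by blast
  \<comment> \<open>The gap \<open>d\<close> is independent of \<open>R\<close>, so one strip
    function within \<open>d\<close> of optimal suffices, and its support alone determines the
    threshold for \<open>R\<close>.\<close>
  obtain \<phi> where \<phi>: "\<phi> \<in> test_functions (strip h)" "0 < quartic \<phi>" "energy \<phi> < (S + d) * sqrt (quartic \<phi>)"
    using S(3)[OF d(1)] by blast
  obtain R\<^sub>0 \<psi> where R0: "0 < R\<^sub>0" "\<And>R. R\<^sub>0 < R \<Longrightarrow> \<psi> \<in> test_functions (Omega h R)"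
    and \<psi>: "quartic \<psi> = quartic \<phi>" "energy \<psi> = energy \<phi>"
    by (rule strip_translate_Omega[OF \<phi>(1)]) blast
  obtain p where p: "\<psi> p \<noteq> 0" by (rule quartic_nonzero_point[of \<psi>]) (use \<phi>(2) \<psi>(1) in auto)
  have "S_Re h R > S_R h R \<and> (\<forall>v. is_arg_min (sobolev_quotient (Omega h R))
      (\<lambda>w. w \<in> H1_0 (Omega h R) \<and> \<not> ae_zero (Omega h R) w) v \<longrightarrow> \<not> even_x (Omega h R) v)"
    if R: "R\<^sub>0 < R" "h < R" for R
  proof -
    interpret symmetric_plane_domain "Omega h R" by (rule symmetric_plane_domain_Omega)
    have sub: "Omega h R \<subseteq> strip h - cball 0 1" by (auto simp: Omega_eq strip_def)
    obtain I u where I: "\<And>\<psi>. \<psi> \<in> TF \<Longrightarrow> I * sqrt (quartic \<psi>) \<le> energy \<psi>"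
      and u: "u \<in> H1_0 (Omega h R)" "\<not> ae_zero (Omega h R) u" "sobolev_quotient (Omega h R) u = I"
      and Imin: "\<And>v. v \<in> H1_0 (Omega h R) \<Longrightarrow> \<not> ae_zero (Omega h R) v \<Longrightarrow> I \<le> sobolev_quotient (Omega h R) v"
      by (rule sobolev_attained[OF R0(2)[OF R(1)] p]) blast
    have "I * sqrt (quartic \<psi>) \<le> energy \<psi>" by (rule I[OF R0(2)[OF R(1)]])
    also have "\<dots> < (S + d) * sqrt (quartic \<psi>)" using \<phi>(3) \<psi> by simp
    finally have ISd: "I < S + d" by (rule mult_right_less_imp_less) simp
    \<comment> \<open>The even class needs a nonzero member; squaring before symmetrizing excludes
      cancellation between the two halves.\<close>
    define \<sigma> where "\<sigma> = symmetrize (\<lambda>p. \<psi> p * \<psi> p)"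
    have \<sigma>: "\<sigma> \<in> TF"
      unfolding \<sigma>_def using R0(2)[OF R(1)] by (intro symmetrize_TF test_functions_mult test_functions_smooth)
    have \<sigma>p: "\<sigma> p \<noteq> 0" using p by (simp add: \<sigma>_def symmetrize_def add_nonneg_eq_0_iff)
    have \<sigma>r: "\<sigma> (reflect_x p) = \<sigma> p" for p by (simp add: \<sigma>_def symmetrize_def)
    have low: "(S + d) * sqrt (quartic \<psi>) \<le> energy \<psi>"
      if "\<psi> \<in> TF" "\<And>p. \<psi> (reflect_x p) = \<psi> p" "0 < quartic \<psi>" for \<psi>
      by (rule d(2)[OF test_functions_mono[OF sub that(1)] that(2,3)])
    obtain J w where J: "S + d \<le> J" and w: "w \<in> H1_0 (Omega h R)" "even_x (Omega h R) w" "\<not> ae_zero (Omega h R) w"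
      "sobolev_quotient (Omega h R) w = J"
      and Jmin: "\<And>v. v \<in> H1_0 (Omega h R) \<Longrightarrow> even_x (Omega h R) v \<Longrightarrow> \<not> ae_zero (Omega h R) v \<Longrightarrow> J \<le> sobolev_quotient (Omega h R) v"
      by (rule even_sobolev_attained[OF \<sigma> \<sigma>p \<sigma>r low]) (assumption+, rule that)
    \<comment> \<open>Attainment together with the lower bound identifies the \<open>LEAST\<close>
      expressions.\<close>
    have "S_R h R = I" unfolding S_R_def using u Imin by (intro Least_equality) auto
    moreover have "S_Re h R = J" unfolding S_Re_def H1_0e_def using w Jmin by (intro Least_equality) auto
    moreover have "\<not> even_x (Omega h R) v"
      if "is_arg_min (sobolev_quotient (Omega h R)) (\<lambda>w. w \<in> H1_0 (Omega h R) \<and> \<not> ae_zero (Omega h R) w) v" for v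
    proof
      assume ev: "even_x (Omega h R) v"
      \<comment> \<open>A minimizer does no worse than \<open>u\<close>, whose quotient
        \<open>I\<close> is below S + d, whereas an even function has quotient at least
        \<open>J\<close> \<ge> S + d.\<close>
      have v: "v \<in> H1_0 (Omega h R)" "\<not> ae_zero (Omega h R) v" "\<not> sobolev_quotient (Omega h R) u < sobolev_quotient (Omega h R) v"
        using that u by (auto simp: is_arg_min_def)
      then show False using Jmin[OF v(1) ev v(2)] u(3) J ISd by linarith
    qed
    ultimately show ?thesis using J ISd by auto
  qed
  then show ?thesis using R0(1) by blast
qed

end
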